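(* Let $t\ge 1$ be an integer, $g=2t+1$, and $\mathbf{x}=(x_1,\dots,x_t)$ be independent variables. Then $$\sum_{\omega\in\mathcal{DD}_{(g)}} (-1)^{|H_{<g,+}|+|H_{<g,+}\cap \Delta|}\,T^{|\omega|/2}\,\mathrm{so}_{\mu}(\mathbf{x})=(T;T)_\infty^t\,K_T(t,\mathbf{x})\prod_{i=1}^t (Tx_i;T)_\infty (Tx_i^{-1};T)_\infty(Tx_i^{2};T^2)_\infty(Tx_i^{-2};T^2)_\infty,$$ where the sum runs over all doubled distinct partitions $\omega$ that are $g$-cores, $\Delta$ is the main diagonal of $\omega$, $H_{<g,+}=\{s\in\omega\mid h_s<g,\ \varepsilon_s=1\}$, and $\mu=\mu(\omega)$ is the partition given by $\mu_i=v_i+i-g$ for $1\le i\le t$, with $\mathbf{v}$ the $V_{g,t}$-coding of $\omega$.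
   Context: $(a;T)_\infty=\prod_{j\ge0}(1-aT^j)$, and $K_T(t,\mathbf{x})=\prod_{1\le i<j\le t}(Tx_ix_j;T)_\infty(Tx_ix_j^{-1};T)_\infty(Tx_i^{-1}x_j;T)_\infty(Tx_i^{-1}x_j^{-1};T)_\infty$. The identity is between formal power series in $T$ with Laurent polynomial coefficients in the $x_i$. For a partition $\lambda$, $h_s$ is the hook length of a box $s$, $d_\lambda=\max\{s:\lambda_s\ge s\}$, $\Delta$ is the set of boxes on the main diagonal of the Ferrers diagram (English convention), and $\varepsilon_s=-1$ if $s$ is strictly below the main diagonal, $\varepsilon_s=1$ otherwise. A $g$-core is a partition with no hook length divisible by $g$. $\mathcal{DD}$ is the set of partitions with $\lambda_i=\lambda'_i+1$ for $1\le i\le d_\lambda$ ($\lambda'$ the conjugate; the empty partition included), and $\mathcal{DD}_{(g)}$ is the set of $g$-cores in $\mathcal{DD}$. Word of a partition: $\psi(\lambda)=(c_k)_{k\in\mathbb{Z}}\in\{0,1\}^{\mathbb{Z}}$ encodes the border of the Ferrers diagram read from South-West to North-East ($0$ vertical step, $1$ horizontal step), indexed so that $\#\{k\le -1: c_k=1\}=\#\{k\ge 0: c_k=0\}$; equivalently $c_k=0$ iff $k=\lambda_i-i$ for some $i\ge1$ (with $\lambda_i=0$ beyond the length). $V_{g,t}$-coding: for $i\in\{0,\dots,g-1\}$ let $\beta_i=\max\{(k+1)g+i\mid k\in\mathbb{Z},\ c_{kg+i}=0\}$; the $V_{g,t}$-coding is $\mathbf{v}=(v_1>\dots>v_t)$,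 the $t$ largest of the distinct integers $\beta_0,\dots,\beta_{g-1}$ in decreasing order. Odd orthogonal character: $\mathrm{so}_\mu(\mathbf{x})=\dfrac{\det_{1\le i,j\le t}\big(x_i^{\mu_j+t-j+1}-x_i^{-(\mu_j+t-j)}\big)}{\det_{1\le i,j\le t}\big(x_i^{t-j+1}-x_i^{-(t-j)}\big)}$. *)

theory Defs
  imports
    "HOL-Library.Poly_Mapping"
    "HOL-Computational_Algebra.Computational_Algebra"
    "HOL-Analysis.Infinite_Sum"
    "HOL-Analysis.Infinite_Products"
    "Jordan_Normal_Form.Determinant"
begin

section \<open>Partitions\<close>

definition partitions :: "nat list set" where
  "partitions = {\<nu>. sorted_wrt (\<ge>) \<nu> \<and> 0 \<notin> set \<nu>}"

text \<open>Parts are numbered from 1, and they are 0 beyond the length.\<close>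

definition part :: "nat list \<Rightarrow> nat \<Rightarrow> nat" where
  "part \<nu> i = (if 1 \<le> i \<and> i \<le> length \<nu> then \<nu> ! (i - 1) else 0)"

definition conj_part :: "nat list \<Rightarrow> nat \<Rightarrow> nat" where
  "conj_part \<nu> j = card {i. 1 \<le> i \<and> i \<le> length \<nu> \<and> j \<le> part \<nu> i}"

text \<open>Ferrers diagram in English convention: the pair \<open>(i, j)\<close> is the box in row \<open>i\<close> (counted
  downwards) and column \<open>j\<close>.\<close>

definition boxes :: "nat list \<Rightarrow> (nat \<times> nat) set" where
  "boxes \<nu> = {(i, j). 1 \<le> i \<and> i \<le> length \<nu> \<and> 1 \<le> j \<and> j \<le> part \<nu> i}"

text \<open>Arm plus leg plus 1; neither subtraction truncates on the boxes of the diagram.\<close>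

definition hook :: "nat list \<Rightarrow> nat \<times> nat \<Rightarrow> nat" where
  "hook \<nu> = (\<lambda>(i, j). (part \<nu> i - j) + (conj_part \<nu> j - i) + 1)"

definition diag :: "nat list \<Rightarrow> (nat \<times> nat) set" where
  "diag \<nu> = {(i, j) \<in> boxes \<nu>. i = j}"

definition eps :: "nat \<times> nat \<Rightarrow> int" where
  "eps = (\<lambda>(i, j). if i > j then - 1 else 1)"

text \<open>The inserted 0 gives the value 0 for the empty partition.\<close>

definition durfee :: "nat list \<Rightarrow> nat" where
  "durfee \<nu> = Max (insert 0 {s. 1 \<le> s \<and> s \<le> part \<nu> s})"

definition core :: "nat \<Rightarrow> nat list \<Rightarrow> bool" where
  "core g \<nu> \<longleftrightarrow> (\<forall>s \<in> boxes \<nu>. \<not> g dvd hook \<nu> s)"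

definition DD :: "nat list set" where
  "DD = {\<nu> \<in> partitions. \<forall>i \<in> {1..durfee \<nu>}. part \<nu> i = conj_part \<nu> i + 1}"

definition DD_cores :: "nat \<Rightarrow> nat list set" where
  "DD_cores g = {\<nu> \<in> DD. core g \<nu>}"

definition H_small_pos :: "nat \<Rightarrow> nat list \<Rightarrow> (nat \<times> nat) set" where
  "H_small_pos g \<nu> = {s \<in> boxes \<nu>. hook \<nu> s < g \<and> eps s = 1}"


section \<open>Words and the \<open>V\<^bsub>g,t\<^esub>\<close>-coding\<close>

text \<open>The border is read from South-West to North-East; the vertical step (letter 0) at the end of
  row \<open>i\<close> has index \<open>\<nu>\<^sub>i - i\<close>. Rows beyond the length contribute the infinite
  initial run of letters 0.\<close>

definition word :: "nat list \<Rightarrow> int \<Rightarrow> nat" where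
  "word \<nu> k = (if \<exists>i\<ge>1. k = int (part \<nu> i) - int i then 0 else 1)"

text \<open>The set is bounded above but not finite, hence \<^const>\<open>Greatest\<close> instead of \<^const>\<open>Max\<close>.\<close>

definition beta :: "nat \<Rightarrow> nat list \<Rightarrow> nat \<Rightarrow> int" where
  "beta g \<nu> i =
     (GREATEST b. \<exists>k. b = (k + 1) * int g + int i \<and> word \<nu> (k * int g + int i) = 0)"

definition V_coding :: "nat \<Rightarrow> nat \<Rightarrow> nat list \<Rightarrow> int list" where
  "V_coding g t \<nu> = take t (rev (sorted_list_of_set (beta g \<nu> ` {0..<g})))"

text \<open>\<open>v\<^sub>i\<close> is entry \<open>i - 1\<close> of the list. The values are integers, so that the subtraction does not truncate.\<close>

definition mu :: "nat \<Rightarrow> nat \<Rightarrow> nat list \<Rightarrow> nat \<Rightarrow> int" where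
  "mu g t \<nu> i = V_coding g t \<nu> ! (i - 1) + int i - int g"


section \<open>Laurent polynomials, characters and products\<close>

text \<open>A monomial is a finitely supported exponent vector with entries in \<open>\<int>\<close>, so
  \<open>laurent\<close> is the ring of integer Laurent polynomials in \<open>x\<^sub>0, x\<^sub>1, x\<^sub>2, \<dots>\<close>; it is an
  integral domain. Quotients of Laurent polynomials are formed in its field of fractions.\<close>

type_synonym laurent = "(nat \<Rightarrow>\<^sub>0 int) \<Rightarrow>\<^sub>0 int"

definition indet :: "nat \<Rightarrow> laurent fract" where
  "indet i = to_fract (Poly_Mapping.single (Poly_Mapping.single i 1) 1)"

text \<open>Matrix indices start at 0, the indices of \<open>x\<close> and \<open>\<mu>\<close> at 1.\<close>

definition so_det :: "nat \<Rightarrow> (nat \<Rightarrow> 'a::field) \<Rightarrow> (nat \<Rightarrow> int) \<Rightarrow> 'a" where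
  "so_det t x \<mu> = Determinant.det (Matrix.mat t t (\<lambda>(i, j).
     x (i + 1) powi (\<mu> (j + 1) + int t - int (j + 1) + 1)
     - x (i + 1) powi (- (\<mu> (j + 1) + int t - int (j + 1)))))"

definition so_char :: "nat \<Rightarrow> (nat \<Rightarrow> 'a::field) \<Rightarrow> (nat \<Rightarrow> int) \<Rightarrow> 'a" where
  "so_char t x \<mu> = so_det t x \<mu> / so_det t x (\<lambda>_. 0)"

text \<open>\<open>(a; q)\<^sub>\<infinity>\<close>, the limit being taken in the \<open>T\<close>-adic topology of the library
  (\<open>T\<close> is \<^const>\<open>fps_X\<close>).\<close>

definition qpoch_inf :: "'a::field fps \<Rightarrow> 'a fps \<Rightarrow> 'a fps" where
  "qpoch_inf a q = prodinf (\<lambda>j. 1 - a * q ^ j)"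

definition K_prod :: "nat \<Rightarrow> (nat \<Rightarrow> 'a::field) \<Rightarrow> 'a fps" where
  "K_prod t x = (\<Prod>(i, j) \<in> {(i, j). 1 \<le> i \<and> i < j \<and> j \<le> t}.
     qpoch_inf (fps_X * fps_const (x i * x j)) fps_X
     * qpoch_inf (fps_X * fps_const (x i * inverse (x j))) fps_X
     * qpoch_inf (fps_X * fps_const (inverse (x i) * x j)) fps_X
     * qpoch_inf (fps_X * fps_const (inverse (x i) * inverse (x j))) fps_X)"

end

theory Submission
  imports Defs "HOL-Algebra.Algebraic_Closure_Type" "HOL-Number_Theory.Totient"
begin

text \<open>The product side is the Macdonald product of type \<open>A\<^sub>2\<^sub>t\<^sup>(\<^sup>2\<^sup>)\<close>. Multiplied by
  the Weyl denominator, it becomes in each variable a quasi-periodic function of degree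
  \<open>g\<close> with a reflection symmetry, and such functions form the span of \<open>t\<close> theta series
  \<open>\<Theta>\<^sub>1, \<dots>, \<Theta>\<^sub>t\<close>. This span also contains the determinant of \<open>\<Theta>\<^sub>j (x\<^sub>i)\<close>; both vanish when two variables coincide, so
  moving one variable at a time shows that they are proportional. The factor is found by moving all
  variables to powers of a primitive \<open>g\<close>-th root of unity, where both sides factor and the Jacobi triple
  product applies.

  The expanded determinant is a sum over \<open>\<int>\<^sup>t\<close>. The beads (letters 0) of a doubled distinct \<open>g\<close>-core
  are on each runner modulo \<open>g\<close> those below some bound \<open>\<beta>\<^sub>r\<close>, where \<open>\<beta>\<^sub>0 = 0\<close> and \<open>\<beta>\<^sub>r + \<beta>\<^bsub>g-r\<^esub> = g\<close>;
  this identifies the cores with \<open>\<int>\<^sup>t\<close>. Sorting the larger one of each pair \<open>\<beta>\<^sub>r, \<beta>\<^bsub>g-r\<^esub>\<close> turns a summand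
  into the numerator of a character, up to a sign that agrees with the parity of the number of small hooks.\<close>

text \<open>The variables are treated as points of a field: the identity is proved for every tuple
  of nonzero constants in general position, and the indeterminates are one such tuple. The roots of
  unity to which they are moved do not lie in the field of fractions of the Laurent polynomials.
  Hence the argument runs over its algebraic closure, and the result is pulled back along the
  inclusion. Proportionality of two points is stated as an equality of cross products. Passing to
  the next intermediate point cancels the product side there; it is nonzero because its constant
  term in T is a product form of the Weyl denominator, which does not vanish as long as no variable
  is itself a g-th root of unity. The constant term in T of the same proportionality also compares
  the determinant form of the Weyl denominator with the product form. At the roots of unity the
  double product over pairs is known only through its square; constant term 1 selects the root. This
  choice and the averaging over the reflection rely on characteristic different from 2.\<close>

unbundle no vec_syntax
no_notation vec_index (infixl "$" 100)

section \<open>Formal power series as a topological ring\<close>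

instance fps :: (ab_group_add) topological_comm_monoid_add
proof
  fix a b :: "'a fps"
  show "((\<lambda>x. fst x + snd x) \<longlongrightarrow> a + b) (nhds a \<times>\<^sub>F nhds b)"
  proof (rule tendsto_fpsI)
    fix n
    show "\<forall>\<^sub>F x in nhds a \<times>\<^sub>F nhds b. (fst x + snd x) $ n = (a + b) $ n"
      by (rule eventually_prodI[THEN eventually_mono,
            OF eventually_fps_nth_eq_nhds_fps[of n] eventually_fps_nth_eq_nhds_fps[of n]]) auto
  qed
qed

instance fps :: (ab_group_add) topological_ab_group_add
proof
  fix a :: "'a fps"
  show "(uminus \<longlongrightarrow> - a) (nhds a)"
  proof (rule tendsto_fpsI)
    fix n
    show "\<forall>\<^sub>F x in nhds a. (- x) $ n = (- a) $ n"
      by (rule eventually_mono[OF eventually_fps_nth_eq_nhds_fps[of n]]) auto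
  qed
qed

text \<open>Coefficient n of a product depends only on the coefficients up to n of the factors, and
  these are locally constant in the T-adic topology. With these instances the general rules for
  limits and for \<open>has_sum\<close> apply to power series.\<close>

instance fps :: (comm_ring_1) topological_semigroup_mult
proof
  fix a b :: "'a fps"
  show "((\<lambda>x. fst x * snd x) \<longlongrightarrow> a * b) (nhds a \<times>\<^sub>F nhds b)"
  proof (rule tendsto_fpsI)
    fix n
    show "\<forall>\<^sub>F x in nhds a \<times>\<^sub>F nhds b. (fst x * snd x) $ n = (a * b) $ n"
      by (rule eventually_prodI[THEN eventually_mono,
            OF eventually_fps_nth_eq_nhds_fps_strong[of n] eventually_fps_nth_eq_nhds_fps_strong[of n]])
         (auto simp: fps_mult_nth intro!: sum.cong)
  qed
qed

section \<open>Infinite sums of formal power series\<close>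

text \<open>Any finite set outside which coefficient n vanishes may serve as a witness, so the exact
  support does not have to be determined.\<close>

lemma has_sum_fpsI':
  fixes f :: "'i \<Rightarrow> 'a::ab_group_add fps"
  assumes "\<And>n. \<exists>F. finite F \<and> F \<subseteq> A \<and> (\<forall>i\<in>A - F. f i $ n = 0) \<and> S $ n = (\<Sum>i\<in>F. f i $ n)"
  shows "(f has_sum S) A"
proof (rule has_sum_fpsI)
  fix n
  obtain F where F: "finite F" "F \<subseteq> A" "\<forall>i\<in>A - F. f i $ n = 0" "S $ n = (\<Sum>i\<in>F. f i $ n)"
    using assms by blast
  have sub: "{x \<in> A. f x $ n \<noteq> 0} \<subseteq> F" using F by auto
  show "finite {x \<in> A. f x $ n \<noteq> 0}" using sub F(1) by (rule finite_subset)
  show "S $ n = (\<Sum>x | x \<in> A \<and> f x $ n \<noteq> 0. f x $ n)"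
    unfolding F(4) using F(1) by (intro sum.mono_neutral_right sub) (use F in auto)
qed

lemma has_sum_fps_nth:
  fixes f :: "'i \<Rightarrow> 'a::ab_group_add fps"
  assumes "(f has_sum S) A" "finite F" "F \<subseteq> A" "\<And>i. i \<in> A - F \<Longrightarrow> f i $ n = 0"
  shows "S $ n = (\<Sum>i\<in>F. f i $ n)"
  unfolding has_sum_fpsD(2)[OF assms(1), of n]
  by (rule sum.mono_neutral_left) (use assms in auto)

lemma summable_on_fps_iff:
  fixes f :: "'i \<Rightarrow> 'a::ab_group_add fps"
  shows "f summable_on A \<longleftrightarrow> (\<forall>n. finite {x \<in> A. f x $ n \<noteq> 0})"
proof
  assume "f summable_on A"
  then show "\<forall>n. finite {x \<in> A. f x $ n \<noteq> 0}"
    unfolding summable_on_def using has_sum_fpsD(1) by blast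
next
  assume "\<forall>n. finite {x \<in> A. f x $ n \<noteq> 0}"
  then have "(f has_sum Abs_fps (\<lambda>n. \<Sum>x | x \<in> A \<and> f x $ n \<noteq> 0. f x $ n)) A"
    by (intro has_sum_fpsI) auto
  then show "f summable_on A" by (auto simp: summable_on_def)
qed

text \<open>Only coefficients up to n of the factors enter coefficient n of a product. The indices
  with a nonzero coefficient up to n form finite sets \<open>F\<close> and \<open>G\<close>, and
  outside \<open>F \<times> G\<close> one factor starts beyond degree n.\<close>

lemma has_sum_fps_mult:
  fixes f :: "'i \<Rightarrow> 'a::comm_ring_1 fps" and g :: "'j \<Rightarrow> 'a fps"
  assumes f: "(f has_sum a) A" and g: "(g has_sum b) B"
  shows "((\<lambda>(i, j). f i * g j) has_sum (a * b)) (A \<times> B)"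
proof (rule has_sum_fpsI')
  fix n
  define F where "F = (\<Union>k\<le>n. {i\<in>A. f i $ k \<noteq> 0})"
  define G where "G = (\<Union>k\<le>n. {i\<in>B. g i $ k \<noteq> 0})"
  have fin: "finite F" "finite G"
    unfolding F_def G_def using has_sum_fpsD(1)[OF f] has_sum_fpsD(1)[OF g] by auto
  have sub: "F \<subseteq> A" "G \<subseteq> B" unfolding F_def G_def by auto
  have F0: "f i $ k = 0" if "i \<in> A - F" "k \<le> n" for i k using that unfolding F_def by auto
  have G0: "g i $ k = 0" if "i \<in> B - G" "k \<le> n" for i k using that unfolding G_def by auto
  have an: "a $ k = (\<Sum>i\<in>F. f i $ k)" if "k \<le> n" for k
    by (rule has_sum_fps_nth[OF f fin(1) sub(1)]) (use F0 that in auto)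
  have bn: "b $ k = (\<Sum>i\<in>G. g i $ k)" if "k \<le> n" for k
    by (rule has_sum_fps_nth[OF g fin(2) sub(2)]) (use G0 that in auto)
  have "(a * b) $ n = (\<Sum>k=0..n. a $ k * b $ (n - k))" by (rule fps_mult_nth)
  also have "\<dots> = (\<Sum>k=0..n. (\<Sum>i\<in>F. f i $ k) * (\<Sum>j\<in>G. g j $ (n - k)))"
    by (intro sum.cong refl) (simp add: an bn)
  also have "\<dots> = (\<Sum>k=0..n. (\<Sum>(i, j)\<in>F \<times> G. f i $ k * g j $ (n - k)))"
    by (simp add: sum_product sum.cartesian_product)
  also have "\<dots> = (\<Sum>(i, j)\<in>F \<times> G. (f i * g j) $ n)"
    by (subst sum.swap) (simp add: fps_mult_nth case_prod_unfold)
  finally have S: "(a * b) $ n = (\<Sum>x\<in>F \<times> G. (case x of (i, j) \<Rightarrow> f i * g j) $ n)"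
    by (simp add: case_prod_unfold)
  have "(f i * g j) $ n = 0" if "(i, j) \<in> A \<times> B - F \<times> G" for i j
    unfolding fps_mult_nth by (rule sum.neutral) (use that F0 G0 in auto)
  then show "\<exists>H. finite H \<and> H \<subseteq> A \<times> B \<and>
        (\<forall>i\<in>A \<times> B - H. (case i of (i, j) \<Rightarrow> f i * g j) $ n = 0) \<and>
        (a * b) $ n = (\<Sum>i\<in>H. (case i of (i, j) \<Rightarrow> f i * g j) $ n)"
    using fin sub S by (intro exI[of _ "F \<times> G"]) auto
qed

text \<open>Expands a finite product of infinite sums into one sum over choice functions; it turns
  the theta determinant into a sum over integer vectors. In the induction, a function on the
  enlarged index set is a value at the new index together with a function on the old set.\<close>

lemma has_sum_fps_PiE:
  fixes f :: "'i \<Rightarrow> 'j \<Rightarrow> 'a::comm_ring_1 fps"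
  assumes "finite I" "\<And>i. i \<in> I \<Longrightarrow> (f i has_sum s i) (A i)"
  shows "((\<lambda>n. \<Prod>i\<in>I. f i (n i)) has_sum (\<Prod>i\<in>I. s i)) (PiE I A)"
  using assms
proof (induction I rule: finite_induct)
  case empty
  show ?case by (auto intro!: has_sum_finiteI)
next
  case (insert x I)
  define h where "h = (\<lambda>(y, g). g(x := y) :: 'i \<Rightarrow> 'j)"
  have inj: "inj_on h (A x \<times> PiE I A)"
  proof (rule inj_onI)
    fix u v assume uv: "u \<in> A x \<times> PiE I A" "v \<in> A x \<times> PiE I A" "h u = h v"
    obtain a b c d where u: "u = (a, b)" "v = (c, d)" by (cases u, cases v) auto
    have "b(x := a) = d(x := c)" using uv u by (simp add: h_def)
    then have "a = c" and "\<And>i. i \<noteq> x \<Longrightarrow> b i = d i" by (metis fun_upd_same, metis fun_upd_other)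
    moreover have "b x = d x"
      using uv u insert(2) PiE_arb[of b I A x] PiE_arb[of d I A x] by auto
    ultimately show "u = v" using u by (metis ext)
  qed
  have im: "PiE (Set.insert x I) A = h ` (A x \<times> PiE I A)"
    unfolding h_def by (rule PiE_insert_eq)
  have "((\<lambda>(y, n). f x y * (\<Prod>i\<in>I. f i (n i))) has_sum (s x * (\<Prod>i\<in>I. s i))) (A x \<times> PiE I A)"
    by (intro has_sum_fps_mult insert) (use insert in auto)
  also have "?this \<longleftrightarrow> (((\<lambda>n. \<Prod>i\<in>Set.insert x I. f i (n i)) \<circ> h) has_sum (s x * (\<Prod>i\<in>I. s i)))
      (A x \<times> PiE I A)"
  proof (rule has_sum_cong)
    fix u assume "u \<in> A x \<times> PiE I A"
    obtain y n where u: "u = (y, n)" by (cases u)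
    have "(\<Prod>i\<in>I. f i (n i)) = (\<Prod>i\<in>I. f i ((n(x := y)) i))"
      by (rule prod.cong) (use insert(2) in auto)
    then show "(case u of (y, n) \<Rightarrow> f x y * (\<Prod>i\<in>I. f i (n i))) =
        ((\<lambda>n. \<Prod>i\<in>Set.insert x I. f i (n i)) \<circ> h) u"
      using insert(1,2) by (simp add: u h_def)
  qed
  finally show ?case using insert(1,2) by (simp add: im has_sum_reindex[OF inj])
qed

text \<open>In each coefficient this is the regrouping of a finite sum. It serves to collect equal
  powers of x and to sort exponents by residue classes.\<close>

lemma has_sum_fps_fibres:
  fixes f :: "'i \<Rightarrow> 'a::ab_group_add fps"
  assumes f: "(f has_sum S) A" and K: "\<And>i. i \<in> A \<Longrightarrow> \<phi> i \<in> K"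
  shows "((\<lambda>k. infsum f {i\<in>A. \<phi> i = k}) has_sum S) K"
proof (rule has_sum_fpsI')
  fix n
  define F where "F = {i\<in>A. f i $ n \<noteq> 0}"
  have fin: "finite F" and sub: "F \<subseteq> A" unfolding F_def using has_sum_fpsD(1)[OF f] by auto
  have Sn: "S $ n = (\<Sum>i\<in>F. f i $ n)"
    by (rule has_sum_fps_nth[OF f fin sub]) (auto simp: F_def)
  have inf: "infsum f {i\<in>A. \<phi> i = k} $ n = (\<Sum>i\<in>{i\<in>F. \<phi> i = k}. f i $ n)" for k
  proof (rule has_sum_fps_nth)
    have "f summable_on {i\<in>A. \<phi> i = k}"
      unfolding summable_on_fps_iff
    proof
      fix m
      show "finite {x \<in> {i \<in> A. \<phi> i = k}. f x $ m \<noteq> 0}"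
        by (rule finite_subset[OF _ has_sum_fpsD(1)[OF f, of m]]) auto
    qed
    then show "(f has_sum infsum f {i\<in>A. \<phi> i = k}) {i\<in>A. \<phi> i = k}" by simp
    show "finite {i\<in>F. \<phi> i = k}" using fin by simp
  qed (use sub in \<open>auto simp: F_def\<close>)
  show "\<exists>G. finite G \<and> G \<subseteq> K \<and> (\<forall>k\<in>K - G. infsum f {i\<in>A. \<phi> i = k} $ n = 0) \<and>
      S $ n = (\<Sum>k\<in>G. infsum f {i\<in>A. \<phi> i = k} $ n)"
  proof (intro exI[of _ "\<phi> ` F"] conjI ballI)
    show "finite (\<phi> ` F)" using fin by simp
    show "\<phi> ` F \<subseteq> K" using sub K by auto
    show "infsum f {i\<in>A. \<phi> i = k} $ n = 0" if "k \<in> K - \<phi> ` F" for k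
      unfolding inf by (rule sum.neutral) (use that in auto)
    show "S $ n = (\<Sum>k\<in>\<phi> ` F. infsum f {i\<in>A. \<phi> i = k} $ n)"
      unfolding Sn inf by (rule sum.image_gen[OF fin])
  qed
qed

lemma has_sum_fps_sum:
  fixes f :: "'j \<Rightarrow> 'i \<Rightarrow> 'a::ab_group_add fps"
  assumes "finite J" "\<And>j. j \<in> J \<Longrightarrow> (f j has_sum S j) A"
  shows "((\<lambda>i. \<Sum>j\<in>J. f j i) has_sum (\<Sum>j\<in>J. S j)) A"
  using assms by (induction J rule: finite_induct) (auto intro!: has_sum_add)

lemma fps_X_power_dvd_iff:
  fixes f :: "'a::comm_ring_1 fps"
  shows "fps_X ^ n dvd f \<longleftrightarrow> (\<forall>k<n. f $ k = 0)"
proof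
  assume "fps_X ^ n dvd f"
  then obtain h where "f = fps_X ^ n * h" by (elim dvdE)
  then show "\<forall>k<n. f $ k = 0" by (simp add: fps_X_power_mult_nth)
next
  assume "\<forall>k<n. f $ k = 0"
  then have "f = fps_X ^ n * fps_shift n f"
    by (intro fps_ext) (simp add: fps_X_power_mult_nth)
  then show "fps_X ^ n dvd f" by (rule dvdI)
qed

lemma fps_X_dvd_iff: "fps_X dvd (f :: 'a::comm_ring_1 fps) \<longleftrightarrow> f $ 0 = 0"
  using fps_X_power_dvd_iff[of 1 f] by auto

lemma fps_X_power_dvd_power:
  fixes f :: "'a::comm_ring_1 fps"
  assumes "f $ 0 = 0"
  shows "fps_X ^ n dvd f ^ n"
  by (rule dvd_power_same) (use assms in \<open>simp add: fps_X_dvd_iff\<close>)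

lemma summable_on_fps_dvd:
  fixes f :: "'i \<Rightarrow> 'a::comm_ring_1 fps"
  assumes "\<And>N. finite {i\<in>A. e i \<le> N}" "\<And>i. i \<in> A \<Longrightarrow> fps_X ^ e i dvd f i"
  shows "f summable_on A"
  unfolding summable_on_fps_iff
proof
  fix n
  have "{x \<in> A. f x $ n \<noteq> 0} \<subseteq> {i\<in>A. e i \<le> n}"
    using assms(2) by (auto simp: fps_X_power_dvd_iff not_less[symmetric])
  then show "finite {x \<in> A. f x $ n \<noteq> 0}" using assms(1) by (rule finite_subset)
qed

section \<open>Infinite products\<close>

text \<open>The difference of two inverses is the difference of the series, up to sign, times both
  inverses; hence agreement up to degree n is inherited by the inverses.\<close>

lemma tendsto_fps_inverse:
  fixes f :: "'i \<Rightarrow> 'a::field fps"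
  assumes f: "(f \<longlongrightarrow> l) F" and l: "l $ 0 \<noteq> 0"
  shows "((\<lambda>x. inverse (f x)) \<longlongrightarrow> inverse l) F"
proof (rule tendsto_fpsI)
  fix n
  have "\<forall>\<^sub>F x in F. \<forall>k\<in>{..n}. f x $ k = l $ k"
    using f by (subst eventually_ball_finite_distrib) (auto simp: tendsto_fps_iff)
  then show "\<forall>\<^sub>F x in F. inverse (f x) $ n = inverse l $ n"
  proof eventually_elim
    case (elim x)
    have fx: "f x $ 0 \<noteq> 0" using elim l by auto
    have "inverse (f x) - inverse l = (l - f x) * (inverse (f x) * inverse l)"
      using inverse_mult_eq_1[OF fx] inverse_mult_eq_1[OF l]
      by (simp add: algebra_simps)
    moreover have "fps_X ^ Suc n dvd (l - f x) * (inverse (f x) * inverse l)"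
      by (rule dvd_mult2) (use elim in \<open>auto simp: fps_X_power_dvd_iff simp del: power_Suc\<close>)
    ultimately have "(inverse (f x) - inverse l) $ n = 0"
      by (simp only: fps_X_power_dvd_iff)
    then show ?case by simp
  qed
qed

lemma tendsto_fps_prod:
  fixes f :: "'i \<Rightarrow> 'j \<Rightarrow> 'a::comm_ring_1 fps"
  assumes "\<And>i. i \<in> I \<Longrightarrow> ((\<lambda>x. f i x) \<longlongrightarrow> l i) F"
  shows "((\<lambda>x. \<Prod>i\<in>I. f i x) \<longlongrightarrow> (\<Prod>i\<in>I. l i)) F"
  using assms by (induction I rule: infinite_finite_induct) (auto intro!: tendsto_mult)

text \<open>Factor M differs from 1 by a multiple of T^M, so coefficient n is constant from n + 1
  factors on.\<close>

lemma fps_partial_products_convergent: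
  fixes u :: "nat \<Rightarrow> 'a::comm_ring_1 fps"
  assumes "\<And>j. fps_X ^ j dvd u j"
  obtains P where "(\<lambda>M. \<Prod>j<M. 1 - u j) \<longlonglongrightarrow> P"
proof
  have step: "(\<Prod>j<M. 1 - u j) $ n = (\<Prod>j<Suc n. 1 - u j) $ n" if "M \<ge> Suc n" for M n
    using that
  proof (induction M rule: dec_induct)
    case (step M)
    have "fps_X ^ M dvd (\<Prod>j<M. 1 - u j) * u M" using assms by (rule dvd_mult)
    then have "((\<Prod>j<M. 1 - u j) * u M) $ n = 0" using step by (auto simp: fps_X_power_dvd_iff)
    then show ?case using step by (simp add: algebra_simps)
  qed simp
  show "(\<lambda>M. \<Prod>j<M. 1 - u j) \<longlonglongrightarrow> Abs_fps (\<lambda>n. (\<Prod>j<Suc n. 1 - u j) $ n)"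
    by (rule tendsto_fpsI)
       (auto simp: eventually_sequentially simp del: prod.lessThan_Suc intro!: exI[of _ "Suc _"] step)
qed

lemma fps_nth_eq_of_tendsto:
  fixes P :: "'a::group_add fps"
  assumes "f \<longlonglongrightarrow> P" "\<And>M. f M $ n = c"
  shows "P $ n = c"
  using assms unfolding tendsto_fps_iff eventually_sequentially by (metis order_refl)

text \<open>\<open>has_prod\<close> asks for a nonzero limit once finitely many factors are dropped.
  Without the factor for j = 0 the product has constant term 1, so its limit is nonzero; the dropped
  factor 1 - a may be 0, which is why a = 1 is a separate case.\<close>

lemma qpoch_tendsto:
  fixes a q :: "'a::field fps"
  assumes q: "q $ 0 = 0"
  shows "(\<lambda>M. \<Prod>j<M. 1 - a * q ^ j) \<longlonglongrightarrow> qpoch_inf a q"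
proof -
  have dv: "fps_X ^ j dvd a * q ^ j" for a j
    by (rule dvd_mult) (rule fps_X_power_dvd_power[OF q])
  obtain P where P: "(\<lambda>M. \<Prod>j<M. 1 - (a * q) * q ^ j) \<longlonglongrightarrow> P"
    using fps_partial_products_convergent[of "\<lambda>j. (a * q) * q ^ j"] dv by blast
  have "(\<lambda>M. \<Prod>j\<le>M. 1 - a * q ^ (j + 1)) \<longlonglongrightarrow> P"
    using LIMSEQ_Suc[OF P] by (simp add: lessThan_Suc_atMost mult.assoc)
  moreover have P0: "P \<noteq> 0"
  proof -
    have "(\<Prod>j<M. 1 - (a * q) * q ^ j) $ 0 = 1" for M
      by (induction M) (auto simp: q)
    then have "P $ 0 = 1" by (rule fps_nth_eq_of_tendsto[OF P])
    then show ?thesis by auto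
  qed
  ultimately have raw: "raw_has_prod (\<lambda>j. 1 - a * q ^ j) (Suc 0) P" by (simp add: raw_has_prod_def)
  have "(\<lambda>j. 1 - a * q ^ j) has_prod ((1 - a) * P)"
  proof (cases "a = 1")
    case True
    then show ?thesis unfolding has_prod_def using raw by (intro disjI2 exI[of _ 0] exI[of _ P]) simp
  next
    case False
    have "(\<lambda>n. (1 - a) * (\<Prod>j<n. 1 - (a * q) * q ^ j)) \<longlonglongrightarrow> (1 - a) * P"
      by (intro tendsto_mult tendsto_const P)
    also have "(\<lambda>n. (1 - a) * (\<Prod>j<n. 1 - (a * q) * q ^ j)) = (\<lambda>n. \<Prod>j\<le>n. 1 - a * q ^ j)"
      unfolding lessThan_Suc_atMost[symmetric] prod.lessThan_Suc_shift by (simp add: mult.assoc)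
    finally show ?thesis using False P0 by (auto simp: has_prod_def raw_has_prod_def)
  qed
  then have "(\<lambda>j. 1 - a * q ^ j) has_prod qpoch_inf a q"
    unfolding qpoch_inf_def using has_prod_unique by metis
  then have "(\<lambda>n. \<Prod>j\<le>n. 1 - a * q ^ j) \<longlonglongrightarrow> qpoch_inf a q"
    by (rule has_prod_imp_tendsto)
  then show ?thesis
    unfolding lessThan_Suc_atMost[symmetric] by (rule LIMSEQ_imp_Suc)
qed

lemma qpoch_nth_0:
  fixes a q :: "'a::field fps"
  assumes "q $ 0 = 0"
  shows "qpoch_inf a q $ 0 = 1 - a $ 0"
proof -
  have "(\<Prod>j<Suc M. 1 - a * q ^ j) $ 0 = 1 - a $ 0" for M
    by (induction M) (auto simp: assms)
  then show ?thesis by (rule fps_nth_eq_of_tendsto[OF LIMSEQ_Suc[OF qpoch_tendsto[OF assms]]])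
qed

lemma qpoch_rec:
  fixes a q :: "'a::field fps"
  assumes q: "q $ 0 = 0"
  shows "qpoch_inf a q = (1 - a) * qpoch_inf (a * q) q"
proof -
  have "(\<lambda>M. (1 - a) * (\<Prod>j<M. 1 - (a * q) * q ^ j)) \<longlonglongrightarrow> (1 - a) * qpoch_inf (a * q) q"
    by (intro tendsto_mult tendsto_const qpoch_tendsto q)
  also have "(\<lambda>M. (1 - a) * (\<Prod>j<M. 1 - (a * q) * q ^ j)) = (\<lambda>M. \<Prod>j<Suc M. 1 - a * q ^ j)"
    unfolding prod.lessThan_Suc_shift by (simp add: mult.assoc)
  finally show ?thesis using LIMSEQ_unique LIMSEQ_Suc[OF qpoch_tendsto[OF q, of a]] by blast
qed

text \<open>Transfers identities of finite products to the limit. The M-th partial product on the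
  left comprises m M factors of the right-hand symbol, and this subsequence has the same limit as
  the full sequence.\<close>

lemma qpoch_eq_of_partial:
  fixes a q :: "'a::field fps"
  assumes "q $ 0 = 0" "\<And>i. i \<in> I \<Longrightarrow> r i $ 0 = 0"
    "\<And>M. (\<Prod>i\<in>I. \<Prod>j<M. 1 - b i * r i ^ j) = (\<Prod>j<m * M. 1 - a * q ^ j)" "m > 0"
  shows "(\<Prod>i\<in>I. qpoch_inf (b i) (r i)) = qpoch_inf a q"
proof -
  have "(\<lambda>M. \<Prod>i\<in>I. \<Prod>j<M. 1 - b i * r i ^ j) \<longlonglongrightarrow> (\<Prod>i\<in>I. qpoch_inf (b i) (r i))"
    by (intro tendsto_fps_prod qpoch_tendsto assms)
  moreover have "(\<lambda>M. \<Prod>j<m * M. 1 - a * q ^ j) \<longlonglongrightarrow> qpoch_inf a q"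
    by (rule LIMSEQ_subseq_LIMSEQ[OF qpoch_tendsto[OF assms(1)], unfolded o_def])
       (use \<open>m > 0\<close> in \<open>auto intro: strict_monoI\<close>)
  ultimately show ?thesis unfolding assms(3) by (rule LIMSEQ_unique)
qed

section \<open>The Jacobi triple product\<close>

text \<open>The general term of the Jacobi triple product. For negative n the formula for n >= 0
  would divide by a and q; with a b = q it is rewritten as a polynomial in b and q.\<close>

definition theta_term :: "'a::comm_ring_1 \<Rightarrow> 'a \<Rightarrow> 'a \<Rightarrow> int \<Rightarrow> 'a" where
  "theta_term a b q n =
     (if n \<ge> 0 then (- a) ^ nat n * q ^ (nat n choose 2) else (- b) ^ nat (- n) * q ^ (nat (- n) choose 2))"

lemma choose_two_Suc: "Suc n choose 2 = n + (n choose 2)"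
  by (simp add: numeral_2_eq_2)

text \<open>The recurrence t(n + 1) = - a q^n t(n), multiplied by q^(M - n) so that negative n cause
  no negative exponents.\<close>

lemma theta_term_step_up:
  assumes "a * b = q" "- int M \<le> n" "n \<le> int M"
  shows "q ^ nat (int M - n) * theta_term a b q (n + 1) = - a * q ^ M * theta_term a b q n"
proof (cases "n \<ge> 0")
  case True
  then obtain k where n: "n = int k" using nonneg_int_cases by blast
  have "nat (int k + 1) = Suc k" "nat (int M - int k) = M - k" by auto
  moreover have "q ^ (M - k) * q ^ k = q ^ M"
    using assms n by (simp add: power_add[symmetric])
  moreover have "q ^ (M - k) * ((- a) ^ Suc k * q ^ (Suc k choose 2))
      = (- a) * (q ^ (M - k) * q ^ k) * ((- a) ^ k * q ^ (k choose 2))"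
    by (simp add: choose_two_Suc power_add mult_ac)
  ultimately show ?thesis by (simp add: n theta_term_def add.commute)
next
  case False
  then obtain k where n: "n = - int (Suc k)"
    by (metis int_cases not_le of_nat_0_le_iff)
  have k: "nat (int M - n) = M + Suc k" "nat (- n) = Suc k" "nat (- (n + 1)) = k" "nat (- int k) = 0"
    "\<not> n \<ge> 0" "n + 1 = - int k"
    using n by auto
  have t: "theta_term a b q (- int k) = (- b) ^ k * q ^ (k choose 2)"
    unfolding theta_term_def by (cases k) (simp_all add: numeral_2_eq_2 nat_add_distrib del: power_Suc of_nat_Suc)
  show ?thesis
    unfolding k(6) t unfolding theta_term_def k using k
    by (simp add: choose_two_Suc power_add assms(1)[symmetric] algebra_simps)
qed

lemma theta_term_swap: "theta_term a b q (- n) = theta_term b a q n"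
  by (cases "n = 0") (auto simp: theta_term_def)

lemma theta_term_step_down:
  assumes "a * b = q" "- int M \<le> n" "n \<le> int M"
  shows "q ^ nat (int M + n) * theta_term a b q (n - 1) = - b * q ^ M * theta_term a b q n"
proof -
  have "q ^ nat (int M - - n) * theta_term b a q (- n + 1) = - b * q ^ M * theta_term b a q (- n)"
    by (rule theta_term_step_up) (use assms in \<open>auto simp: mult.commute\<close>)
  moreover have "theta_term b a q (- n + 1) = theta_term a b q (n - 1)"
    using theta_term_swap[of a b q "1 - n"] by simp
  moreover have "theta_term b a q (- n) = theta_term a b q n"
    using theta_term_swap[of b a q n] by simp
  ultimately show ?thesis by simp
qed

lemma fps_X_power_dvd_theta_term:
  fixes q :: "'a::comm_ring_1 fps"
  assumes "q $ 0 = 0"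
  shows "fps_X ^ (nat \<bar>n\<bar> choose 2) dvd theta_term a b q n"
  unfolding theta_term_def using fps_X_power_dvd_power[OF assms] by (auto intro!: dvd_mult)

lemma choose_two_ge: "n choose 2 \<ge> n - 1"
  by (induction n) (auto simp: choose_two_Suc)

definition qfact :: "'a::comm_ring_1 \<Rightarrow> nat \<Rightarrow> 'a" where
  "qfact q n = (\<Prod>j<n. 1 - q * q ^ j)"

text \<open>The q-binomial coefficient of 2M over M + n, times (q;q)_M. The extra factor is the one
  that belongs to the triple product, and it makes the limit for M to infinity equal to 1.\<close>

definition jtp_coeff :: "'a::field fps \<Rightarrow> nat \<Rightarrow> int \<Rightarrow> 'a fps" where
  "jtp_coeff q M n = (if \<bar>n\<bar> \<le> int M then
     qfact q M * qfact q (2 * M) * inverse (qfact q (nat (int M - n))) * inverse (qfact q (nat (int M + n)))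
     else 0)"

lemma qfact_Suc: "qfact q (Suc n) = qfact q n * (1 - q ^ Suc n)"
  by (simp add: qfact_def)

lemma qfact_nth_0: "(q :: 'a::comm_ring_1 fps) $ 0 = 0 \<Longrightarrow> qfact q n $ 0 = 1"
  by (induction n) (auto simp: qfact_def)

lemma inverse_qfact:
  fixes q :: "'a::field fps"
  assumes "q $ 0 = 0"
  shows "inverse (qfact q n) = inverse (qfact q (Suc n)) * (1 - q ^ Suc n)"
    and "qfact q n * inverse (qfact q n) = 1"
proof -
  show 1: "qfact q n * inverse (qfact q n) = 1" for n
    using qfact_nth_0[OF assms, of n] by (simp add: inverse_mult_eq_1')
  have "inverse (qfact q n) = inverse (qfact q n) * (qfact q (Suc n) * inverse (qfact q (Suc n)))"
    by (simp add: 1)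
  also have "\<dots> = (qfact q n * inverse (qfact q n)) * (inverse (qfact q (Suc n)) * (1 - q ^ Suc n))"
    by (simp add: qfact_Suc mult_ac)
  finally show "inverse (qfact q n) = inverse (qfact q (Suc n)) * (1 - q ^ Suc n)" by (simp add: 1)
qed

text \<open>The polynomial identity behind \<open>jtp_coeff_rec\<close>: u and v stand for q^(M-n)
  and q^(M+n), \<open>I\<close> and \<open>J\<close> for the inverse q-factorials of M - n + 1 and M
  + n + 1, and \<open>D\<close> for 1 - q^(M+1).\<close>

lemma jtp_identity:
  fixes q :: "'a::comm_ring_1"
  shows "W * (D * (1 - q * (u * v)) * (1 - q * (q * (u * v)))) * (I * J)
    = D * ((1 + q * (u * v)) * (W * (I * (1 - q * u) * (J * (1 - q * v))))
      + q * u * (W * (I * (J * (1 - q * v) * (1 - v)))) + q * v * (W * (J * (I * (1 - q * u) * (1 - u)))))"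
  by (simp add: algebra_simps)

text \<open>The q-Pascal rule applied twice, because the upper index 2M grows by 2. For n = M + 1
  and n = - M - 1 a single neighbour is nonzero and the rule reduces to a q-factorial.\<close>

lemma jtp_coeff_rec:
  fixes q :: "'a::field fps"
  assumes q: "q $ 0 = 0"
  shows "jtp_coeff q (Suc M) n = (1 - q ^ Suc M) * ((1 + q ^ Suc (2 * M)) * jtp_coeff q M n
     + q ^ nat (int M - n + 1) * jtp_coeff q M (n - 1) + q ^ nat (int M + n + 1) * jtp_coeff q M (n + 1))"
proof -
  define i where "i n = inverse (qfact q n)" for n
  define W where "W = qfact q M * qfact q (2 * M)"
  have W': "qfact q (Suc M) * qfact q (2 * Suc M)
      = W * ((1 - q ^ Suc M) * (1 - q ^ Suc (2 * M)) * (1 - q ^ Suc (Suc (2 * M))))"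
    by (simp add: W_def qfact_Suc mult_ac)
  have i: "i n = i (Suc n) * (1 - q ^ Suc n)" for n unfolding i_def by (rule inverse_qfact[OF q])
  have wi: "qfact q n * i n = 1" for n unfolding i_def by (rule inverse_qfact[OF q])
  have i0: "i 0 = 1" by (simp add: i_def qfact_def)
  consider "\<bar>n\<bar> \<le> int M" | "n = int M + 1" | "n = - int M - 1" | "\<bar>n\<bar> > int M + 1" by linarith
  then show ?thesis
  proof cases
    case 1
    define p where "p = nat (int M - n)"
    define r where "r = nat (int M + n)"
    have pr: "nat (int (Suc M) - n) = Suc p" "nat (int (Suc M) + n) = Suc r"
      "nat (int M - n + 1) = Suc p" "nat (int M + n + 1) = Suc r"
      "nat (int M - (n - 1)) = Suc p" "nat (int M + (n + 1)) = Suc r"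
      "nat (int M - n) = p" "nat (int M + n) = r"
      using 1 unfolding p_def r_def by auto
    have "p + r = 2 * M" using 1 unfolding p_def r_def by linarith
    then have uv: "q ^ (2 * M) = q ^ p * q ^ r" by (metis power_add)
    have c0: "jtp_coeff q M n = W * (i p * i r)"
      using 1 by (simp add: jtp_coeff_def pr W_def i_def mult.assoc)
    \<comment> \<open>The formula stays correct at the border r = 0: the neighbour is 0 by
      definition, and the factor 1 - q^0 vanishes.\<close>
    have c1: "jtp_coeff q M (n - 1) = W * (i (Suc p) * (i r * (1 - q ^ r)))"
    proof (cases r)
      case 0
      then have "n = - int M" using 1 unfolding r_def by auto
      then show ?thesis using 0 by (simp add: jtp_coeff_def)
    next
      case (Suc r')
      then have "nat (int M + (n - 1)) = r'" "\<bar>n - 1\<bar> \<le> int M" using 1 unfolding r_def by auto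
      then show ?thesis
        using i[of r'] Suc by (simp add: jtp_coeff_def pr W_def i_def mult.assoc)
    qed
    have c2: "jtp_coeff q M (n + 1) = W * (i (Suc r) * (i p * (1 - q ^ p)))"
    proof (cases p)
      case 0
      then have "n = int M" using 1 unfolding p_def by auto
      then show ?thesis using 0 by (simp add: jtp_coeff_def)
    next
      case (Suc p')
      then have "nat (int M - (n + 1)) = p'" "\<bar>n + 1\<bar> \<le> int M" using 1 unfolding p_def by auto
      then show ?thesis
        using i[of p'] Suc by (simp add: jtp_coeff_def pr W_def i_def mult_ac)
    qed
    have c3: "jtp_coeff q (Suc M) n = W * ((1 - q ^ Suc M) * (1 - q ^ Suc (2 * M)) * (1 - q ^ Suc (Suc (2 * M))))
        * (i (Suc p) * i (Suc r))"
    proof -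
      have "jtp_coeff q (Suc M) n = (qfact q (Suc M) * qfact q (2 * Suc M)) * i (Suc p) * i (Suc r)"
        unfolding jtp_coeff_def pr i_def using 1 by simp
      then show ?thesis unfolding W' by (simp only: mult.assoc)
    qed
    show ?thesis
      unfolding c0 c1 c2 c3 pr i[of p] i[of r] power_Suc uv by (rule jtp_identity)
  next
    case 2
    have n: "nat (int (Suc M) - n) = 0" "nat (int (Suc M) + n) = 2 * Suc M" "nat (int M - n + 1) = 0"
      "nat (int M - (n - 1)) = 0" "nat (int M + (n - 1)) = 2 * M" "nat (int M * 2) = 2 * M" "nat (2 * int M) = 2 * M" using 2 by auto
    have "jtp_coeff q (Suc M) n = qfact q (Suc M) * (qfact q (2 * Suc M) * i (2 * Suc M))"
      unfolding jtp_coeff_def n i_def[symmetric] i0 using 2 by simp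
    moreover have "jtp_coeff q M (n - 1) = qfact q M * (qfact q (2 * M) * i (2 * M))"
      unfolding jtp_coeff_def n i_def[symmetric] i0 using 2 by (simp add: n i0 i_def[symmetric])
    moreover have "jtp_coeff q M n = 0" "jtp_coeff q M (n + 1) = 0"
      using 2 by (auto simp: jtp_coeff_def)
    ultimately show ?thesis by (simp only: wi n) (simp add: qfact_Suc)
  next
    case 3
    have n: "nat (int (Suc M) - n) = 2 * Suc M" "nat (int (Suc M) + n) = 0" "nat (int M + n + 1) = 0"
      "nat (int M - (n + 1)) = 2 * M" "nat (int M + (n + 1)) = 0" "nat (int M * 2) = 2 * M" "nat (2 * int M) = 2 * M" using 3 by auto
    have "jtp_coeff q (Suc M) n = qfact q (Suc M) * (qfact q (2 * Suc M) * i (2 * Suc M))"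
      unfolding jtp_coeff_def n i_def[symmetric] i0 using 3 by simp
    moreover have "jtp_coeff q M (n + 1) = qfact q M * (qfact q (2 * M) * i (2 * M))"
      unfolding jtp_coeff_def n i_def[symmetric] i0 using 3 by (simp add: n i0 i_def[symmetric])
    moreover have "jtp_coeff q M n = 0" "jtp_coeff q M (n - 1) = 0"
      using 3 by (auto simp: jtp_coeff_def)
    ultimately show ?thesis by (simp only: wi n) (simp add: qfact_Suc)
  next
    case 4
    then have "\<not> \<bar>n\<bar> \<le> int M" "\<not> \<bar>n\<bar> \<le> int (Suc M)" "\<not> \<bar>n - 1\<bar> \<le> int M" "\<not> \<bar>n + 1\<bar> \<le> int M"
      by linarith+
    then show ?thesis by (simp add: jtp_coeff_def)
  qed
qed

text \<open>In the recurrence for the coefficients, shifting the summation index by the step rules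
  of \<open>theta_term\<close> turns the three terms into 1 + q^(2M+1), - a q^M and - b q^M times
  the old sum; as a b = q, these factors add up to (1 - a q^M)(1 - b q^M).\<close>

lemma finite_jacobi_triple_product:
  fixes a b q :: "'a::field fps"
  assumes q: "q $ 0 = 0" and ab: "a * b = q"
  shows "(\<Prod>j<M. 1 - a * q ^ j) * (\<Prod>j<M. 1 - b * q ^ j) * qfact q M
    = (\<Sum>n\<in>{- int M..int M}. jtp_coeff q M n * theta_term a b q n)"
proof (induction M)
  case 0
  show ?case by (simp add: qfact_def jtp_coeff_def theta_term_def numeral_2_eq_2)
next
  case (Suc M)
  define t where "t = theta_term a b q"
  define c where "c = jtp_coeff q M"
  define S where "S = (\<Sum>n\<in>{- int M..int M}. c n * t n)"
  have c0: "c n = 0" if "\<bar>n\<bar> > int M" for n using that by (simp add: c_def jtp_coeff_def)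
  let ?B = "{- int (Suc M)..int (Suc M)}"
  have S0: "(\<Sum>n\<in>?B. c n * t n) = S"
    unfolding S_def by (rule sum.mono_neutral_right) (auto simp: c0)
  have "(\<Sum>n\<in>?B. q ^ nat (int M - n + 1) * c (n - 1) * t n)
      = (\<Sum>n\<in>{- int M..int M}. q ^ nat (int M - n) * c n * t (n + 1))"
    by (rule sum.reindex_bij_witness_not_neutral[where S' = "?B - {n. \<bar>n - 1\<bar> \<le> int M}" and T' = "{}" and i = "\<lambda>n. n + 1" and j = "\<lambda>n. n - 1"])
       (auto simp: c0 algebra_simps)
  also have "\<dots> = (\<Sum>n\<in>{- int M..int M}. - a * q ^ M * (c n * t n))"
  proof (rule sum.cong)
    fix n assume "n \<in> {- int M..int M}"
    then have "q ^ nat (int M - n) * t (n + 1) = - a * q ^ M * t n"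
      unfolding t_def by (intro theta_term_step_up ab) auto
    then show "q ^ nat (int M - n) * c n * t (n + 1) = - a * q ^ M * (c n * t n)"
      by (metis mult.assoc mult.left_commute)
  qed auto
  also have "\<dots> = - a * q ^ M * S" unfolding S_def by (simp only: sum_distrib_left)
  finally have S1: "(\<Sum>n\<in>?B. q ^ nat (int M - n + 1) * c (n - 1) * t n) = - a * q ^ M * S" .
  have "(\<Sum>n\<in>?B. q ^ nat (int M + n + 1) * c (n + 1) * t n)
      = (\<Sum>n\<in>{- int M..int M}. q ^ nat (int M + n) * c n * t (n - 1))"
    by (rule sum.reindex_bij_witness_not_neutral[where S' = "?B - {n. \<bar>n + 1\<bar> \<le> int M}" and T' = "{}" and i = "\<lambda>n. n - 1" and j = "\<lambda>n. n + 1"])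
       (auto simp: c0 algebra_simps)
  also have "\<dots> = (\<Sum>n\<in>{- int M..int M}. - b * q ^ M * (c n * t n))"
  proof (rule sum.cong)
    fix n assume "n \<in> {- int M..int M}"
    then have "q ^ nat (int M + n) * t (n - 1) = - b * q ^ M * t n"
      unfolding t_def by (intro theta_term_step_down ab) auto
    then show "q ^ nat (int M + n) * c n * t (n - 1) = - b * q ^ M * (c n * t n)"
      by (metis mult.assoc mult.left_commute)
  qed auto
  also have "\<dots> = - b * q ^ M * S" unfolding S_def by (simp only: sum_distrib_left)
  finally have S2: "(\<Sum>n\<in>?B. q ^ nat (int M + n + 1) * c (n + 1) * t n) = - b * q ^ M * S" .
  have "(\<Sum>n\<in>?B. jtp_coeff q (Suc M) n * theta_term a b q n)
      = (\<Sum>n\<in>?B. (1 - q ^ Suc M) * ((1 + q ^ Suc (2 * M)) * (c n * t n)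
         + q ^ nat (int M - n + 1) * c (n - 1) * t n + q ^ nat (int M + n + 1) * c (n + 1) * t n))"
    unfolding jtp_coeff_rec[OF q] c_def t_def by (simp add: algebra_simps)
  also have "\<dots> = (1 - q ^ Suc M) * ((1 + q ^ Suc (2 * M)) * (\<Sum>n\<in>?B. c n * t n)
      + (\<Sum>n\<in>?B. q ^ nat (int M - n + 1) * c (n - 1) * t n)
      + (\<Sum>n\<in>?B. q ^ nat (int M + n + 1) * c (n + 1) * t n))"
    unfolding sum_distrib_left[symmetric] sum.distrib by (simp only: sum_distrib_left)
  also have "\<dots> = (1 - q ^ Suc M) * ((1 + q ^ Suc (2 * M)) * S + - a * q ^ M * S + - b * q ^ M * S)"
    unfolding S0 S1 S2 ..
  also have "\<dots> = (1 - q ^ Suc M) * ((1 - a * q ^ M) * (1 - b * q ^ M) * S)"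
  proof -
    have e: "q ^ Suc (2 * M) = (a * q ^ M) * (b * q ^ M)"
    proof -
      have "q ^ Suc (2 * M) = q * (q ^ M * q ^ M)" by (simp add: mult_2 power_add)
      then show ?thesis unfolding ab[symmetric] power_mult_distrib by (simp only: mult_ac)
    qed
    show ?thesis unfolding e by (simp add: algebra_simps)
  qed
  also have "S = (\<Prod>j<M. 1 - a * q ^ j) * (\<Prod>j<M. 1 - b * q ^ j) * qfact q M"
    unfolding S_def c_def t_def by (rule Suc[symmetric])
  finally show ?case by (simp add: qfact_Suc mult_ac)
qed

lemma jtp_coeff_tendsto:
  fixes q :: "'a::field fps"
  assumes q: "q $ 0 = 0"
  shows "(\<lambda>M. jtp_coeff q M n) \<longlonglongrightarrow> 1"
proof -
  define W where "W = qpoch_inf q q"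
  have W: "qfact q \<longlonglongrightarrow> W" using qpoch_tendsto[OF q, of q] by (simp add: qfact_def[abs_def] W_def)
  have W0: "W $ 0 = 1" by (simp add: W_def qpoch_nth_0 q)
  have Wi: "W * inverse W = 1" by (rule inverse_mult_eq_1') (simp add: W0)
  have lim: "(\<lambda>M. qfact q (f M)) \<longlonglongrightarrow> W" if "filterlim f at_top at_top" for f
    using filterlim_compose[OF W that] .
  have "(\<lambda>M. qfact q M * qfact q (2 * M) * inverse (qfact q (nat (int M - n)))
        * inverse (qfact q (nat (int M + n)))) \<longlonglongrightarrow> W * W * inverse W * inverse W"
  proof (intro tendsto_mult tendsto_fps_inverse lim)
    show "filterlim (\<lambda>M. 2 * M :: nat) at_top at_top"
      unfolding filterlim_at_top eventually_sequentially by (intro allI, rule_tac x = Z in exI) auto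
    show "filterlim (\<lambda>M. nat (int M - n)) at_top at_top" "filterlim (\<lambda>M. nat (int M + n)) at_top at_top"
      unfolding filterlim_at_top eventually_sequentially
      by (intro allI; rule_tac x = "Z + nat \<bar>n\<bar>" in exI; force)+
  qed (auto simp: W W0 filterlim_ident)
  also have "W * W * inverse W * inverse W = (W * inverse W) * (W * inverse W)" by (simp only: mult_ac)
  also have "\<dots> = 1" by (simp add: Wi)
  finally show ?thesis
  proof (rule Lim_transform_eventually)
    show "\<forall>\<^sub>F M in sequentially. qfact q M * qfact q (2 * M) * inverse (qfact q (nat (int M - n)))
        * inverse (qfact q (nat (int M + n))) = jtp_coeff q M n"
      unfolding eventually_sequentially by (rule exI[of _ "nat \<bar>n\<bar>"]) (auto simp: jtp_coeff_def)
  qed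
qed

text \<open>The limit M to infinity in the finite identity. It may be taken term by term, because
  the terms with |n| > N + 2 are divisible by such a power of T that they do not reach coefficient
  N, whatever M is.\<close>

theorem jacobi_triple_product:
  fixes a b q :: "'a::field fps"
  assumes q: "q $ 0 = 0" and ab: "a * b = q"
  shows "(theta_term a b q has_sum qpoch_inf a q * qpoch_inf b q * qpoch_inf q q) UNIV"
proof (rule has_sum_fpsI')
  fix N
  define t where "t = theta_term a b q"
  define L where "L = qpoch_inf a q * qpoch_inf b q * qpoch_inf q q"
  define F where "F = {- int (N + 2)..int (N + 2)}"
  define S where "S = (\<lambda>M. \<Sum>n\<in>{- int M..int M}. jtp_coeff q M n * t n)"
  have t0: "(x * t n) $ N = 0" if "n \<notin> F" for n x
  proof -
    have "N < nat \<bar>n\<bar> - 1" using that unfolding F_def by auto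
    then have "N < nat \<bar>n\<bar> choose 2" using choose_two_ge[of "nat \<bar>n\<bar>"] by simp
    moreover have "fps_X ^ (nat \<bar>n\<bar> choose 2) dvd x * t n"
      unfolding t_def using fps_X_power_dvd_theta_term[OF q] by (rule dvd_mult)
    ultimately show ?thesis by (auto simp: fps_X_power_dvd_iff)
  qed
  have "S \<longlonglongrightarrow> L"
    unfolding S_def t_def finite_jacobi_triple_product[OF q ab, symmetric] L_def qfact_def
    by (intro tendsto_mult qpoch_tendsto q)
  then have "\<forall>\<^sub>F M in sequentially. S M $ N = L $ N" by (simp add: tendsto_fps_iff)
  moreover have "(\<lambda>M. \<Sum>n\<in>F. jtp_coeff q M n * t n) \<longlonglongrightarrow> (\<Sum>n\<in>F. 1 * t n)"
    by (intro tendsto_sum tendsto_mult jtp_coeff_tendsto q tendsto_const)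
  then have "\<forall>\<^sub>F M in sequentially. (\<Sum>n\<in>F. jtp_coeff q M n * t n) $ N = (\<Sum>n\<in>F. 1 * t n) $ N"
    by (simp add: tendsto_fps_iff)
  moreover have "\<forall>\<^sub>F M in sequentially. S M $ N = (\<Sum>n\<in>F. jtp_coeff q M n * t n) $ N"
    unfolding eventually_sequentially
  proof (intro exI[of _ "N + 2"] allI impI)
    fix M assume "N + 2 \<le> M"
    then show "S M $ N = (\<Sum>n\<in>F. jtp_coeff q M n * t n) $ N"
      unfolding S_def fps_sum_nth
      by (intro sum.mono_neutral_right) (auto simp: F_def[symmetric] t0, auto simp: F_def)
  qed
  ultimately have "\<forall>\<^sub>F M :: nat in sequentially. L $ N = (\<Sum>n\<in>F. 1 * t n) $ N"
    by eventually_elim simp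
  then have "L $ N = (\<Sum>n\<in>F. t n) $ N" by simp
  then show "\<exists>F. finite F \<and> F \<subseteq> UNIV \<and> (\<forall>i\<in>UNIV - F. theta_term a b q i $ N = 0) \<and>
      (qpoch_inf a q * qpoch_inf b q * qpoch_inf q q) $ N = (\<Sum>i\<in>F. theta_term a b q i $ N)"
    using t0[where x = 1] by (intro exI[of _ F]) (auto simp: F_def L_def t_def fps_sum_nth)
qed

section \<open>Quadratic exponents\<close>

definition tri :: "int \<Rightarrow> int" where
  "tri n = n * (n - 1) div 2"

lemma tri_0 [simp]: "tri 0 = 0"
  by (simp add: tri_def)

lemma two_tri: "2 * tri n = n * (n - 1)"
  by (simp add: tri_def)

lemma tri_add_one: "tri (n + 1) = tri n + n"
  using two_tri[of n] two_tri[of "n + 1"] by (simp add: algebra_simps)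

lemma tri_uminus: "tri (- n) = tri n + n"
  using two_tri[of n] two_tri[of "- n"] by (simp add: algebra_simps)

lemma tri_of_nat: "tri (int k) = int (k choose 2)"
proof (induction k)
  case (Suc k)
  then show ?case using tri_add_one[of "int k"] by (simp add: choose_two_Suc add.commute)
qed (simp add: numeral_2_eq_2)

lemma tri_nonneg: "tri n \<ge> 0"
proof (cases "n \<ge> 0")
  case True
  then obtain k where "n = int k" using nonneg_int_cases by blast
  then show ?thesis by (simp add: tri_of_nat)
next
  case False
  then have "n * (n - 1) \<ge> 0" by (intro mult_nonpos_nonpos) auto
  then show ?thesis by (simp add: tri_def)
qed

text \<open>The exponent of T in term n of the triple product with a = T^r z, b = T^s / z and q =
  T^(r+s). The integer inside is never negative, so \<open>nat\<close> truncates nothing, see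
  \<open>int_qexp\<close>.\<close>

definition qexp :: "nat \<Rightarrow> nat \<Rightarrow> int \<Rightarrow> nat" where
  "qexp r s n = nat (int r * n + int (r + s) * tri n)"

lemma int_qexp: "int (qexp r s n) = int r * n + int (r + s) * tri n"
proof (cases "n \<ge> 0")
  case True
  then show ?thesis unfolding qexp_def using tri_nonneg[of n] by simp
next
  case False
  have "int r * n + int (r + s) * tri n = int s * (- n) + int (r + s) * tri (- n)"
    by (simp add: tri_uminus algebra_simps)
  also have "\<dots> \<ge> 0" using False tri_nonneg[of "- n"] by (intro add_nonneg_nonneg mult_nonneg_nonneg) auto
  finally show ?thesis unfolding qexp_def by simp
qed

lemma int_qexp_add_one: "int (qexp r s (n + 1)) = int (qexp r s n) + int r + int (r + s) * n"
  unfolding int_qexp tri_add_one by (simp add: algebra_simps)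

lemma qexp_0 [simp]: "qexp r s 0 = 0"
  by (simp add: qexp_def)

lemma qexp_uminus: "qexp r s (- n) = qexp s r n"
proof -
  have "int (qexp r s (- n)) = int (qexp s r n)"
    unfolding int_qexp tri_uminus by (simp add: algebra_simps)
  then show ?thesis by simp
qed

lemma qexp_ge:
  assumes "r + s > 0"
  shows "\<bar>n\<bar> \<le> int (qexp r s n) + 1"
proof -
  have pos: "n \<le> int (qexp r s n) + 1" if "r + s > 0" "n \<ge> 0" for r s n
  proof -
    obtain k where k: "n = int k" using \<open>n \<ge> 0\<close> by (rule nonneg_int_cases)
    have "int k \<le> tri n + 1" using choose_two_ge[of k] unfolding k tri_of_nat by linarith
    moreover have "tri n \<le> int (r + s) * tri n"
      using mult_right_mono[of 1 "int (r + s)" "tri n"] that tri_nonneg[of n] by simp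
    moreover have "int (r + s) * tri n \<le> int (qexp r s n)" unfolding int_qexp using that by simp
    ultimately show ?thesis unfolding k by linarith
  qed
  show ?thesis
  proof (cases "n \<ge> 0")
    case True
    then show ?thesis using pos[of r s n] assms by simp
  next
    case False
    have "s + r > 0" using assms by linarith
    then show ?thesis using pos[of s r "- n"] False by (simp add: qexp_uminus)
  qed
qed

lemma finite_qexp_le:
  assumes "r + s > 0"
  shows "finite {n. qexp r s n \<le> N}"
proof (rule finite_subset)
  show "{n. qexp r s n \<le> N} \<subseteq> {- int (N + 1)..int (N + 1)}"
  proof
    fix n assume "n \<in> {n. qexp r s n \<le> N}"
    then have "\<bar>n\<bar> \<le> int N + 1" using qexp_ge[OF assms, of n] by simp
    then show "n \<in> {- int (N + 1)..int (N + 1)}" by auto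
  qed
qed simp

lemma qexp_pos:
  assumes "r > 0" "s > 0" "n \<noteq> 0"
  shows "qexp r s n > 0"
proof -
  have pos: "qexp r s n > 0" if "r > 0" "n > 0" for r s n
  proof -
    have "int r * n > 0" "int (r + s) * tri n \<ge> 0" using that tri_nonneg[of n] by auto
    then have "int (qexp r s n) > 0" unfolding int_qexp by linarith
    then show ?thesis by simp
  qed
  show ?thesis using pos[of r n s] pos[of s "- n" r] assms by (cases "n > 0") (auto simp: qexp_uminus)
qed

lemma theta_term_eq:
  fixes z :: "'a::field"
  assumes "z \<noteq> 0"
  shows "theta_term (fps_X ^ r * fps_const z) (fps_X ^ s * fps_const (inverse z)) (fps_X ^ (r + s)) n
    = fps_X ^ qexp r s n * fps_const ((- z) powi n)"
proof -
  have pos: "theta_term (fps_X ^ r * fps_const z) (fps_X ^ s * fps_const (inverse z)) (fps_X ^ (r + s)) (int k)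
    = fps_X ^ qexp r s (int k) * fps_const ((- z) powi (int k))" for k r s and z :: 'a
  proof -
    have "qexp r s (int k) = r * k + (r + s) * (k choose 2)"
      by (simp add: qexp_def tri_of_nat flip: of_nat_mult of_nat_add)
    moreover have "(- (fps_X ^ r * fps_const z)) ^ k = fps_X ^ (r * k) * fps_const ((- z) ^ k)"
    proof -
      have "- (fps_X ^ r * fps_const z) = fps_X ^ r * fps_const (- z)" by (simp flip: fps_const_neg)
      then show ?thesis by (simp only: power_mult_distrib power_mult fps_const_power)
    qed
    ultimately show ?thesis
      by (simp add: theta_term_def power_add power_mult mult_ac)
  qed
  show ?thesis
  proof (cases "n \<ge> 0")
    case True
    then show ?thesis using pos[where k = "nat n" and z = z] by simp
  next
    case False
    have "theta_term (fps_X ^ r * fps_const z) (fps_X ^ s * fps_const (inverse z)) (fps_X ^ (r + s)) n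
      = theta_term (fps_X ^ s * fps_const (inverse z)) (fps_X ^ r * fps_const z) (fps_X ^ (s + r)) (- n)"
      using theta_term_swap[of "fps_X ^ r * fps_const z" "fps_X ^ s * fps_const (inverse z)" "fps_X ^ (r + s)" "- n"]
      by (simp add: add.commute)
    also have "\<dots> = fps_X ^ qexp s r (- n) * fps_const ((- inverse z) powi (- n))"
      using pos[where k = "nat (- n)" and r = s and s = r and z = "inverse z"] False by simp
    also have "(- inverse z) powi (- n) = (- z) powi n"
      by (simp add: power_int_minus flip: inverse_minus_eq power_int_inverse)
    finally show ?thesis by (simp add: qexp_uminus)
  qed
qed

section \<open>Quasi-periodic functions\<close>

text \<open>These are the functions that satisfy \<open>f (T x) = f x / (A x\<^sup>d)\<close> formally. As \<open>T x\<close> does not lie in the field of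
  constants, the condition is put on the coefficients of a Laurent expansion; the exponents of
  \<open>T\<close> are distributed over both sides to keep them nonnegative.\<close>

definition quasi_periodic :: "int \<Rightarrow> 'a::field fps \<Rightarrow> ('a \<Rightarrow> 'a fps) \<Rightarrow> bool" where
  "quasi_periodic d A f \<longleftrightarrow> (\<exists>c. (\<forall>k. fps_X ^ nat (- k) * c (k + d) = A * fps_X ^ nat k * c k)
     \<and> (\<forall>x. x \<noteq> 0 \<longrightarrow> ((\<lambda>k. c k * fps_const (x powi k)) has_sum f x) UNIV))"

text \<open>The coefficients of the product are convolutions, and the shift of (i, j) by (d, e) maps
  the antidiagonal i + j = k onto the one for k + d + e.\<close>

lemma quasi_periodic_mult:
  fixes f g :: "'a::field \<Rightarrow> 'a fps"
  assumes f: "quasi_periodic d A f" and g: "quasi_periodic e B g"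
  shows "quasi_periodic (d + e) (A * B) (\<lambda>x. f x * g x)"
proof -
  obtain c where c: "\<And>k. fps_X ^ nat (- k) * c (k + d) = A * fps_X ^ nat k * c k"
    "\<And>x. x \<noteq> 0 \<Longrightarrow> ((\<lambda>k. c k * fps_const (x powi k)) has_sum f x) UNIV"
    using f unfolding quasi_periodic_def by blast
  obtain c' where c': "\<And>k. fps_X ^ nat (- k) * c' (k + e) = B * fps_X ^ nat k * c' k"
    "\<And>x. x \<noteq> 0 \<Longrightarrow> ((\<lambda>k. c' k * fps_const (x powi k)) has_sum g x) UNIV"
    using g unfolding quasi_periodic_def by blast
  define D where "D k = {(i, j). i + j = k}" for k :: int
  define u where "u = (\<lambda>(i, j). c i * c' j)"
  define h where "h k = infsum u (D k)" for k
  \<comment> \<open>Evaluation at x = 1 shows that the products of coefficients are summable, so the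
    convolutions \<open>h\<close> can be defined without reference to x.\<close>
  have "(u has_sum (f 1 * g 1)) (UNIV \<times> UNIV)"
    using has_sum_fps_mult[OF c(2)[of 1] c'(2)[of 1]] by (simp add: u_def)
  then have "u summable_on D k" for k
    using summable_on_fps_iff[of u "D k"] summable_on_fps_iff[of u "UNIV \<times> UNIV"]
    by (auto simp: has_sum_iff intro: finite_subset[rotated])
  then have h: "(u has_sum h k) (D k)" for k unfolding h_def by simp
  have shift: "fps_X ^ nat (- k) * (c (i + d) * c' (j + e)) = A * B * fps_X ^ nat k * (c i * c' j)"
    if "i + j = k" for i j k
  proof -
    \<comment> \<open>The powers T^(nat (- i)) and T^(nat (- j)) do not combine to T^(nat (- k)) if
      i and j have different signs; both sides are multiplied by T^S, which is cancelled at the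
      end.\<close>
    define S where "S = nat (- i) + nat (- j)"
    have exps: "S + nat k = nat (- k) + nat i + nat j"
      using that unfolding S_def by linarith
    have "fps_X ^ S * (fps_X ^ nat (- k) * (c (i + d) * c' (j + e)))
      = fps_X ^ nat (- k) * ((fps_X ^ nat (- i) * c (i + d)) * (fps_X ^ nat (- j) * c' (j + e)))"
      by (simp add: S_def power_add mult_ac)
    also have "\<dots> = fps_X ^ nat (- k) * ((A * fps_X ^ nat i * c i) * (B * fps_X ^ nat j * c' j))"
      by (simp only: c(1) c'(1))
    also have "\<dots> = fps_X ^ (nat (- k) + nat i + nat j) * (A * B * (c i * c' j))"
      by (simp add: power_add mult_ac)
    also have "\<dots> = fps_X ^ S * (A * B * fps_X ^ nat k * (c i * c' j))"
      by (simp add: exps[symmetric] power_add mult_ac)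
    finally show ?thesis by simp
  qed
  show ?thesis
    unfolding quasi_periodic_def
  proof (intro exI[of _ h] conjI allI impI)
    fix k
    have bij: "bij_betw (\<lambda>(i, j). (i + d, j + e)) (D k) (D (k + (d + e)))"
      by (rule bij_betwI[where g = "\<lambda>(i, j). (i - d, j - e)"]) (auto simp: D_def)
    have "((\<lambda>x. u ((\<lambda>(i, j). (i + d, j + e)) x)) has_sum h (k + (d + e))) (D k)"
      using h unfolding has_sum_reindex_bij_betw[OF bij] .
    then have "((\<lambda>x. fps_X ^ nat (- k) * u ((\<lambda>(i, j). (i + d, j + e)) x))
        has_sum (fps_X ^ nat (- k) * h (k + (d + e)))) (D k)"
      by (rule has_sum_cmult_right)
    moreover have "((\<lambda>x. A * B * fps_X ^ nat k * u x) has_sum (A * B * fps_X ^ nat k * h k)) (D k)"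
      by (rule has_sum_cmult_right) (rule h)
    then have "((\<lambda>x. fps_X ^ nat (- k) * u ((\<lambda>(i, j). (i + d, j + e)) x))
        has_sum (A * B * fps_X ^ nat k * h k)) (D k)"
      by (rule has_sum_cong[THEN iffD1, rotated]) (use shift in \<open>auto simp: D_def u_def\<close>)
    ultimately show "fps_X ^ nat (- k) * h (k + (d + e)) = A * B * fps_X ^ nat k * h k"
      by (rule has_sum_unique)
  next
    fix x :: 'a assume x: "x \<noteq> 0"
    define w where "w = (\<lambda>(i, j). c i * fps_const (x powi i) * (c' j * fps_const (x powi j)))"
    have w: "(w has_sum f x * g x) (UNIV \<times> UNIV)"
      unfolding w_def by (rule has_sum_fps_mult[OF c(2)[OF x] c'(2)[OF x]])
    have "((\<lambda>k. infsum w {p \<in> UNIV \<times> UNIV. (case p of (i, j) \<Rightarrow> i + j) = k}) has_sum f x * g x) UNIV"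
      by (rule has_sum_fps_fibres[OF w]) auto
    moreover have "infsum w {p \<in> UNIV \<times> UNIV. (case p of (i, j) \<Rightarrow> i + j) = k} = h k * fps_const (x powi k)" for k
    proof -
      have "((\<lambda>p. u p * fps_const (x powi k)) has_sum (h k * fps_const (x powi k))) (D k)"
        by (rule has_sum_cmult_left) (rule h)
      then have "(w has_sum (h k * fps_const (x powi k))) (D k)"
        by (rule has_sum_cong[THEN iffD1, rotated])
           (auto simp: D_def u_def w_def power_int_add x fps_const_mult[symmetric] mult_ac simp del: fps_const_mult)
      moreover have "{p \<in> UNIV \<times> UNIV. (case p of (i, j) \<Rightarrow> i + j) = k} = D k" by (auto simp: D_def)
      ultimately show ?thesis by (simp add: infsumI)
    qed
    ultimately show "((\<lambda>k. h k * fps_const (x powi k)) has_sum f x * g x) UNIV" by simp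
  qed
qed

lemma quasi_periodic_one: "quasi_periodic 0 1 (\<lambda>_. 1)"
  unfolding quasi_periodic_def
proof (intro exI[of _ "\<lambda>k. if k = 0 then 1 else 0"] conjI allI impI)
  fix x :: 'a
  show "((\<lambda>k. (if k = 0 then 1 else 0) * fps_const (x powi k)) has_sum 1) UNIV"
    by (rule has_sum_cong_neutral[THEN iffD1, OF _ _ _ has_sum_finiteI[of "{0}"]]) auto
qed auto

lemma quasi_periodic_prod:
  assumes "finite I" "\<And>i. i \<in> I \<Longrightarrow> quasi_periodic (d i) (A i) (f i)"
  shows "quasi_periodic (\<Sum>i\<in>I. d i) (\<Prod>i\<in>I. A i) (\<lambda>x. \<Prod>i\<in>I. f i x)"
  using assms by (induction I rule: finite_induct) (simp_all add: quasi_periodic_one quasi_periodic_mult)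

text \<open>The triple product in z = y x^p: its expansion contains only exponents divisible by p,
  and consecutive ones differ by the factor - y T^(r + p n).\<close>

lemma quasi_periodic_theta:
  fixes y :: "'a::field"
  assumes y: "y \<noteq> 0" and p: "p = r + s" "p > 0"
  shows "quasi_periodic (int p) (- (fps_X ^ r * fps_const y))
    (\<lambda>x. qpoch_inf (fps_X ^ r * fps_const (y * x ^ p)) (fps_X ^ p)
       * qpoch_inf (fps_X ^ s * fps_const (inverse (y * x ^ p))) (fps_X ^ p) * qpoch_inf (fps_X ^ p) (fps_X ^ p))"
  unfolding quasi_periodic_def
proof (intro exI conjI allI impI)
  define c where "c k = (if int p dvd k
     then fps_X ^ qexp r s (k div int p) * fps_const ((- y) powi (k div int p)) else 0)" for k
  fix x :: 'a assume x: "x \<noteq> 0"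
  define P where "P = qpoch_inf (fps_X ^ r * fps_const (y * x ^ p)) (fps_X ^ p)
       * qpoch_inf (fps_X ^ s * fps_const (inverse (y * x ^ p))) (fps_X ^ p) * qpoch_inf (fps_X ^ p) (fps_X ^ p)"
  have z: "y * x ^ p \<noteq> 0" using x y by simp
  have "(theta_term (fps_X ^ r * fps_const (y * x ^ p)) (fps_X ^ s * fps_const (inverse (y * x ^ p)))
      (fps_X ^ p) has_sum P) UNIV"
    unfolding P_def
  proof (rule jacobi_triple_product)
    show "(fps_X ^ p :: 'a fps) $ 0 = 0" using p by simp
    have "fps_const (y * x ^ p) * fps_const (inverse (y * x ^ p)) = 1"
      unfolding fps_const_mult right_inverse[OF z] by simp
    then show "fps_X ^ r * fps_const (y * x ^ p) * (fps_X ^ s * fps_const (inverse (y * x ^ p))) = fps_X ^ p"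
      unfolding p(1) power_add by (metis (no_types, lifting) mult.assoc mult.left_commute mult.right_neutral)
  qed
  also have "theta_term (fps_X ^ r * fps_const (y * x ^ p)) (fps_X ^ s * fps_const (inverse (y * x ^ p))) (fps_X ^ p)
    = (\<lambda>n. (\<lambda>k. c k * fps_const (x powi k)) (int p * n))"
    unfolding p(1)
  proof
    fix n
    have "(- (y * x ^ (r + s))) powi n = (- y) powi n * x powi (int (r + s) * n)"
    proof -
      have "(- (y * x ^ (r + s))) powi n = ((- y) * x powi int (r + s)) powi n"
        by (simp only: power_int_of_nat mult_minus_left)
      then show ?thesis by (simp only: power_int_mult_distrib power_int_mult)
    qed
    then show "theta_term (fps_X ^ r * fps_const (y * x ^ (r + s))) (fps_X ^ s * fps_const (inverse (y * x ^ (r + s)))) (fps_X ^ (r + s)) n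
      = c (int (r + s) * n) * fps_const (x powi (int (r + s) * n))"
    proof -
      have "int (r + s) * n div int (r + s) = n"
        by (rule nonzero_mult_div_cancel_left) (use p in linarith)
      then have "c (int (r + s) * n) = fps_X ^ qexp r s n * fps_const ((- y) powi n)"
        by (simp only: c_def p(1) dvd_triv_left if_True)
      then show ?thesis
        using theta_term_eq[OF z[unfolded p(1)], of r s n] \<open>(- (y * x ^ (r + s))) powi n = _\<close>
        by (simp only: mult.assoc fps_const_mult)
    qed
  qed
  also have "((\<lambda>n. (\<lambda>k. c k * fps_const (x powi k)) (int p * n)) has_sum P) UNIV \<longleftrightarrow>
    ((\<lambda>k. c k * fps_const (x powi k)) has_sum P) (range (\<lambda>n. int p * n))"
    by (subst has_sum_reindex) (use p in \<open>auto simp: inj_on_def o_def\<close>)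
  also have "\<dots> \<longleftrightarrow> ((\<lambda>k. c k * fps_const (x powi k)) has_sum P) UNIV"
    by (rule has_sum_cong_neutral) (auto simp: c_def elim!: dvdE)
  finally show "((\<lambda>k. c k * fps_const (x powi k)) has_sum P) UNIV" .
next
  fix k
  define c where "c k = (if int p dvd k
     then fps_X ^ qexp r s (k div int p) * fps_const ((- y) powi (k div int p)) else 0)" for k
  show "fps_X ^ nat (- k) * c (k + int p) = - (fps_X ^ r * fps_const y) * fps_X ^ nat k * c k"
  proof (cases "int p dvd k")
    case False
    then show ?thesis by (simp add: c_def)
  next
    case True
    then obtain n where k: "k = int p * n" by (elim dvdE)
    have "(int p * n + int p) div int p = n + 1" using p(2) by simp
    moreover have "nat (- k) + qexp r s (n + 1) = r + nat k + qexp r s n"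
      using int_qexp_add_one[of r s n] unfolding k p(1) by linarith
    then have "fps_X ^ nat (- k) * fps_X ^ qexp r s (n + 1) = (fps_X ^ r * fps_X ^ nat k * fps_X ^ qexp r s n :: 'a fps)"
      by (metis power_add)
    moreover have "(- y) powi (n + 1) = (- y) powi n * (- y)" using y by (simp add: power_int_add_1)
    ultimately show ?thesis using p(2) unfolding c_def k
      by (simp add: mult.assoc[symmetric])
  qed
qed

text \<open>All exponents of x are congruent to j - t modulo g = 2t + 1. The shift by t is chosen so
  that x times the value at 1/x exchanges j and g - j; the function \<Theta>_j is
  \<open>Phi t j\<close> minus \<open>Phi t (g - j)\<close>.\<close>

definition Phi :: "nat \<Rightarrow> nat \<Rightarrow> 'a::field \<Rightarrow> 'a fps" where
  "Phi t j x = infsum (\<lambda>n. fps_X ^ qexp j (2 * t + 1 - j) n * fps_const (x powi (int j - int t + n * int (2 * t + 1)))) UNIV"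

lemma Phi_has_sum:
  assumes "j \<le> 2 * t + 1"
  shows "((\<lambda>n. fps_X ^ qexp j (2 * t + 1 - j) n * fps_const (x powi (int j - int t + n * int (2 * t + 1))))
    has_sum Phi t j x) UNIV"
  unfolding Phi_def
  by (rule has_sum_infsum, rule summable_on_fps_dvd[where e = "qexp j (2 * t + 1 - j)"])
     (use finite_qexp_le[of j "2 * t + 1 - j"] assms in auto)

text \<open>Replacing n by - n exchanges the two parameters of \<open>qexp\<close> and turns an
  exponent e of x into 1 - e.\<close>

lemma Phi_reflect:
  fixes x :: "'a::field"
  assumes j: "j \<le> 2 * t + 1" and x: "x \<noteq> 0"
  shows "fps_const x * Phi t j (inverse x) = Phi t (2 * t + 1 - j) x"
proof -
  let ?g = "2 * t + 1"
  have "((\<lambda>n. fps_const x * (fps_X ^ qexp j (?g - j) n * fps_const (inverse x powi (int j - int t + n * int ?g))))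
    has_sum fps_const x * Phi t j (inverse x)) UNIV"
    by (intro has_sum_cmult_right Phi_has_sum j)
  also have "(\<lambda>n. fps_const x * (fps_X ^ qexp j (?g - j) n * fps_const (inverse x powi (int j - int t + n * int ?g))))
    = (\<lambda>n. (\<lambda>m. fps_X ^ qexp (?g - j) j m * fps_const (x powi (int (?g - j) - int t + m * int ?g))) (- n))"
  proof
    fix n
    have "x * inverse x powi (int j - int t + n * int ?g) = x powi (1 + - (int j - int t + n * int ?g))"
      unfolding power_int_add[OF disjI1[OF x]] by (simp only: power_int_minus power_int_inverse power_int_1_right)
    also have "1 + - (int j - int t + n * int ?g) = int (?g - j) - int t + - n * int ?g"
      using j by (simp add: of_nat_diff algebra_simps)
    finally have e: "x * inverse x powi (int j - int t + n * int ?g) = x powi (int (?g - j) - int t + - n * int ?g)" .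
    show "fps_const x * (fps_X ^ qexp j (?g - j) n * fps_const (inverse x powi (int j - int t + n * int ?g)))
      = fps_X ^ qexp (?g - j) j (- n) * fps_const (x powi (int (?g - j) - int t + - n * int ?g))"
      unfolding e[symmetric] qexp_uminus by (simp only: fps_const_mult[symmetric] mult_ac)
  qed
  also have "((\<lambda>n. (\<lambda>m. fps_X ^ qexp (?g - j) j m * fps_const (x powi (int (?g - j) - int t + m * int ?g))) (- n))
    has_sum fps_const x * Phi t j (inverse x)) UNIV \<longleftrightarrow>
    ((\<lambda>m. fps_X ^ qexp (?g - j) j m * fps_const (x powi (int (?g - j) - int t + m * int ?g)))
    has_sum fps_const x * Phi t j (inverse x)) UNIV"
    by (rule has_sum_reindex_bij_betw) (rule bij_betwI[where g = uminus], auto)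
  finally have "((\<lambda>m. fps_X ^ qexp (?g - j) j m * fps_const (x powi (int (?g - j) - int t + m * int ?g)))
    has_sum fps_const x * Phi t j (inverse x)) UNIV" .
  moreover have "((\<lambda>m. fps_X ^ qexp (?g - j) j m * fps_const (x powi (int (?g - j) - int t + m * int ?g)))
    has_sum Phi t (?g - j) x) UNIV"
    using Phi_has_sum[of "?g - j" t x] j by simp
  ultimately show ?thesis by (rule has_sum_unique)
qed

text \<open>An index shift by 1. It makes the antisymmetrized series for j = 0 vanish, which leaves
  the indices 1, ..., 2t to be paired.\<close>

lemma Phi_wrap: "Phi t (2 * t + 1) x = Phi t 0 (x :: 'a::field)"
proof -
  let ?g = "2 * t + 1"
  have "((\<lambda>n. (\<lambda>m. fps_X ^ qexp 0 ?g m * fps_const (x powi (- int t + m * int ?g))) (n + 1)) has_sum Phi t 0 x) UNIV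
    \<longleftrightarrow> ((\<lambda>m. fps_X ^ qexp 0 ?g m * fps_const (x powi (- int t + m * int ?g))) has_sum Phi t 0 x) UNIV"
    by (rule has_sum_reindex_bij_betw) (rule bij_betwI[where g = "\<lambda>n. n - 1"], auto)
  also have \<dots> using Phi_has_sum[of 0 t x] by simp
  also have "(\<lambda>n. (\<lambda>m. fps_X ^ qexp 0 ?g m * fps_const (x powi (- int t + m * int ?g))) (n + 1))
    = (\<lambda>n. fps_X ^ qexp ?g 0 n * fps_const (x powi (int ?g - int t + n * int ?g)))"
  proof
    fix n
    have "int (qexp 0 ?g (n + 1)) = int (qexp ?g 0 n)"
      unfolding int_qexp tri_add_one by (simp add: algebra_simps)
    moreover have "- int t + (n + 1) * int ?g = int ?g - int t + n * int ?g" by (simp add: algebra_simps)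
    ultimately show "(\<lambda>m. fps_X ^ qexp 0 ?g m * fps_const (x powi (- int t + m * int ?g))) (n + 1)
      = fps_X ^ qexp ?g 0 n * fps_const (x powi (int ?g - int t + n * int ?g))"
      by (simp only: of_nat_eq_iff)
  qed
  finally show ?thesis using Phi_has_sum[of ?g t x] by (auto intro: has_sum_unique)
qed

text \<open>The condition says c(k + g) = T^(k+1) c(k). Starting at r - 1 absorbs the 1 in the
  exponent, and the steps accumulate to exactly \<open>qexp\<close>.\<close>

lemma quasi_periodic_coeff:
  fixes c :: "int \<Rightarrow> 'a::field fps"
  assumes c: "\<And>k. fps_X ^ nat (- k) * c (k + int (r + s)) = fps_X * fps_X ^ nat k * c k"
  shows "c (int r - 1 + n * int (r + s)) = fps_X ^ qexp r s n * c (int r - 1)"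
proof -
  let ?P = "\<lambda>n. c (int r - 1 + n * int (r + s)) = fps_X ^ qexp r s n * c (int r - 1)"
  have step: "?P n \<longleftrightarrow> ?P (n + 1)" for n
  proof -
    define k where "k = int r - 1 + n * int (r + s)"
    have k': "int r - 1 + (n + 1) * int (r + s) = k + int (r + s)" by (simp add: k_def algebra_simps)
    have "int (nat (- k) + qexp r s (n + 1)) = int (Suc (nat k) + qexp r s n)"
      using int_qexp_add_one[of r s n] by (simp add: k_def algebra_simps)
    then have e: "nat (- k) + qexp r s (n + 1) = Suc (nat k) + qexp r s n" by (simp only: of_nat_eq_iff)
    have "?P n \<longleftrightarrow> fps_X ^ Suc (nat k) * c k = fps_X ^ Suc (nat k) * (fps_X ^ qexp r s n * c (int r - 1))"
      by (simp add: k_def)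
    also have "fps_X ^ Suc (nat k) * (fps_X ^ qexp r s n * c (int r - 1))
      = fps_X ^ nat (- k) * (fps_X ^ qexp r s (n + 1) * c (int r - 1))"
      by (simp only: mult.assoc[symmetric] power_add[symmetric] e)
    also have "fps_X ^ Suc (nat k) * c k = fps_X ^ nat (- k) * c (k + int (r + s))"
      using c[of k] by simp
    also have "(fps_X ^ nat (- k) * c (k + int (r + s)) = fps_X ^ nat (- k) * (fps_X ^ qexp r s (n + 1) * c (int r - 1)))
      \<longleftrightarrow> ?P (n + 1)"
      unfolding k' by simp
    finally show ?thesis .
  qed
  show ?thesis
  proof (induction n rule: int_induct[where k = 0])
    case base
    show ?case by simp
  next
    case (step1 i)
    then show ?case using step by blast
  next
    case (step2 i)
    then show ?case using step[of "i - 1"] by simp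
  qed
qed

text \<open>The quasi-periodicity leaves \<open>2 t + 1\<close> free coefficients, one for each series \<open>Phi\<close>; averaging the
  expansion with its reflection, which needs the division by 2, pairs them off.\<close>

lemma quasi_periodic_in_span:
  fixes f :: "'a::field \<Rightarrow> 'a fps"
  assumes t: "t \<ge> 1" and f: "quasi_periodic (int (2 * t + 1)) fps_X f" and two: "(2 :: 'a) \<noteq> 0"
    and F: "\<And>x. x \<noteq> 0 \<Longrightarrow> F x = fps_const (x powi (1 - int t)) * f x"
    and F_refl: "\<And>x. x \<noteq> 0 \<Longrightarrow> fps_const x * F (inverse x) = - F x"
  shows "\<exists>a. \<forall>x. x \<noteq> 0 \<longrightarrow> F x = (\<Sum>j=1..t. a j * (Phi t j x - Phi t (2 * t + 1 - j) x))"
proof -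
  let ?g = "2 * t + 1"
  obtain c where c: "\<And>k. fps_X ^ nat (- k) * c (k + int ?g) = fps_X * fps_X ^ nat k * c k"
    "\<And>x. x \<noteq> 0 \<Longrightarrow> ((\<lambda>k. c k * fps_const (x powi k)) has_sum f x) UNIV"
    using f unfolding quasi_periodic_def by blast
  have expand: "F x = (\<Sum>j<?g. c (int j - 1) * Phi t j x)" if x: "x \<noteq> 0" for x
  proof -
    define u where "u k = c k * fps_const (x powi k)" for k
    \<comment> \<open>The residue of k + 1, as the coefficient at j - 1 governs the class of
      j.\<close>
    define \<phi> where "\<phi> k = nat ((k + 1) mod int ?g)" for k
    have "((\<lambda>j. infsum u {k\<in>UNIV. \<phi> k = j}) has_sum f x) {..<?g}"
    proof (rule has_sum_fps_fibres)
      show "(u has_sum f x) UNIV" unfolding u_def by (rule c(2)[OF x])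
      show "\<phi> k \<in> {..<?g}" for k
        unfolding \<phi>_def using pos_mod_bound[of "int ?g" "k + 1"] pos_mod_sign[of "int ?g" "k + 1"] by (simp add: nat_less_iff)
    qed
    then have "f x = (\<Sum>j<?g. infsum u {k\<in>UNIV. \<phi> k = j})"
      by (rule has_sum_unique) (rule has_sum_finite, simp)
    also have "\<dots> = (\<Sum>j<?g. c (int j - 1) * fps_const (x powi (int t - 1)) * Phi t j x)"
    proof (rule sum.cong[OF refl])
      fix j assume j: "j \<in> {..<?g}"
      have bij: "bij_betw (\<lambda>n. int j - 1 + n * int ?g) UNIV {k\<in>UNIV. \<phi> k = j}"
      proof (rule bij_betwI[where g = "\<lambda>k. (k + 1) div int ?g"])
        show "(\<lambda>n. int j - 1 + n * int ?g) \<in> UNIV \<rightarrow> {k \<in> UNIV. \<phi> k = j}"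
          using j by (auto simp: \<phi>_def simp del: of_nat_Suc of_nat_add)
        show "(int j - 1 + n * int ?g + 1) div int ?g = n" for n
          using j by (simp del: of_nat_Suc of_nat_add)
        fix k assume "k \<in> {k\<in>UNIV. \<phi> k = j}"
        then have "int j = (k + 1) mod int ?g" unfolding \<phi>_def using pos_mod_sign[of "int ?g" "k + 1"] by auto
        then show "int j - 1 + (k + 1) div int ?g * int ?g = k"
          using div_mult_mod_eq[of "k + 1" "int ?g"] by linarith
      qed auto
      have "((\<lambda>n. c (int j - 1) * fps_const (x powi (int t - 1)) *
          (fps_X ^ qexp j (?g - j) n * fps_const (x powi (int j - int t + n * int ?g))))
          has_sum c (int j - 1) * fps_const (x powi (int t - 1)) * Phi t j x) UNIV"
        by (intro has_sum_cmult_right Phi_has_sum) (use j in auto)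
      also have "(\<lambda>n. c (int j - 1) * fps_const (x powi (int t - 1)) *
          (fps_X ^ qexp j (?g - j) n * fps_const (x powi (int j - int t + n * int ?g))))
          = (\<lambda>n. u (int j - 1 + n * int ?g))"
      proof
        fix n
        have g: "j + (?g - j) = ?g" using j by simp
        have "c (int j - 1 + n * int ?g) = fps_X ^ qexp j (?g - j) n * c (int j - 1)"
          using quasi_periodic_coeff[of c j "?g - j" n] c(1) unfolding g by blast
        moreover have "x powi (int j - 1 + n * int ?g) = x powi (int t - 1) * x powi (int j - int t + n * int ?g)"
          unfolding power_int_add[OF disjI1[OF x], symmetric] by (simp add: algebra_simps)
        ultimately show "c (int j - 1) * fps_const (x powi (int t - 1)) *
          (fps_X ^ qexp j (?g - j) n * fps_const (x powi (int j - int t + n * int ?g))) = u (int j - 1 + n * int ?g)"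
          unfolding u_def by (simp only: fps_const_mult[symmetric] mult_ac)
      qed
      also have "((\<lambda>n. u (int j - 1 + n * int ?g)) has_sum c (int j - 1) * fps_const (x powi (int t - 1)) * Phi t j x) UNIV
        \<longleftrightarrow> (u has_sum c (int j - 1) * fps_const (x powi (int t - 1)) * Phi t j x) {k\<in>UNIV. \<phi> k = j}"
        by (rule has_sum_reindex_bij_betw[OF bij])
      finally show "infsum u {k\<in>UNIV. \<phi> k = j} = c (int j - 1) * fps_const (x powi (int t - 1)) * Phi t j x"
        by (rule infsumI)
    qed
    finally have "F x = fps_const (x powi (1 - int t)) * (\<Sum>j<?g. c (int j - 1) * fps_const (x powi (int t - 1)) * Phi t j x)"
      by (simp add: F x)
    also have "\<dots> = (\<Sum>j<?g. (fps_const (x powi (1 - int t)) * fps_const (x powi (int t - 1))) * (c (int j - 1) * Phi t j x))"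
      unfolding sum_distrib_left by (simp only: mult_ac)
    also have "fps_const (x powi (1 - int t)) * fps_const (x powi (int t - 1)) = 1"
      using x by (simp flip: power_int_add)
    finally show ?thesis by simp
  qed
  define a where "a j = fps_const (inverse 2) * (c (int j - 1) - c (int (?g - j) - 1))" for j
  define \<Theta> where "\<Theta> j x = Phi t j x - Phi t (?g - j) x" for j and x :: 'a
  show ?thesis
  proof (intro exI[of _ a] allI impI)
    fix x :: 'a assume x: "x \<noteq> 0"
    have "fps_const x * F (inverse x) = (\<Sum>j<?g. c (int j - 1) * (fps_const x * Phi t j (inverse x)))"
      using x by (simp add: expand sum_distrib_left mult.left_commute del: sum.lessThan_Suc)
    also have "\<dots> = (\<Sum>j<?g. c (int j - 1) * Phi t (?g - j) x)"
      by (intro sum.cong refl arg_cong2[where f = times] Phi_reflect x) auto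
    finally have "F x + F x = (\<Sum>j<?g. c (int j - 1) * Phi t j x) - (\<Sum>j<?g. c (int j - 1) * Phi t (?g - j) x)"
      using F_refl[OF x] expand[OF x] by (metis diff_minus_eq_add)
    also have "\<dots> = (\<Sum>j<?g. c (int j - 1) * \<Theta> j x)"
      by (simp only: \<Theta>_def right_diff_distrib sum_subtractf)
    \<comment> \<open>The term for j = 0 vanishes by \<open>Phi_wrap\<close>.\<close>
    also have "\<dots> = (\<Sum>j\<in>{1..<?g}. c (int j - 1) * \<Theta> j x)"
      by (rule sum.mono_neutral_right) (use Phi_wrap[of t x] in \<open>auto simp: \<Theta>_def not_less_eq_eq\<close>)
    also have "{1..<?g} = {1..t} \<union> {t+1..<?g}" by auto
    also have "(\<Sum>j\<in>{1..t} \<union> {t+1..<?g}. c (int j - 1) * \<Theta> j x)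
      = (\<Sum>j=1..t. c (int j - 1) * \<Theta> j x) + (\<Sum>j=t+1..<?g. c (int j - 1) * \<Theta> j x)"
      by (rule sum.union_disjoint) auto
    \<comment> \<open>The upper half is folded onto the lower one: \<Theta> changes sign under j to
      g - j.\<close>
    also have "(\<Sum>j=t+1..<?g. c (int j - 1) * \<Theta> j x) = (\<Sum>j=1..t. - (c (int (?g - j) - 1) * \<Theta> j x))"
      by (rule sum.reindex_bij_witness[where i = "\<lambda>j. ?g - j" and j = "\<lambda>j. ?g - j"])
         (auto simp: \<Theta>_def algebra_simps)
    also have "(\<Sum>j=1..t. c (int j - 1) * \<Theta> j x) + \<dots> = (\<Sum>j=1..t. (c (int j - 1) - c (int (?g - j) - 1)) * \<Theta> j x)"
      by (simp only: sum.distrib[symmetric] left_diff_distrib) simp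
    finally have "fps_const (inverse 2) * (F x + F x) = (\<Sum>j=1..t. a j * \<Theta> j x)"
      by (simp only: a_def sum_distrib_left mult.assoc)
    moreover have "fps_const (inverse 2) * (F x + F x) = F x"
    proof -
      have "F x + F x = fps_const 2 * F x" by (simp add: numeral_fps_const flip: mult_2)
      then show ?thesis using two by (simp flip: mult.assoc)
    qed
    ultimately show "F x = (\<Sum>j=1..t. a j * (Phi t j x - Phi t (?g - j) x))" by (simp add: \<Theta>_def)
  qed
qed

section \<open>The product side as a quasi-periodic function of each variable\<close>

text \<open>The Jacobi theta function with nome T, of degree 1 in x. Its companion
  \<open>theta_fun2\<close> has base T^2 and argument T x^2, hence degree 2.\<close>

definition theta_fun :: "'a::field \<Rightarrow> 'a \<Rightarrow> 'a fps" where
  "theta_fun y x = qpoch_inf (fps_const (y * x)) fps_X * qpoch_inf (fps_X * fps_const (inverse (y * x))) fps_X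
     * qpoch_inf fps_X fps_X"

definition theta_fun2 :: "'a::field \<Rightarrow> 'a fps" where
  "theta_fun2 x = qpoch_inf (fps_X * fps_const (x ^ 2)) (fps_X ^ 2)
     * qpoch_inf (fps_X * fps_const (inverse (x ^ 2))) (fps_X ^ 2) * qpoch_inf (fps_X ^ 2) (fps_X ^ 2)"

lemma quasi_periodic_theta_fun: "y \<noteq> 0 \<Longrightarrow> quasi_periodic 1 (- fps_const y) (theta_fun y)"
  using quasi_periodic_theta[of y 1 0 1] by (simp add: theta_fun_def[abs_def])

lemma quasi_periodic_theta_fun2: "quasi_periodic 2 (- fps_X) theta_fun2"
  using quasi_periodic_theta[of 1 2 1 1] by (simp add: theta_fun2_def[abs_def])

text \<open>The part of the product that belongs to a pair of variables, together with its factor of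
  the Weyl denominator. That factor times x is (1 - x y)(1 - x/y), which supplies the missing first
  factors of two of the symbols and thus completes them to theta functions in x. In
  \<open>eta\<close>, the factor 1 - x plays the same role.\<close>

definition kappa :: "'a::field \<Rightarrow> 'a \<Rightarrow> 'a fps" where
  "kappa x y = fps_const (x + inverse x - y - inverse y)
     * (qpoch_inf (fps_X * fps_const (x * y)) fps_X
     * qpoch_inf (fps_X * fps_const (x * inverse y)) fps_X
     * qpoch_inf (fps_X * fps_const (inverse x * y)) fps_X
     * qpoch_inf (fps_X * fps_const (inverse x * inverse y)) fps_X)"

definition eta :: "'a::field \<Rightarrow> 'a fps" where
  "eta x = fps_const (1 - x)
     * (qpoch_inf (fps_X * fps_const x) fps_X
     * qpoch_inf (fps_X * fps_const (inverse x)) fps_X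
     * qpoch_inf (fps_X * fps_const (x ^ 2)) (fps_X ^ 2)
     * qpoch_inf (fps_X * fps_const (inverse x ^ 2)) (fps_X ^ 2))"

lemma kappa_swap: "kappa y x = - kappa x y"
proof -
  have "fps_const (y + inverse y - x - inverse x) = - fps_const (x + inverse x - y - inverse y)" by simp
  then show ?thesis unfolding kappa_def by (simp only: mult_ac mult_minus_left mult_minus_right)
qed

lemma kappa_same: "kappa x x = 0"
  by (simp add: kappa_def)

lemma kappa_inverse: "kappa (inverse x) y = kappa x y"
  by (simp add: kappa_def mult_ac add_ac)

lemma eta_inverse:
  assumes "x \<noteq> 0"
  shows "fps_const x * eta (inverse x) = - eta x"
proof -
  have "fps_const x * fps_const (1 - inverse x) = - fps_const (1 - x)"
    using assms by (simp add: algebra_simps)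
  then show ?thesis
    unfolding eta_def by (simp only: mult.assoc[symmetric] inverse_inverse_eq) (simp only: mult_ac mult_minus_left mult_minus_right)
qed

lemma theta_fun_eq:
  "theta_fun y x = fps_const (1 - y * x) * (qpoch_inf (fps_X * fps_const (y * x)) fps_X
     * qpoch_inf (fps_X * fps_const (inverse (y * x))) fps_X * qpoch_inf fps_X fps_X)"
proof -
  have "qpoch_inf (fps_const (y * x)) fps_X = (1 - fps_const (y * x)) * qpoch_inf (fps_const (y * x) * fps_X) fps_X"
    by (rule qpoch_rec) simp
  also have "1 - fps_const (y * x) = fps_const (1 - y * x)" by (simp flip: fps_const_1_eq_1 add: fps_const_sub)
  finally show ?thesis unfolding theta_fun_def by (simp only: mult_ac)
qed

lemma kappa_theta_fun:
  assumes x: "x \<noteq> 0" and y: "y \<noteq> 0"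
  shows "fps_const x * kappa x y * qpoch_inf fps_X fps_X ^ 2 = theta_fun y x * theta_fun (inverse y) x"
proof -
  define R where "R = qpoch_inf (fps_X * fps_const (x * y)) fps_X
     * qpoch_inf (fps_X * fps_const (x * inverse y)) fps_X
     * qpoch_inf (fps_X * fps_const (inverse x * y)) fps_X
     * qpoch_inf (fps_X * fps_const (inverse x * inverse y)) fps_X * (qpoch_inf fps_X fps_X * qpoch_inf fps_X fps_X)"
  have "fps_const x * kappa x y * qpoch_inf fps_X fps_X ^ 2 = (fps_const x * fps_const (x + inverse x - y - inverse y)) * R"
    unfolding kappa_def R_def power2_eq_square by (simp only: mult_ac)
  also have "fps_const x * fps_const (x + inverse x - y - inverse y) = fps_const (1 - y * x) * fps_const (1 - inverse y * x)"
    using x y by (simp add: field_simps)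
  also have "\<dots> * R = theta_fun y x * theta_fun (inverse y) x"
  proof -
    have "inverse (y * x) = inverse x * inverse y" "inverse (inverse y * x) = inverse x * y" by simp_all
    then show ?thesis unfolding theta_fun_eq R_def by (simp only: mult_ac)
  qed
  finally show ?thesis .
qed

lemma eta_theta_fun:
  "eta x * (qpoch_inf fps_X fps_X * qpoch_inf (fps_X ^ 2) (fps_X ^ 2)) = theta_fun 1 x * theta_fun2 x"
  unfolding theta_fun_eq theta_fun2_def eta_def mult_1_left power_inverse by (simp only: mult_ac)

lemma qpoch_X_unit: "(qpoch_inf fps_X fps_X :: 'a::field fps) $ 0 = 1" "(qpoch_inf (fps_X ^ 2) (fps_X ^ 2) :: 'a fps) $ 0 = 1"
  by (simp_all add: qpoch_nth_0)

text \<open>The degrees 1 + 2 of \<open>eta\<close> and 1 + 1 for each of the other t - 1 variables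
  add up to 2t + 1. The multipliers -1 and -T of \<open>eta\<close> give T, and the two of each
  other variable are reciprocal. The factors x of \<open>kappa_theta_fun\<close> account for the
  power 1 - t, and the reflection is odd for \<open>eta\<close> and even for
  \<open>kappa\<close>.\<close>

lemma kappa_eta_in_span:
  fixes x :: "nat \<Rightarrow> 'a::field"
  assumes t: "t \<ge> 1" and i: "i \<in> {1..t}" and x: "\<And>j. j \<in> {1..t} \<Longrightarrow> x j \<noteq> 0" and two: "(2::'a) \<noteq> 0"
  shows "\<exists>a. \<forall>y. y \<noteq> 0 \<longrightarrow>
    eta y * (\<Prod>j\<in>{1..t} - {i}. kappa y (x j)) = (\<Sum>j=1..t. a j * (Phi t j y - Phi t (2 * t + 1 - j) y))"
proof -
  let ?J = "{1..t} - {i}"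
  let ?W = "qpoch_inf fps_X fps_X :: 'a fps"
  let ?W2 = "qpoch_inf (fps_X ^ 2) (fps_X ^ 2) :: 'a fps"
  \<comment> \<open>The symbols (T;T) and (T^2;T^2) that complete the theta functions;
    \<open>U\<close> has constant term 1 and is divided out at the end.\<close>
  define U where "U = ?W * ?W2 * (?W ^ 2) ^ (t - 1)"
  define f where "f y = theta_fun 1 y * theta_fun2 y * (\<Prod>j\<in>?J. theta_fun (x j) y * theta_fun (inverse (x j)) y)" for y
  define G where "G y = eta y * (\<Prod>j\<in>?J. kappa y (x j))" for y
  have card: "card ?J = t - 1" "card ({Suc 0..t} - {i}) = t - Suc 0" using i by simp_all
  have "quasi_periodic (1 + 2 + (\<Sum>j\<in>?J. 1 + 1))
     (- fps_const 1 * (- fps_X) * (\<Prod>j\<in>?J. - fps_const (x j) * - fps_const (inverse (x j)))) f"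
    unfolding f_def
    by (intro quasi_periodic_mult quasi_periodic_prod quasi_periodic_theta_fun quasi_periodic_theta_fun2) (use x in auto)
  also have "(\<Prod>j\<in>?J. - fps_const (x j) * - fps_const (inverse (x j))) = (\<Prod>j\<in>?J. 1)"
    by (rule prod.cong) (use x in auto)
  also have "- fps_const 1 * (- fps_X) * (\<Prod>j\<in>?J. 1) = (fps_X :: 'a fps)" by simp
  also have "(1 + 2 + (\<Sum>j\<in>?J. 1 + 1) :: int) = int (2 * t + 1)" using t card by simp
  finally have f: "quasi_periodic (int (2 * t + 1)) fps_X f" .
  have F: "U * G y = fps_const (y powi (1 - int t)) * f y" if y: "y \<noteq> 0" for y
  proof -
    have "fps_const y ^ (t - 1) * (U * G y)
      = (eta y * (?W * ?W2)) * (\<Prod>j\<in>?J. fps_const y * kappa y (x j) * ?W ^ 2)"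
      by (simp add: U_def G_def prod.distrib card mult_ac)
    also have "\<dots> = f y"
      unfolding f_def eta_theta_fun
      by (intro arg_cong2[where f = times] prod.cong refl kappa_theta_fun) (use x y in auto)
    finally have "fps_const (y powi (1 - int t)) * f y
      = (fps_const (y powi (1 - int t)) * fps_const y ^ (t - 1)) * (U * G y)" by (simp only: mult.assoc)
    also have "fps_const (y powi (1 - int t)) * fps_const y ^ (t - 1) = 1"
    proof -
      have "y powi (1 - int t) * y ^ (t - 1) = y powi (1 - int t) * y powi int (t - 1)"
        by (simp only: power_int_of_nat)
      also have "\<dots> = 1" using y t by (simp add: of_nat_diff flip: power_int_add)
      finally show ?thesis by (simp add: fps_const_power)
    qed
    finally show ?thesis by simp
  qed
  have refl: "fps_const y * (U * G (inverse y)) = - (U * G y)" if "y \<noteq> 0" for y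
    using eta_inverse[OF that] unfolding G_def kappa_inverse
    by (metis (no_types, lifting) mult.assoc mult.left_commute mult_minus_left mult_minus_right)
  obtain a where a: "\<And>y. y \<noteq> 0 \<Longrightarrow> U * G y = (\<Sum>j=1..t. a j * (Phi t j y - Phi t (2 * t + 1 - j) y))"
    using quasi_periodic_in_span[OF t f two F refl] by blast
  have U: "inverse U * U = 1"
    by (rule inverse_mult_eq_1) (simp add: U_def qpoch_X_unit fps_power_zeroth)
  show ?thesis
  proof (intro exI[of _ "\<lambda>j. inverse U * a j"] allI impI)
    fix y :: 'a assume "y \<noteq> 0"
    have "G y = inverse U * (U * G y)" by (simp flip: mult.assoc add: U)
    also have "\<dots> = (\<Sum>j=1..t. inverse U * a j * (Phi t j y - Phi t (2 * t + 1 - j) y))"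
      unfolding a[OF \<open>y \<noteq> 0\<close>] sum_distrib_left by (simp only: mult.assoc)
    finally show "eta y * (\<Prod>j\<in>?J. kappa y (x j)) = \<dots>" by (simp add: G_def)
  qed
qed

definition pairs :: "nat \<Rightarrow> (nat \<times> nat) set" where
  "pairs t = {(i, j). 1 \<le> i \<and> i < j \<and> j \<le> t}"

lemma finite_pairs [simp]: "finite (pairs t)"
  by (rule finite_subset[of _ "{1..t} \<times> {1..t}"]) (auto simp: pairs_def)

definition weyl_prod :: "nat \<Rightarrow> (nat \<Rightarrow> 'a::field) \<Rightarrow> 'a fps" where
  "weyl_prod t x = (\<Prod>(i, j)\<in>pairs t. kappa (x i) (x j)) * (\<Prod>i=1..t. eta (x i))"

lemma prod_pairs_split:
  fixes f :: "nat \<Rightarrow> nat \<Rightarrow> 'b::comm_monoid_mult"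
  assumes i: "i \<in> {1..t}"
  shows "(\<Prod>(j, k)\<in>pairs t. f j k) = (\<Prod>(j, k)\<in>{p\<in>pairs t. fst p \<noteq> i \<and> snd p \<noteq> i}. f j k)
    * ((\<Prod>k\<in>{i<..t}. f i k) * (\<Prod>j\<in>{1..<i}. f j i))"
proof -
  let ?A = "{p\<in>pairs t. fst p \<noteq> i \<and> snd p \<noteq> i}"
  let ?B = "Pair i ` {i<..t}" and ?C = "(\<lambda>j. (j, i)) ` {1..<i}"
  have P: "pairs t = ?A \<union> (?B \<union> ?C)" using i by (auto simp: pairs_def)
  have "(\<Prod>(j, k)\<in>pairs t. f j k) = (\<Prod>(j, k)\<in>?A \<union> (?B \<union> ?C). f j k)" by (subst P) (rule refl)
  also have "\<dots> = (\<Prod>(j, k)\<in>?A. f j k) * (\<Prod>(j, k)\<in>?B \<union> ?C. f j k)"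
  proof (rule prod.union_disjoint)
    show "finite ?A" by (rule finite_subset[OF _ finite_pairs]) auto
  qed auto
  also have "(\<Prod>(j, k)\<in>?B \<union> ?C. f j k) = (\<Prod>(j, k)\<in>?B. f j k) * (\<Prod>(j, k)\<in>?C. f j k)"
    by (rule prod.union_disjoint) auto
  also have "(\<Prod>(j, k)\<in>?B. f j k) = (\<Prod>k\<in>{i<..t}. f i k)"
    by (subst prod.reindex) (auto simp: inj_on_def)
  also have "(\<Prod>(j, k)\<in>?C. f j k) = (\<Prod>j\<in>{1..<i}. f j i)"
    by (subst prod.reindex) (auto simp: inj_on_def)
  finally show ?thesis .
qed

text \<open>Pairs in which i comes second are turned around by \<open>kappa_swap\<close>; the signs
  go into \<open>C\<close>, together with all factors free of variable i.\<close>

lemma weyl_prod_upd: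
  fixes x :: "nat \<Rightarrow> 'a::field"
  assumes i: "i \<in> {1..t}"
  obtains C where "\<And>y. weyl_prod t (x(i := y)) = C * (eta y * (\<Prod>j\<in>{1..t} - {i}. kappa y (x j)))"
proof
  fix y
  let ?z = "x(i := y)"
  let ?A = "{p\<in>pairs t. fst p \<noteq> i \<and> snd p \<noteq> i}"
  have "(\<Prod>(j, k)\<in>pairs t. kappa (?z j) (?z k)) = (\<Prod>(j, k)\<in>?A. kappa (?z j) (?z k))
    * ((\<Prod>k\<in>{i<..t}. kappa (?z i) (?z k)) * (\<Prod>j\<in>{1..<i}. kappa (?z j) (?z i)))"
    by (rule prod_pairs_split[OF i])
  also have "(\<Prod>(j, k)\<in>?A. kappa (?z j) (?z k)) = (\<Prod>(j, k)\<in>?A. kappa (x j) (x k))"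
    by (rule prod.cong) auto
  also have "(\<Prod>k\<in>{i<..t}. kappa (?z i) (?z k)) = (\<Prod>k\<in>{i<..t}. kappa y (x k))"
    by (rule prod.cong) auto
  also have "(\<Prod>j\<in>{1..<i}. kappa (?z j) (?z i)) = (\<Prod>j\<in>{1..<i}. - 1 * kappa y (x j))"
    by (rule prod.cong) (auto simp: kappa_swap[of y])
  also have "\<dots> = (- 1) ^ card {1..<i} * (\<Prod>j\<in>{1..<i}. kappa y (x j))"
    by (simp only: prod.distrib prod_constant)
  also have "(\<Prod>k\<in>{i<..t}. kappa y (x k)) * ((- 1) ^ card {1..<i} * (\<Prod>j\<in>{1..<i}. kappa y (x j)))
    = (- 1) ^ card {1..<i} * ((\<Prod>k\<in>{i<..t}. kappa y (x k)) * (\<Prod>j\<in>{1..<i}. kappa y (x j)))"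
    by (rule mult.left_commute)
  also have "(\<Prod>k\<in>{i<..t}. kappa y (x k)) * (\<Prod>j\<in>{1..<i}. kappa y (x j)) = (\<Prod>j\<in>{i<..t} \<union> {1..<i}. kappa y (x j))"
    by (rule prod.union_disjoint[symmetric]) auto
  also have "{i<..t} \<union> {1..<i} = {1..t} - {i}" using i by auto
  finally have 1: "(\<Prod>(j, k)\<in>pairs t. kappa (?z j) (?z k))
    = (\<Prod>(j, k)\<in>?A. kappa (x j) (x k)) * ((- 1) ^ card {1..<i} * (\<Prod>j\<in>{1..t} - {i}. kappa y (x j)))" .
  have "(\<Prod>j=1..t. eta (?z j)) = eta (?z i) * (\<Prod>j\<in>{1..t} - {i}. eta (?z j))"
    by (rule prod.remove) (use i in auto)
  also have "(\<Prod>j\<in>{1..t} - {i}. eta (?z j)) = (\<Prod>j\<in>{1..t} - {i}. eta (x j))"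
    by (rule prod.cong) auto
  finally have 2: "(\<Prod>j=1..t. eta (?z j)) = eta y * (\<Prod>j\<in>{1..t} - {i}. eta (x j))" by simp
  show "weyl_prod t (x(i := y)) = ((\<Prod>(j, k)\<in>?A. kappa (x j) (x k)) * (- 1) ^ card {1..<i} * (\<Prod>j\<in>{1..t} - {i}. eta (x j)))
     * (eta y * (\<Prod>j\<in>{1..t} - {i}. kappa y (x j)))"
    unfolding weyl_prod_def 1 2 by (simp only: mult_ac)
qed

lemma weyl_prod_in_span:
  fixes x :: "nat \<Rightarrow> 'a::field"
  assumes "t \<ge> 1" "i \<in> {1..t}" "\<And>j. j \<in> {1..t} \<Longrightarrow> x j \<noteq> 0" "(2::'a) \<noteq> 0"
  obtains a where "\<And>y. y \<noteq> 0 \<Longrightarrow> weyl_prod t (x(i := y)) = (\<Sum>j=1..t. a j * (Phi t j y - Phi t (2 * t + 1 - j) y))"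
proof -
  obtain C where C: "\<And>y. weyl_prod t (x(i := y)) = C * (eta y * (\<Prod>j\<in>{1..t} - {i}. kappa y (x j)))"
    using weyl_prod_upd[OF assms(2)] by blast
  have "\<exists>a. \<forall>y. y \<noteq> 0 \<longrightarrow>
    eta y * (\<Prod>j\<in>{1..t} - {i}. kappa y (x j)) = (\<Sum>j=1..t. a j * (Phi t j y - Phi t (2 * t + 1 - j) y))"
    by (rule kappa_eta_in_span) (use assms in auto)
  then obtain a where a: "\<forall>y. y \<noteq> 0 \<longrightarrow>
    eta y * (\<Prod>j\<in>{1..t} - {i}. kappa y (x j)) = (\<Sum>j=1..t. a j * (Phi t j y - Phi t (2 * t + 1 - j) y))" ..
  show ?thesis
  proof (rule that[of "\<lambda>j. C * a j"])
    fix y :: 'a assume "y \<noteq> 0"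
    then show "weyl_prod t (x(i := y)) = (\<Sum>j=1..t. C * a j * (Phi t j y - Phi t (2 * t + 1 - j) y))"
      using a by (simp only: C sum_distrib_left mult.assoc simp_thms)
  qed
qed

lemma weyl_prod_eq_0:
  assumes "i \<in> {1..t}" "k \<in> {1..t}" "k \<noteq> i"
  shows "weyl_prod t (x(i := x k)) = 0"
proof -
  obtain C where "\<And>y. weyl_prod t (x(i := y)) = C * (eta y * (\<Prod>j\<in>{1..t} - {i}. kappa y (x j)))"
    using weyl_prod_upd[OF assms(1)] by blast
  moreover have "(\<Prod>j\<in>{1..t} - {i}. kappa (x k) (x j)) = 0"
    by (rule prod_zero) (use assms in \<open>auto intro!: bexI[of _ k] simp: kappa_same\<close>)
  ultimately show ?thesis by simp
qed

section \<open>The theta determinant\<close>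

definition theta_mat :: "nat \<Rightarrow> (nat \<Rightarrow> 'a::field) \<Rightarrow> 'a fps mat" where
  "theta_mat t x = mat t t (\<lambda>(i, j). Phi t (j + 1) (x (i + 1)) - Phi t (2 * t - j) (x (i + 1)))"

definition theta_det :: "nat \<Rightarrow> (nat \<Rightarrow> 'a::field) \<Rightarrow> 'a fps" where
  "theta_det t x = det (theta_mat t x)"

text \<open>Laplace expansion along the row of variable i. Its cofactors do not involve this
  variable, so they are the coefficients.\<close>

lemma theta_det_in_span:
  assumes i: "i \<in> {1..t}"
  obtains b where "\<And>y. theta_det t (x(i := y)) = (\<Sum>j=1..t. b j * (Phi t j y - Phi t (2 * t + 1 - j) y))"
proof
  fix y
  let ?z = "x(i := y)"
  have carr: "theta_mat t z \<in> carrier_mat t t" for z :: "nat \<Rightarrow> 'a" by (simp add: theta_mat_def)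
  have i': "i - 1 < t" "i - 1 + 1 = i" using i by auto
  have cof: "cofactor (theta_mat t ?z) (i - 1) j = cofactor (theta_mat t x) (i - 1) j" if "j < t" for j
  proof -
    have "mat_delete (theta_mat t ?z) (i - 1) j = mat_delete (theta_mat t x) (i - 1) j"
      unfolding mat_delete_def by (rule eq_matI) (use i that in \<open>auto simp: theta_mat_def\<close>)
    then show ?thesis by (simp add: cofactor_def)
  qed
  have "theta_det t ?z = (\<Sum>j<t. theta_mat t ?z $$ (i - 1, j) * cofactor (theta_mat t ?z) (i - 1) j)"
    unfolding theta_det_def by (rule laplace_expansion_row[OF carr i'(1)])
  also have "\<dots> = (\<Sum>j<t. cofactor (theta_mat t x) (i - 1) j * (Phi t (j + 1) y - Phi t (2 * t - j) y))"
  proof (rule sum.cong[OF refl])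
    fix j assume "j \<in> {..<t}"
    then have j: "j < t" by simp
    have e: "theta_mat t ?z $$ (i - 1, j) = Phi t (j + 1) y - Phi t (2 * t - j) y"
      unfolding theta_mat_def using i' j by simp
    show "theta_mat t ?z $$ (i - 1, j) * cofactor (theta_mat t ?z) (i - 1) j
      = cofactor (theta_mat t x) (i - 1) j * (Phi t (j + 1) y - Phi t (2 * t - j) y)"
      unfolding e cof[OF j] by (rule mult.commute)
  qed
  also have "\<dots> = (\<Sum>j=1..t. cofactor (theta_mat t x) (i - 1) (j - 1) * (Phi t j y - Phi t (2 * t + 1 - j) y))"
    by (rule sum.reindex_bij_witness[where i = "\<lambda>j. j - 1" and j = "\<lambda>j. j + 1"]) auto
  finally show "theta_det t ?z = \<dots>" .
qed

lemma theta_det_eq_0: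
  assumes i: "i \<in> {1..t}" and k: "k \<in> {1..t}" "k \<noteq> i"
  shows "theta_det t (x(i := x k)) = 0"
  unfolding theta_det_def
proof (rule det_identical_rows)
  show "theta_mat t (x(i := x k)) \<in> carrier_mat t t" by (simp add: theta_mat_def)
  show "i - 1 \<noteq> k - 1" "i - 1 < t" "k - 1 < t" using assms by auto
  show "row (theta_mat t (x(i := x k))) (i - 1) = row (theta_mat t (x(i := x k))) (k - 1)"
    by (rule eq_vecI) (use assms in \<open>auto simp: theta_mat_def\<close>)
qed

text \<open>The coefficients of a combination that vanishes at all points form a kernel vector of
  \<open>theta_mat\<close>.\<close>

lemma span_eq_0:
  fixes x :: "nat \<Rightarrow> 'a::field"
  assumes D: "theta_det t x \<noteq> 0"
    and zero: "\<And>k. k \<in> {1..t} \<Longrightarrow> (\<Sum>j=1..t. v j * (Phi t j (x k) - Phi t (2 * t + 1 - j) (x k))) = 0"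
    and j: "j \<in> {1..t}"
  shows "v j = 0"
proof -
  define w where "w = vec t (\<lambda>j. v (j + 1))"
  have M: "theta_mat t x \<in> carrier_mat t t" by (simp add: theta_mat_def)
  have "theta_mat t x *\<^sub>v w = 0\<^sub>v t"
  proof (rule eq_vecI)
    fix i assume "i < dim_vec (0\<^sub>v t :: 'a fps vec)"
    then have i: "i < t" by simp
    have "vec_index (theta_mat t x *\<^sub>v w) i = (\<Sum>j<t. (Phi t (j + 1) (x (i + 1)) - Phi t (2 * t - j) (x (i + 1))) * v (j + 1))"
      using i by (simp add: theta_mat_def w_def scalar_prod_def lessThan_atLeast0)
    also have "\<dots> = (\<Sum>j=1..t. v j * (Phi t j (x (i + 1)) - Phi t (2 * t + 1 - j) (x (i + 1))))"
      by (rule sum.reindex_bij_witness[where i = "\<lambda>j. j - 1" and j = "\<lambda>j. j + 1"]) (auto simp: mult.commute)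
    also have "\<dots> = 0" using i by (intro zero) auto
    finally show "vec_index (theta_mat t x *\<^sub>v w) i = vec_index (0\<^sub>v t) i" using i by simp
  qed (simp add: theta_mat_def)
  moreover have "w \<in> carrier_vec t" by (simp add: w_def)
  ultimately have "w = 0\<^sub>v t"
    using D det_0_iff_vec_prod_zero[OF M] unfolding theta_det_def by blast
  then have e: "vec_index w (j - 1) = vec_index (0\<^sub>v t) (j - 1)" by simp
  have "j - 1 < t" "j - 1 + 1 = j" using j by auto
  then show ?thesis using e by (simp add: w_def)
qed

text \<open>As functions of the variable at \<open>i\<close>, both sides lie in the span of the same \<open>t\<close> theta
  functions, and their difference vanishes at \<open>x 1, \<dots>, x t\<close>; the nonvanishing of the determinant makes
  these points separate the span.\<close>

lemma exchange_aux:
  fixes x :: "nat \<Rightarrow> 'a::field"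
  assumes t: "t \<ge> 1" and i: "i \<in> {1..t}" and x: "\<And>j. j \<in> {1..t} \<Longrightarrow> x j \<noteq> 0" and two: "(2::'a) \<noteq> 0"
    and y: "y \<noteq> 0" and D: "theta_det t x \<noteq> 0"
  shows "theta_det t x * weyl_prod t (x(i := y)) = theta_det t (x(i := y)) * weyl_prod t x"
proof -
  define \<theta> where "\<theta> j z = Phi t j z - Phi t (2 * t + 1 - j) z" for j and z :: 'a
  obtain a where a: "\<And>z. z \<noteq> 0 \<Longrightarrow> weyl_prod t (x(i := z)) = (\<Sum>j=1..t. a j * \<theta> j z)"
    using weyl_prod_in_span[where x = x, OF t i x two] unfolding \<theta>_def by blast
  obtain b where b: "\<And>z. theta_det t (x(i := z)) = (\<Sum>j=1..t. b j * \<theta> j z)"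
    using theta_det_in_span[OF i] unfolding \<theta>_def by blast
  define v where "v j = theta_det t x * a j - weyl_prod t x * b j" for j
  have comb: "(\<Sum>j=1..t. v j * \<theta> j z) = theta_det t x * weyl_prod t (x(i := z)) - weyl_prod t x * theta_det t (x(i := z))"
    if "z \<noteq> 0" for z
    unfolding a[OF that] b v_def sum_distrib_left sum_subtractf[symmetric] by (simp only: left_diff_distrib mult.assoc)
  have "(\<Sum>j=1..t. v j * \<theta> j (x k)) = 0" if k: "k \<in> {1..t}" for k
  proof (cases "k = i")
    case True
    then show ?thesis using comb[OF x[OF i]] by (simp add: mult.commute)
  next
    case False
    then show ?thesis using comb[OF x[OF k]] weyl_prod_eq_0[OF i k False, of x] theta_det_eq_0[OF i k False, of x] by simp
  qed
  then have "v j = 0" if "j \<in> {1..t}" for j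
    using span_eq_0[OF D, of v j] that unfolding \<theta>_def by blast
  then have "(\<Sum>j=1..t. v j * \<theta> j y) = 0" by simp
  then show ?thesis using comb[OF y] by (simp add: mult.commute)
qed

text \<open>If the determinant vanishes at x but not at the changed point, the argument is run
  backwards from there; if it vanishes at both points, both sides are 0.\<close>

lemma exchange:
  fixes x :: "nat \<Rightarrow> 'a::field"
  assumes t: "t \<ge> 1" and i: "i \<in> {1..t}" and x: "\<And>j. j \<in> {1..t} \<Longrightarrow> x j \<noteq> 0" and two: "(2::'a) \<noteq> 0"
    and y: "y \<noteq> 0"
  shows "theta_det t x * weyl_prod t (x(i := y)) = theta_det t (x(i := y)) * weyl_prod t x"
proof (cases "theta_det t x = 0")
  case False
  show ?thesis by (rule exchange_aux[OF t i x two y False])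
next
  case D: True
  show ?thesis
  proof (cases "theta_det t (x(i := y)) = 0")
    case True
    then show ?thesis using D by simp
  next
    case False
    have "theta_det t (x(i := y)) * weyl_prod t ((x(i := y))(i := x i))
      = theta_det t ((x(i := y))(i := x i)) * weyl_prod t (x(i := y))"
      by (rule exchange_aux[OF t i _ two _ False]) (use x y i in auto)
    then show ?thesis by simp
  qed
qed

text \<open>Variable by variable, x is replaced by z. Chaining two exchanges cancels the product at
  the point between them; hence the assumption that it is nonzero at every mixed point.\<close>

lemma theta_det_weyl_prod_proportional:
  fixes x z :: "nat \<Rightarrow> 'a::field"
  assumes t: "t \<ge> 1" and two: "(2::'a) \<noteq> 0"
    and x: "\<And>j. j \<in> {1..t} \<Longrightarrow> x j \<noteq> 0" and z: "\<And>j. j \<in> {1..t} \<Longrightarrow> z j \<noteq> 0"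
    and nz: "\<And>m. m \<le> t \<Longrightarrow> weyl_prod t (\<lambda>i. if i \<le> m then z i else x i) \<noteq> 0"
  shows "theta_det t x * weyl_prod t z = theta_det t z * weyl_prod t x"
proof -
  define w where "w m = (\<lambda>i. if i \<le> m then z i else x i)" for m
  have cong: "theta_det t u = theta_det t v" "weyl_prod t u = weyl_prod t v"
    if "\<And>i. i \<in> {1..t} \<Longrightarrow> u i = v i" for u v :: "nat \<Rightarrow> 'a"
  proof -
    show "theta_det t u = theta_det t v"
      unfolding theta_det_def theta_mat_def by (intro arg_cong[where f = det] eq_matI) (auto simp: that)
    show "weyl_prod t u = weyl_prod t v"
      unfolding weyl_prod_def by (intro arg_cong2[where f = times] prod.cong) (auto simp: that pairs_def)
  qed
  have "theta_det t x * weyl_prod t (w m) = theta_det t (w m) * weyl_prod t x" if "m \<le> t" for m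
    using that
  proof (induction m)
    case 0
    have "theta_det t (w 0) = theta_det t x" "weyl_prod t (w 0) = weyl_prod t x"
      by (auto intro!: cong simp: w_def)
    then show ?case by simp
  next
    case (Suc m)
    have upd: "(w m)(Suc m := z (Suc m)) = w (Suc m)" by (auto simp: w_def)
    have "theta_det t (w m) * weyl_prod t ((w m)(Suc m := z (Suc m)))
      = theta_det t ((w m)(Suc m := z (Suc m))) * weyl_prod t (w m)"
      by (rule exchange[OF t _ _ two]) (use Suc x z in \<open>auto simp: w_def\<close>)
    then have ex: "theta_det t (w m) * weyl_prod t (w (Suc m)) = theta_det t (w (Suc m)) * weyl_prod t (w m)"
      unfolding upd .
    have "weyl_prod t (w m) * (theta_det t x * weyl_prod t (w (Suc m)))
      = (theta_det t x * weyl_prod t (w m)) * weyl_prod t (w (Suc m))" by (simp only: mult_ac)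
    also have "\<dots> = (theta_det t (w m) * weyl_prod t (w (Suc m))) * weyl_prod t x"
      using Suc by (simp only: mult_ac Suc_leD)
    also have "\<dots> = weyl_prod t (w m) * (theta_det t (w (Suc m)) * weyl_prod t x)"
      unfolding ex by (simp only: mult_ac)
    finally show ?case using nz[of m] Suc by (simp add: w_def)
  qed
  from this[of t] have "theta_det t x * weyl_prod t (w t) = theta_det t (w t) * weyl_prod t x" by simp
  moreover have "theta_det t (w t) = theta_det t z" "weyl_prod t (w t) = weyl_prod t z"
    by (auto intro!: cong simp: w_def)
  ultimately show ?thesis by simp
qed

section \<open>Evaluation at roots of unity\<close>

text \<open>As polynomials in z, both sides have degree at most g and agree at g + 1 points: at 0
  and at the g powers of \<zeta>.\<close>

lemma prod_one_minus_root_of_unity: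
  fixes \<zeta> :: "'a::idom"
  assumes g: "g > 0" and \<zeta>: "\<zeta> ^ g = 1" "\<And>i. 0 < i \<Longrightarrow> i < g \<Longrightarrow> \<zeta> ^ i \<noteq> 1"
  shows "(\<Prod>r<g. 1 - \<zeta> ^ r * z) = 1 - z ^ g"
proof -
  define p where "p = (\<Prod>r<g. [:1, - (\<zeta> ^ r):])"
  define q where "q = (1 - Polynomial.monom 1 g :: 'a poly)"
  define A where "A = Set.insert 0 ((\<lambda>r. \<zeta> ^ r) ` {..<g})"
  have nz: "\<zeta> \<noteq> 0" using \<zeta>(1) g by (auto simp: power_0_left)
  have inj: "inj_on (\<lambda>r. \<zeta> ^ r) {..<g}"
  proof (rule linorder_inj_onI)
    fix r s assume rs: "r < s" "r \<in> {..<g}" "s \<in> {..<g}"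
    have "\<zeta> ^ s = \<zeta> ^ r * \<zeta> ^ (s - r)" using rs by (simp flip: power_add)
    moreover have "\<zeta> ^ (s - r) \<noteq> 1" using rs by (intro \<zeta>(2)) auto
    ultimately show "\<zeta> ^ r \<noteq> \<zeta> ^ s" using nz by auto
  qed auto
  have card: "card A = Suc g" unfolding A_def using nz by (subst card_insert_disjoint) (auto simp: card_image[OF inj])
  have "Polynomial.degree p \<le> g"
  proof -
    have "Polynomial.degree p \<le> (\<Sum>r<g. Polynomial.degree [:1, - (\<zeta> ^ r):])" 
      using degree_prod_sum_le[of "{..<g}" "\<lambda>r. [:1, - (\<zeta> ^ r):]"] by (simp add: p_def o_def)
    also have "\<dots> \<le> (\<Sum>r<g. 1)" by (rule sum_mono) simp
    finally show ?thesis by simp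
  qed
  moreover have "Polynomial.degree q \<le> g" unfolding q_def by (intro degree_diff_le) (auto simp: degree_monom_le)
  moreover have "poly p y = poly q y" if y: "y \<in> A" for y
  proof (cases "y = 0")
    case True
    then show ?thesis using g by (simp add: p_def q_def poly_prod poly_monom)
  next
    case False
    then obtain r where r: "r < g" "y = \<zeta> ^ r" using y by (auto simp: A_def)
    \<comment> \<open>The exponent inverse to r modulo g; factor s of the product vanishes at y =
      \<zeta>^r.\<close>
    define s where "s = (if r = 0 then 0 else g - r)"
    have s: "s < g" "\<zeta> ^ s * \<zeta> ^ r = 1" unfolding s_def using r g \<zeta>(1) by (auto simp flip: power_add)
    have "poly p y = (\<Prod>r'<g. 1 - \<zeta> ^ r' * y)" by (simp add: p_def poly_prod mult.commute)
    also have "\<dots> = 0" by (rule prod_zero) (use s r in \<open>auto intro!: bexI[of _ s]\<close>)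
    also have "0 = poly q y"
      using \<zeta>(1) unfolding q_def r by (simp add: poly_monom) (metis mult.commute power_mult power_one)
    finally show ?thesis .
  qed
  ultimately have "p = q" by (intro poly_eqI_degree[of A]) (auto simp: card)
  then have "poly p z = poly q z" by simp
  then show ?thesis by (simp add: p_def q_def poly_prod poly_monom mult.commute)
qed

text \<open>When i runs through the residues other than - j, the sum i + j runs through all nonzero
  residues, so the product of h (i + j) is the product over i = 1, ..., t taken twice. On the left,
  i = 0 contributes h(j), i = j contributes h(2j), and the rest is grouped as i and - i.\<close>

lemma prod_even_periodic_shift:
  fixes h :: "int \<Rightarrow> 'b::comm_monoid_mult"
  assumes even: "\<And>k. h (- k) = h k" and per: "\<And>k. h (k + int (2 * t + 1)) = h k" and j: "j \<in> {1..t}"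
  shows "h (int j) * h (int (2 * j)) * (\<Prod>i\<in>{1..t} - {j}. h (int i + int j) * h (int i - int j)) = (\<Prod>i=1..t. h (int i)) ^ 2"
proof -
  let ?T = "int t" and ?J = "int j"
  have J: "1 \<le> ?J" "?J \<le> ?T" using j by auto
  have split: "(\<Prod>i\<in>{-?T..?T} - {0}. u i) = (\<Prod>i=1..t. u (int i) * u (- int i))" for u :: "int \<Rightarrow> 'b"
  proof -
    have "{-?T..?T} - {0} = {1..?T} \<union> {-?T..-1}" by auto
    then have "(\<Prod>i\<in>{-?T..?T} - {0}. u i) = (\<Prod>i\<in>{1..?T}. u i) * (\<Prod>i\<in>{-?T..-1}. u i)"
      by (simp add: prod.union_disjoint)
    also have "(\<Prod>i\<in>{1..?T}. u i) = (\<Prod>i=1..t. u (int i))"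
      by (rule prod.reindex_bij_witness[where i = int and j = nat]) auto
    also have "(\<Prod>i\<in>{-?T..-1}. u i) = (\<Prod>i=1..t. u (- int i))"
      by (rule prod.reindex_bij_witness[where i = "\<lambda>i. - int i" and j = "\<lambda>i. nat (- i)"]) auto
    finally show ?thesis by (simp add: prod.distrib)
  qed
  have "(\<Prod>i\<in>{-?T..?T} - {-?J}. h (i + ?J)) = (\<Prod>k\<in>{-?T..?T} - {0}. h k)"
  proof (rule prod.reindex_bij_witness[where j = "\<lambda>i. if i + ?J \<le> ?T then i + ?J else i + ?J - int (2 * t + 1)"
        and i = "\<lambda>k. if k - ?J \<ge> -?T then k - ?J else k - ?J + int (2 * t + 1)"])
    fix i assume "i \<in> {-?T..?T} - {-?J}"
    then show "h (if i + ?J \<le> ?T then i + ?J else i + ?J - int (2 * t + 1)) = h (i + ?J)"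
      using per[of "i + ?J - int (2 * t + 1)"] by auto
  qed (use J in \<open>auto split: if_splits\<close>)
  also have "\<dots> = (\<Prod>i=1..t. h (int i)) ^ 2"
    unfolding split by (simp add: even prod.distrib power2_eq_square)
  finally have 1: "(\<Prod>i\<in>{-?T..?T} - {-?J}. h (i + ?J)) = (\<Prod>i=1..t. h (int i)) ^ 2" .
  \<comment> \<open>The excluded index - j is put back with the value 1, so that the range becomes
    symmetric.\<close>
  define u where "u i = (if i = -?J then 1 else h (i + ?J))" for i
  have "(\<Prod>i\<in>{-?T..?T} - {-?J}. h (i + ?J)) = (\<Prod>i\<in>{-?T..?T}. u i)"
    by (rule prod.mono_neutral_cong_left) (auto simp: u_def)
  also have "\<dots> = u 0 * (\<Prod>i\<in>{-?T..?T} - {0}. u i)" by (rule prod.remove) auto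
  also have "u 0 = h ?J" using J by (simp add: u_def)
  also have "(\<Prod>i\<in>{-?T..?T} - {0}. u i) = (\<Prod>i=1..t. u (int i) * u (- int i))" by (rule split)
  also have "\<dots> = (u ?J * u (- ?J)) * (\<Prod>i\<in>{1..t} - {j}. u (int i) * u (- int i))" by (rule prod.remove) (use j in auto)
  also have "u ?J * u (- ?J) = h (int (2 * j))" using J by (simp add: u_def)
  also have "(\<Prod>i\<in>{1..t} - {j}. u (int i) * u (- int i)) = (\<Prod>i\<in>{1..t} - {j}. h (int i + int j) * h (int i - int j))"
  proof (rule prod.cong[OF refl])
    fix i assume i: "i \<in> {1..t} - {j}"
    have "h (- int i + ?J) = h (int i - ?J)" using even[of "int i - ?J"] by simp
    then show "u (int i) * u (- int i) = h (int i + int j) * h (int i - int j)" using i by (simp add: u_def)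
  qed
  finally show ?thesis using 1 by (simp only: mult.assoc)
qed

text \<open>The modulus is odd, so doubling permutes its nonzero residues up to sign.\<close>

lemma prod_even_periodic_double:
  fixes h :: "int \<Rightarrow> 'b::comm_monoid_mult"
  assumes even: "\<And>k. h (- k) = h k" and per: "\<And>k. h (k + int (2 * t + 1)) = h k"
  shows "(\<Prod>j=1..t. h (int (2 * j))) = (\<Prod>j=1..t. h (int j))"
proof (rule prod.reindex_bij_witness[where j = "\<lambda>j. if 2 * j \<le> t then 2 * j else 2 * t + 1 - 2 * j"
      and i = "\<lambda>k. if even k then k div 2 else (2 * t + 1 - k) div 2"])
  fix j assume j: "j \<in> {1..t}"
  have "int (2 * t + 1 - 2 * j) = - int (2 * j) + int (2 * t + 1)" using j by (simp add: of_nat_diff)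
  then have "h (int (2 * t + 1 - 2 * j)) = h (int (2 * j))" using per[of "- int (2 * j)"] even by simp
  then show "h (int (if 2 * j \<le> t then 2 * j else 2 * t + 1 - 2 * j)) = h (int (2 * j))" by simp
next
  fix k assume k: "k \<in> {1..t}"
  show "(if 2 * (if even k then k div 2 else (2 * t + 1 - k) div 2) \<le> t
     then 2 * (if even k then k div 2 else (2 * t + 1 - k) div 2)
     else 2 * t + 1 - 2 * (if even k then k div 2 else (2 * t + 1 - k) div 2)) = k"
    using k by (cases "even k") (auto elim!: evenE oddE)
  show "(if even k then k div 2 else (2 * t + 1 - k) div 2) \<in> {1..t}"
    using k by (cases "even k") (auto elim!: evenE oddE)
qed auto

lemma prod_pairs_square:
  fixes f :: "nat \<Rightarrow> nat \<Rightarrow> 'b::comm_monoid_mult"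
  assumes "\<And>i j. f i j = f j i"
  shows "(\<Prod>j=1..t. \<Prod>i\<in>{1..t} - {j}. f i j) = (\<Prod>(i, j)\<in>pairs t. f i j) ^ 2"
proof -
  have "(\<Prod>j=1..t. \<Prod>i\<in>{1..t} - {j}. f i j) = (\<Prod>(j, i)\<in>(SIGMA j:{1..t}. {1..t} - {j}). f i j)"
    by (rule prod.Sigma) auto
  also have "(SIGMA j:{1..t}. {1..t} - {j}) = pairs t \<union> prod.swap ` pairs t"
    by (auto simp: pairs_def image_iff)
  also have "(\<Prod>(j, i)\<in>pairs t \<union> prod.swap ` pairs t. f i j)
    = (\<Prod>(j, i)\<in>pairs t. f i j) * (\<Prod>(j, i)\<in>prod.swap ` pairs t. f i j)"
  proof (rule prod.union_disjoint)
    show "pairs t \<inter> prod.swap ` pairs t = {}" by (auto simp: pairs_def)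
  qed simp_all
  also have "(\<Prod>(j, i)\<in>prod.swap ` pairs t. f i j) = (\<Prod>(j, i)\<in>pairs t. f j i)"
    by (subst prod.reindex) (auto simp: case_prod_unfold)
  finally show ?thesis using assms by (simp add: power2_eq_square case_prod_unfold)
qed

text \<open>\<open>prod_even_periodic_shift\<close> is multiplied over all j, and the doubled
  arguments disappear by \<open>prod_even_periodic_double\<close>. Every unordered pair is met
  twice, hence the squares; \<open>fps_square_eq_imp_eq\<close> removes them later.\<close>

lemma prod_pairs_even_periodic:
  fixes h :: "int \<Rightarrow> 'b::comm_monoid_mult"
  assumes even: "\<And>k. h (- k) = h k" and per: "\<And>k. h (k + int (2 * t + 1)) = h k"
  shows "((\<Prod>(i, j)\<in>pairs t. h (int i + int j) * h (int i - int j)) * (\<Prod>i=1..t. h (int i))) ^ 2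
    = ((\<Prod>i=1..t. h (int i)) ^ t) ^ 2"
proof -
  let ?H = "\<Prod>i=1..t. h (int i)"
  have sym: "h (int i + int j) * h (int i - int j) = h (int j + int i) * h (int j - int i)" for i j
    using even[of "int i - int j"] by (simp add: add.commute)
  have "(\<Prod>j=1..t. h (int j) * h (int (2 * j)) * (\<Prod>i\<in>{1..t} - {j}. h (int i + int j) * h (int i - int j)))
    = (\<Prod>j=1..t. ?H ^ 2)"
    by (intro prod.cong refl prod_even_periodic_shift even per) auto
  then have "?H * (\<Prod>j=1..t. h (int (2 * j))) * (\<Prod>j=1..t. \<Prod>i\<in>{1..t} - {j}. h (int i + int j) * h (int i - int j))
    = (?H ^ 2) ^ t"
    by (simp only: prod.distrib) simp
  moreover have "(\<Prod>j=1..t. h (int (2 * j))) = ?H"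
    by (rule prod_even_periodic_double[OF even per])
  moreover have "(\<Prod>j=1..t. \<Prod>i\<in>{1..t} - {j}. h (int i + int j) * h (int i - int j))
     = (\<Prod>(i, j)\<in>pairs t. h (int i + int j) * h (int i - int j)) ^ 2"
    by (rule prod_pairs_square) (rule sym)
  ultimately have "?H * ?H * (\<Prod>(i, j)\<in>pairs t. h (int i + int j) * h (int i - int j)) ^ 2 = (?H ^ 2) ^ t" by (simp only:)
  moreover have "(?H ^ 2) ^ t = (?H ^ t) ^ 2" by (simp only: power_mult[symmetric] mult.commute)
  ultimately show ?thesis by (simp only: power_mult_distrib power2_eq_square[of ?H] mult_ac)
qed

lemma fps_square_eq_imp_eq:
  fixes f g :: "'a::field fps"
  assumes "f ^ 2 = g ^ 2" "f $ 0 = 1" "g $ 0 = 1" "(2 :: 'a) \<noteq> 0"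
  shows "f = g"
proof -
  have "f = g \<or> f = - g" using assms(1) by (simp add: power2_eq_iff)
  moreover have "f \<noteq> - g"
  proof
    assume "f = - g"
    then have "f $ 0 + g $ 0 = 0" by simp
    then show False using assms by simp
  qed
  ultimately show ?thesis by blast
qed

text \<open>The assumption on 2 allows the averaging over the reflection and separates the two
  square roots of a power series by their constant terms.\<close>

locale root_of_unity =
  fixes t :: nat and \<zeta> :: "'a::field"
  assumes root: "\<zeta> ^ (2 * t + 1) = 1"
    and primitive: "\<And>i. 0 < i \<Longrightarrow> i < 2 * t + 1 \<Longrightarrow> \<zeta> ^ i \<noteq> 1"
    and two: "(2 :: 'a) \<noteq> 0"
begin

abbreviation g :: nat where "g \<equiv> 2 * t + 1"

lemma zeta_nonzero: "\<zeta> \<noteq> 0"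
  using root by (auto simp: power_0_left)

lemma powi_add_g: "\<zeta> powi (k + int g) = \<zeta> powi k"
proof -
  have "\<zeta> powi (k + int g) = \<zeta> powi k * \<zeta> powi int g" by (rule power_int_add) (simp add: zeta_nonzero)
  also have "\<zeta> powi int g = 1" using root by (simp only: power_int_of_nat)
  finally show ?thesis by simp
qed

lemma prod_powers_split:
  fixes f :: "'a \<Rightarrow> 'b::comm_monoid_mult"
  shows "(\<Prod>r<g. f (\<zeta> ^ r)) = f 1 * (\<Prod>i=1..t. f (\<zeta> powi int i) * f (\<zeta> powi (- int i)))"
proof -
  have "{..<g} = {0} \<union> ({1..t} \<union> {t+1..<g})" by auto
  then have "(\<Prod>r<g. f (\<zeta> ^ r)) = (\<Prod>r\<in>{0} \<union> ({1..t} \<union> {t+1..<g}). f (\<zeta> ^ r))" by (simp only:)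
  also have "\<dots> = (\<Prod>r\<in>{0}. f (\<zeta> ^ r)) * (\<Prod>r\<in>{1..t} \<union> {t+1..<g}. f (\<zeta> ^ r))"
    by (rule prod.union_disjoint) auto
  also have "(\<Prod>r\<in>{0}. f (\<zeta> ^ r)) = f 1" by simp
  also have "(\<Prod>r\<in>{1..t} \<union> {t+1..<g}. f (\<zeta> ^ r)) = (\<Prod>r\<in>{1..t}. f (\<zeta> ^ r)) * (\<Prod>r\<in>{t+1..<g}. f (\<zeta> ^ r))"
    by (rule prod.union_disjoint) auto
  also have "(\<Prod>r\<in>{t+1..<g}. f (\<zeta> ^ r)) = (\<Prod>i=1..t. f (\<zeta> powi (- int i)))"
  proof (rule prod.reindex_bij_witness[where i = "\<lambda>i. g - i" and j = "\<lambda>r. g - r"])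
    fix r assume r: "r \<in> {t+1..<g}"
    have "- int (g - r) + int g = int r" using r by auto
    then have "\<zeta> powi (- int (g - r)) = \<zeta> ^ r" using powi_add_g[of "- int (g - r)"] by simp
    then show "f (\<zeta> powi (- int (g - r))) = f (\<zeta> ^ r)" by simp
  qed auto
  finally show ?thesis by (simp add: prod.distrib)
qed

text \<open>For fixed j the factors with \<zeta>^r multiply to 1 minus a g-th power, by
  \<open>prod_one_minus_root_of_unity\<close> with the argument T^(a + b j).\<close>

lemma prod_qpoch_powers:
  assumes "b > 0"
  shows "(\<Prod>r<g. qpoch_inf (fps_X ^ a * fps_const (\<zeta> ^ r)) (fps_X ^ b)) = qpoch_inf (fps_X ^ (g * a)) (fps_X ^ (g * b))"
proof (rule qpoch_eq_of_partial[where m = 1])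
  fix M
  have "(\<Prod>r<g. \<Prod>j<M. 1 - fps_X ^ a * fps_const (\<zeta> ^ r) * (fps_X ^ b) ^ j)
    = (\<Prod>j<M. \<Prod>r<g. 1 - fps_const \<zeta> ^ r * (fps_X ^ a * (fps_X ^ b) ^ j))"
    by (subst prod.swap) (simp only: fps_const_power mult_ac)
  also have "\<dots> = (\<Prod>j<M. 1 - (fps_X ^ a * (fps_X ^ b) ^ j) ^ g)"
  proof (rule prod.cong[OF refl], rule prod_one_minus_root_of_unity)
    show "fps_const \<zeta> ^ g = 1" by (simp only: fps_const_power root fps_const_1_eq_1)
    show "fps_const \<zeta> ^ i \<noteq> 1" if "0 < i" "i < g" for i
    proof
      assume "fps_const \<zeta> ^ i = 1"
      then have "fps_const (\<zeta> ^ i) $ 0 = 1 $ 0" by (simp only: fps_const_power)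
      then show False using primitive[OF that] by simp
    qed
  qed simp
  also have "\<dots> = (\<Prod>j<1 * M. 1 - fps_X ^ (g * a) * (fps_X ^ (g * b)) ^ j)"
  proof -
    have "(x ^ a * (x ^ b) ^ j) ^ G = x ^ (G * a) * (x ^ (G * b)) ^ j" for x :: "'a fps" and j G
      by (simp add: power_mult_distrib mult.commute mult.left_commute flip: power_mult)
    then show ?thesis by (simp only: mult_1)
  qed
  finally show "(\<Prod>r<g. \<Prod>j<M. 1 - fps_X ^ a * fps_const (\<zeta> ^ r) * (fps_X ^ b) ^ j) = \<dots>" .
qed (use assms in auto)

end

text \<open>Euler's product. Even and odd positions give (q;q) = (q;q^2)(q^2;q^2), the difference of
  squares gives (q;q)(-q;q) = (q^2;q^2), and the common nonzero factor (q^2;q^2) is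
  cancelled.\<close>

lemma qpoch_euler:
  fixes q :: "'a::field fps"
  assumes q: "q $ 0 = 0"
  shows "qpoch_inf (- q) q * qpoch_inf q (q ^ 2) = 1"
proof -
  have "(\<Prod>i\<in>{0, 1::nat}. qpoch_inf (if i = 0 then q else q ^ 2) (q ^ 2)) = qpoch_inf q q"
  proof (rule qpoch_eq_of_partial[where m = 2])
    fix M
    have "(\<Prod>j<2 * M. 1 - q * q ^ j) = (\<Prod>j<M. 1 - q * (q ^ 2) ^ j) * (\<Prod>j<M. 1 - q ^ 2 * (q ^ 2) ^ j)"
      by (induction M) (simp_all add: power_mult power2_eq_square power_mult_distrib mult_ac)
    then show "(\<Prod>i\<in>{0, 1::nat}. \<Prod>j<M. 1 - (if i = 0 then q else q ^ 2) * (q ^ 2) ^ j) = (\<Prod>j<2 * M. 1 - q * q ^ j)"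
      by simp
  qed (use q in \<open>auto simp: power2_eq_square\<close>)
  then have 1: "qpoch_inf q (q ^ 2) * qpoch_inf (q ^ 2) (q ^ 2) = qpoch_inf q q" by simp
  have "(\<Prod>i\<in>{0, 1::nat}. qpoch_inf (if i = 0 then q else - q) q) = qpoch_inf (q ^ 2) (q ^ 2)"
  proof (rule qpoch_eq_of_partial[where m = 1])
    fix M
    have "(\<Prod>j<M. 1 - q * q ^ j) * (\<Prod>j<M. 1 - (- q) * q ^ j) = (\<Prod>j<M. 1 - q ^ 2 * (q ^ 2) ^ j)"
      unfolding prod.distrib[symmetric]
      by (rule prod.cong) (auto simp: power2_eq_square power_mult_distrib algebra_simps)
    then show "(\<Prod>i\<in>{0, 1::nat}. \<Prod>j<M. 1 - (if i = 0 then q else - q) * q ^ j) = (\<Prod>j<1 * M. 1 - q ^ 2 * (q ^ 2) ^ j)"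
      by simp
  qed (use q in \<open>auto simp: power2_eq_square\<close>)
  then have 2: "qpoch_inf q q * qpoch_inf (- q) q = qpoch_inf (q ^ 2) (q ^ 2)" by simp
  have "qpoch_inf (q ^ 2) (q ^ 2) $ 0 \<noteq> 0" using q by (simp add: qpoch_nth_0 power2_eq_square)
  then have "qpoch_inf (q ^ 2) (q ^ 2) \<noteq> 0" by auto
  moreover have "qpoch_inf (q ^ 2) (q ^ 2) * (qpoch_inf (- q) q * qpoch_inf q (q ^ 2)) = qpoch_inf (q ^ 2) (q ^ 2) * 1"
    using 1 2 by (metis mult.assoc mult.commute mult.right_neutral)
  ultimately show ?thesis by (simp only: mult_cancel_left) blast
qed

text \<open>The value of \<open>Phi t j\<close> at 1. It is the factor by which the series is
  multiplied, as compared with a single power of x, at every g-th root of unity.\<close>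

definition tau :: "nat \<Rightarrow> nat \<Rightarrow> 'a::field fps" where
  "tau t j = infsum (\<lambda>n. fps_X ^ qexp j (2 * t + 1 - j) n) UNIV"

lemma tau_has_sum:
  assumes "j \<le> 2 * t + 1"
  shows "((\<lambda>n. fps_X ^ qexp j (2 * t + 1 - j) n :: 'a::field fps) has_sum tau t j) UNIV"
  unfolding tau_def
  by (rule has_sum_infsum, rule summable_on_fps_dvd[where e = "qexp j (2 * t + 1 - j)"])
     (use finite_qexp_le[of j "2 * t + 1 - j"] assms in auto)

text \<open>The triple product at z = -1, where all signs of the terms become positive.\<close>

lemma tau_eq:
  assumes "j \<le> 2 * t + 1"
  shows "(tau t j :: 'a::field fps) = qpoch_inf (- (fps_X ^ j)) (fps_X ^ (2 * t + 1))
    * qpoch_inf (- (fps_X ^ (2 * t + 1 - j))) (fps_X ^ (2 * t + 1)) * qpoch_inf (fps_X ^ (2 * t + 1)) (fps_X ^ (2 * t + 1))"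
proof -
  let ?s = "2 * t + 1 - j"
  have g: "j + ?s = 2 * t + 1" using assms by simp
  have "(theta_term (- (fps_X ^ j)) (- (fps_X ^ ?s)) (fps_X ^ (2 * t + 1) :: 'a fps) has_sum
     qpoch_inf (- (fps_X ^ j)) (fps_X ^ (2 * t + 1))
    * qpoch_inf (- (fps_X ^ ?s)) (fps_X ^ (2 * t + 1)) * qpoch_inf (fps_X ^ (2 * t + 1)) (fps_X ^ (2 * t + 1))) UNIV"
  proof (rule jacobi_triple_product)
    show "- (fps_X ^ j) * - (fps_X ^ ?s) = (fps_X ^ (2 * t + 1) :: 'a fps)"
      by (simp only: minus_mult_minus power_add[symmetric] g)
  qed simp
  also have "theta_term (- (fps_X ^ j)) (- (fps_X ^ ?s)) (fps_X ^ (2 * t + 1) :: 'a fps) = (\<lambda>n. fps_X ^ qexp j ?s n)"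
  proof
    fix n
    have "inverse (- 1 :: 'a) = - 1" by simp
    then show "theta_term (- (fps_X ^ j)) (- (fps_X ^ ?s)) (fps_X ^ (2 * t + 1) :: 'a fps) n = fps_X ^ qexp j ?s n"
      using theta_term_eq[of "- 1 :: 'a" j ?s n] unfolding g
      by (simp flip: fps_const_neg)
  qed
  finally show ?thesis using tau_has_sum[OF assms] by (rule has_sum_unique[symmetric])
qed

text \<open>Each \<open>tau t j\<close> supplies the symbols (-T^j;T^g) and (-T^(g-j);T^g). With the
  added one for j = g, all residues occur once, and their exponents interleave to (-T;T).\<close>

lemma prod_tau:
  "(\<Prod>j=1..t. tau t j) * qpoch_inf (- (fps_X ^ (2 * t + 1))) (fps_X ^ (2 * t + 1))
    = qpoch_inf (fps_X ^ (2 * t + 1)) (fps_X ^ (2 * t + 1)) ^ t * qpoch_inf (- fps_X) (fps_X :: 'a::field fps)"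
proof -
  let ?g = "2 * t + 1"
  define q where "q j = qpoch_inf (- (fps_X ^ j)) (fps_X ^ ?g :: 'a fps)" for j
  define E where "E = qpoch_inf (fps_X ^ ?g) (fps_X ^ ?g :: 'a fps)"
  have e: "x ^ Suc i * (x ^ G) ^ j = x * x ^ (i + j * G)" for x :: "'a fps" and i j G
    by (simp add: power_add mult.commute flip: power_mult)
  have "(\<Prod>j=1..t. tau t j) = (\<Prod>j=1..t. q j * q (?g - j) * E)"
    by (rule prod.cong) (auto simp: tau_eq q_def E_def)
  also have "\<dots> = (\<Prod>j=1..t. q j) * (\<Prod>j=1..t. q (?g - j)) * E ^ t" by (simp add: prod.distrib)
  also have "(\<Prod>j=1..t. q (?g - j)) = (\<Prod>j=t+1..2*t. q j)"
    by (rule prod.reindex_bij_witness[where i = "\<lambda>j. ?g - j" and j = "\<lambda>j. ?g - j"]) auto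
  also have "(\<Prod>j=1..t. q j) * (\<Prod>j=t+1..2*t. q j) = (\<Prod>j\<in>{1..t} \<union> {t+1..2*t}. q j)"
    by (rule prod.union_disjoint[symmetric]) auto
  also have "{1..t} \<union> {t+1..2*t} = {1..2*t}" by auto
  finally have "(\<Prod>j=1..t. tau t j) * q ?g = E ^ t * ((\<Prod>j=1..2*t. q j) * q ?g)" by (simp only: mult_ac)
  also have "(\<Prod>j=1..2*t. q j) * q ?g = (\<Prod>j=1..?g. q j)" by simp
  also have "\<dots> = (\<Prod>i<?g. q (Suc i))"
    by (rule prod.reindex_bij_witness[where i = Suc and j = "\<lambda>j. j - 1"]) auto
  also have "\<dots> = qpoch_inf (- fps_X) fps_X"
    unfolding q_def
  proof (rule qpoch_eq_of_partial[where m = ?g])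
    fix M
    have "(\<Prod>i<?g. \<Prod>j<M. 1 - - (fps_X ^ Suc i) * (fps_X ^ ?g) ^ j)
      = (\<Prod>j<M. \<Prod>i<?g. 1 - - fps_X * (fps_X :: 'a fps) ^ (i + j * ?g))"
      by (subst prod.swap) (simp only: mult_minus_left e)
    also have "\<dots> = (\<Prod>j<M. \<Prod>k\<in>{j * ?g..<j * ?g + ?g}. 1 - - fps_X * fps_X ^ k)"
    proof (rule prod.cong[OF refl])
      fix j
      show "(\<Prod>i<?g. 1 - - fps_X * (fps_X :: 'a fps) ^ (i + j * ?g)) = (\<Prod>k\<in>{j * ?g..<j * ?g + ?g}. 1 - - fps_X * fps_X ^ k)"
        by (rule prod.reindex_bij_witness[where i = "\<lambda>k. k - j * ?g" and j = "\<lambda>i. i + j * ?g"]) auto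
    qed
    also have "\<dots> = (\<Prod>k<M * ?g. 1 - - fps_X * fps_X ^ k)" by (rule prod.nat_group)
    finally show "(\<Prod>i<?g. \<Prod>j<M. 1 - - (fps_X ^ Suc i) * (fps_X ^ ?g) ^ j) = (\<Prod>k<?g * M. 1 - - fps_X * (fps_X :: 'a fps) ^ k)"
      by (simp only: mult.commute)
  qed auto
  finally show ?thesis by (simp add: q_def E_def)
qed

section \<open>The Macdonald identity\<close>

definition macdonald_prod :: "nat \<Rightarrow> (nat \<Rightarrow> 'a::field) \<Rightarrow> 'a fps" where
  "macdonald_prod t x = qpoch_inf fps_X fps_X ^ t * K_prod t x
     * (\<Prod>i = 1..t. qpoch_inf (fps_X * fps_const (x i)) fps_X
         * qpoch_inf (fps_X * fps_const (inverse (x i))) fps_X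
         * qpoch_inf (fps_X * fps_const (x i ^ 2)) (fps_X ^ 2)
         * qpoch_inf (fps_X * fps_const (inverse (x i) ^ 2)) (fps_X ^ 2))"

definition weyl_const :: "nat \<Rightarrow> (nat \<Rightarrow> 'a::field) \<Rightarrow> 'a" where
  "weyl_const t x = (\<Prod>(i, j)\<in>pairs t. x i + inverse (x i) - x j - inverse (x j)) * (\<Prod>i=1..t. 1 - x i)"

text \<open>The constant term in T of \<open>theta_det\<close>. Up to the sign (-1)^t it is the
  denominator of the odd orthogonal characters, see \<open>so_det_0\<close>.\<close>

definition theta_const :: "nat \<Rightarrow> (nat \<Rightarrow> 'a::field) \<Rightarrow> 'a" where
  "theta_const t x = det (mat t t (\<lambda>(i, j). x (i + 1) powi (int j + 1 - int t) - x (i + 1) powi (int t - int j)))"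

lemma fps_const_prod: "fps_const (\<Prod>i\<in>I. f i) = (\<Prod>i\<in>I. fps_const (f i))"
  by (induction I rule: infinite_finite_induct) (simp_all flip: fps_const_mult)

lemma fps_prod_nth_0: "(\<Prod>i\<in>I. f i :: 'a::comm_ring_1 fps) $ 0 = (\<Prod>i\<in>I. f i $ 0)"
  by (induction I rule: infinite_finite_induct) simp_all

lemma K_prod_eq: "K_prod t x = (\<Prod>(i, j)\<in>pairs t.
     qpoch_inf (fps_X * fps_const (x i * x j)) fps_X
     * qpoch_inf (fps_X * fps_const (x i * inverse (x j))) fps_X
     * qpoch_inf (fps_X * fps_const (inverse (x i) * x j)) fps_X
     * qpoch_inf (fps_X * fps_const (inverse (x i) * inverse (x j))) fps_X)"
  by (simp add: K_prod_def pairs_def)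

lemma weyl_prod_eq:
  "qpoch_inf fps_X fps_X ^ t * weyl_prod t x = fps_const (weyl_const t x) * macdonald_prod t x"
  unfolding weyl_prod_def weyl_const_def macdonald_prod_def K_prod_eq kappa_def eta_def fps_const_mult[symmetric]
    fps_const_prod case_prod_unfold prod.distrib
  by (simp only: mult_ac)

lemma macdonald_prod_nth_0: "macdonald_prod t x $ 0 = 1"
  unfolding macdonald_prod_def K_prod_eq
  by (simp add: fps_prod_nth_0 fps_power_zeroth qpoch_nth_0 case_prod_unfold prod.neutral)

lemma weyl_prod_nth_0: "weyl_prod t x $ 0 = weyl_const t x"
proof -
  have "(qpoch_inf fps_X fps_X ^ t * weyl_prod t x) $ 0 = weyl_const t x"
    unfolding weyl_prod_eq by (simp add: macdonald_prod_nth_0)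
  then show ?thesis by (simp add: fps_power_zeroth qpoch_nth_0)
qed

text \<open>For 0 < j < g every exponent \<open>qexp\<close> with nonzero n is positive, so one term
  survives.\<close>

lemma Phi_nth_0:
  assumes "0 < j" "j < 2 * t + 1"
  shows "Phi t j x $ 0 = x powi (int j - int t)"
proof -
  have "Phi t j x $ 0 = (\<Sum>n\<in>{0}. (fps_X ^ qexp j (2 * t + 1 - j) n * fps_const (x powi (int j - int t + n * int (2 * t + 1)))) $ 0)"
  proof (rule has_sum_fps_nth[OF Phi_has_sum])
    fix n assume "n \<in> UNIV - {0 :: int}"
    then have "qexp j (2 * t + 1 - j) n > 0" using assms by (intro qexp_pos) auto
    then show "(fps_X ^ qexp j (2 * t + 1 - j) n * fps_const (x powi (int j - int t + n * int (2 * t + 1)))) $ 0 = 0"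
      by simp
  qed (use assms in auto)
  then show ?thesis by simp
qed

text \<open>If x^g = 1, the power of x is the same in all terms and can be taken out of the
  sum.\<close>

lemma Phi_root:
  assumes j: "j \<le> 2 * t + 1" and x: "x \<noteq> 0" "x ^ (2 * t + 1) = 1"
  shows "Phi t j x = tau t j * fps_const (x powi (int j - int t))"
proof -
  have "x powi (int j - int t + n * int (2 * t + 1)) = x powi (int j - int t)" for n
  proof -
    have "x powi (int (2 * t + 1) * n) = (x ^ (2 * t + 1)) powi n"
      by (simp only: power_int_mult power_int_of_nat)
    then have "x powi (n * int (2 * t + 1)) = 1" unfolding x(2) by (simp add: mult.commute)
    then show ?thesis unfolding power_int_add[OF disjI1[OF x(1)]] by simp
  qed
  then have "((\<lambda>n. fps_X ^ qexp j (2 * t + 1 - j) n * fps_const (x powi (int j - int t))) has_sum Phi t j x) UNIV"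
    using Phi_has_sum[OF j, of x] by simp
  moreover have "((\<lambda>n. fps_X ^ qexp j (2 * t + 1 - j) n * fps_const (x powi (int j - int t))) has_sum
      tau t j * fps_const (x powi (int j - int t))) UNIV"
    by (intro has_sum_cmult_left tau_has_sum j)
  ultimately show ?thesis by (rule has_sum_unique)
qed

lemma tau_reflect:
  assumes j: "j \<le> 2 * t + 1"
  shows "(tau t (2 * t + 1 - j) :: 'a::field fps) = tau t j"
  unfolding tau_eq[OF j] tau_eq[OF diff_le_self] using j by (simp only: diff_diff_cancel mult_ac)

lemma det_scale_columns:
  fixes A :: "nat \<Rightarrow> nat \<Rightarrow> 'a::comm_ring_1"
  shows "det (mat n n (\<lambda>(i, j). c j * A i j)) = (\<Prod>j<n. c j) * det (mat n n (\<lambda>(i, j). A i j))"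
proof -
  have "det (mat n n (\<lambda>(i, j). c j * A i j))
    = (\<Sum>p | p permutes {0..<n}. signof p * (\<Prod>j<n. c j * A (p j) j))"
    by (subst det_col) (auto intro!: sum.cong prod.cong arg_cong2[where f = times] dest: permutes_in_image)
  also have "\<dots> = (\<Sum>p | p permutes {0..<n}. (\<Prod>j<n. c j) * (signof p * (\<Prod>j<n. A (p j) j)))"
    by (simp only: prod.distrib mult_ac)
  also have "\<dots> = (\<Prod>j<n. c j) * (\<Sum>p | p permutes {0..<n}. signof p * (\<Prod>j<n. A (p j) j))"
    by (simp only: sum_distrib_left)
  also have "(\<Sum>p | p permutes {0..<n}. signof p * (\<Prod>j<n. A (p j) j)) = det (mat n n (\<lambda>(i, j). A i j))"
    by (subst det_col) (auto intro!: sum.cong prod.cong arg_cong2[where f = times] dest: permutes_in_image)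
  finally show ?thesis .
qed

interpretation fps_nth_0_hom: comm_ring_hom "\<lambda>f :: 'a::comm_ring_1 fps. f $ 0"
  by unfold_locales auto

interpretation fps_const_hom: comm_ring_hom "fps_const :: 'a::comm_ring_1 \<Rightarrow> 'a fps"
  by unfold_locales auto

lemma theta_det_nth_0: "theta_det t x $ 0 = theta_const t x"
proof -
  have "map_mat (\<lambda>f. f $ 0) (theta_mat t x)
    = mat t t (\<lambda>(i, j). x (i + 1) powi (int j + 1 - int t) - x (i + 1) powi (int t - int j))"
    by (rule eq_matI) (auto simp: theta_mat_def Phi_nth_0 of_nat_diff add.commute)
  then show ?thesis
    unfolding theta_det_def theta_const_def fps_nth_0_hom.hom_det[symmetric] by simp
qed

text \<open>By \<open>tau_reflect\<close> the two series in an entry share the same factor, which is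
  constant along the column.\<close>

lemma theta_det_root:
  assumes x: "\<And>i. i \<in> {1..t} \<Longrightarrow> x i \<noteq> 0" "\<And>i. i \<in> {1..t} \<Longrightarrow> x i ^ (2 * t + 1) = (1 :: 'a::field)"
  shows "theta_det t x = (\<Prod>j=1..t. tau t j) * fps_const (theta_const t x)"
proof -
  let ?A = "\<lambda>i j. x (i + 1) powi (int j + 1 - int t) - x (i + 1) powi (int t - int j)"
  have "theta_mat t x = mat t t (\<lambda>(i, j). tau t (j + 1) * fps_const (?A i j))"
  proof (rule eq_matI)
    fix i j assume "i < dim_row (mat t t (\<lambda>(i, j). tau t (j + 1) * fps_const (?A i j)))"
      "j < dim_col (mat t t (\<lambda>(i, j). tau t (j + 1) * fps_const (?A i j)))"
    then have ij: "i < t" "j < t" by auto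
    have xi: "x (i + 1) \<noteq> 0" "x (i + 1) ^ (2 * t + 1) = 1" using ij x by auto
    have "Phi t (j + 1) (x (i + 1)) = tau t (j + 1) * fps_const (x (i + 1) powi (int j + 1 - int t))"
      using Phi_root[OF _ xi, of "j + 1"] ij by (simp add: algebra_simps)
    moreover have "tau t (2 * t - j) = (tau t (j + 1) :: 'a fps)"
      using tau_reflect[of "j + 1" t] ij by simp
    then have "Phi t (2 * t - j) (x (i + 1)) = tau t (j + 1) * fps_const (x (i + 1) powi (int t - int j))"
      using Phi_root[OF _ xi, of "2 * t - j"] ij by (simp add: of_nat_diff)
    ultimately show "theta_mat t x $$ (i, j) = mat t t (\<lambda>(i, j). tau t (j + 1) * fps_const (?A i j)) $$ (i, j)"
      using ij by (simp add: theta_mat_def right_diff_distrib flip: fps_const_sub)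
  qed (auto simp: theta_mat_def)
  then have "theta_det t x = (\<Prod>j<t. tau t (j + 1)) * det (mat t t (\<lambda>(i, j). fps_const (?A i j)))"
    unfolding theta_det_def by (simp only: det_scale_columns)
  also have "(\<Prod>j<t. tau t (j + 1)) = (\<Prod>j=1..t. tau t j :: 'a fps)"
    by (rule prod.reindex_bij_witness[where i = "\<lambda>j. j - 1" and j = Suc]) auto
  also have "mat t t (\<lambda>(i, j). fps_const (?A i j)) = map_mat fps_const (mat t t (\<lambda>(i, j). ?A i j))"
    by (rule eq_matI) auto
  finally show ?thesis by (simp add: theta_const_def fps_const_hom.hom_det)
qed

text \<open>The factor of a pair is (x_i - x_j)(x_i x_j - 1) / (x_i x_j).\<close>

lemma weyl_const_nonzero:
  fixes x :: "nat \<Rightarrow> 'a::field"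
  assumes "\<And>i. i \<in> {1..t} \<Longrightarrow> x i \<noteq> 0 \<and> x i \<noteq> 1"
    "\<And>i j. i \<in> {1..t} \<Longrightarrow> j \<in> {1..t} \<Longrightarrow> i < j \<Longrightarrow> x i \<noteq> x j \<and> x i * x j \<noteq> 1"
  shows "weyl_const t x \<noteq> 0"
proof -
  have "x i + inverse (x i) - x j - inverse (x j) \<noteq> 0" if "(i, j) \<in> pairs t" for i j
  proof
    have ij: "i \<in> {1..t}" "j \<in> {1..t}" "i < j" using that by (auto simp: pairs_def)
    have nz: "x i \<noteq> 0" "x j \<noteq> 0" using assms(1) ij by auto
    assume "x i + inverse (x i) - x j - inverse (x j) = 0"
    then have "(x i - x j) * (x i * x j - 1) = 0" using nz by (simp add: field_simps)
    then show False using assms(2)[OF ij] by simp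
  qed
  then show ?thesis using assms(1) unfolding weyl_const_def by (auto simp: prod_zero_iff finite_pairs)
qed

context root_of_unity
begin

definition z :: "nat \<Rightarrow> 'a" where "z i = \<zeta> powi int i"

definition phi :: "'a \<Rightarrow> 'a fps" where "phi y = qpoch_inf (fps_X * fps_const y) fps_X"

definition psi :: "'a \<Rightarrow> 'a fps" where "psi y = qpoch_inf (fps_X * fps_const y) (fps_X ^ 2)"

text \<open>At powers of \<zeta> the factors of the product depend only on an integer exponent.
  Joining opposite exponents makes them even and g-periodic functions of it, as the lemmas on
  \<open>h\<close> require.\<close>

definition phi2 :: "int \<Rightarrow> 'a fps" where "phi2 k = phi (\<zeta> powi k) * phi (\<zeta> powi (- k))"

definition psi2 :: "int \<Rightarrow> 'a fps" where "psi2 k = psi (\<zeta> powi k) * psi (\<zeta> powi (- k))"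

lemma periodic:
  "phi2 (k + int (2 * t + 1)) = phi2 k" "phi2 (- k) = phi2 k"
  "psi2 (k + int (2 * t + 1)) = psi2 k" "psi2 (- k) = psi2 k"
proof -
  have "- (k + int g) + int g = - k" by simp
  then have "\<zeta> powi (- (k + int g)) = \<zeta> powi (- k)" using powi_add_g[of "- (k + int g)"] by metis
  then show "phi2 (k + int (2 * t + 1)) = phi2 k" "psi2 (k + int (2 * t + 1)) = psi2 k"
    by (simp_all only: phi2_def psi2_def powi_add_g)
  show "phi2 (- k) = phi2 k" "psi2 (- k) = psi2 k"
    by (simp_all add: phi2_def psi2_def mult.commute)
qed

text \<open>The square root of \<open>prod_pairs_even_periodic\<close>; both sides have constant
  term 1.\<close>

lemma K_prod_mult: "K_prod t z * (\<Prod>i=1..t. phi2 (int i)) = (\<Prod>i=1..t. phi2 (int i)) ^ t"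
proof (rule fps_square_eq_imp_eq)
  have "K_prod t z = (\<Prod>(i, j)\<in>pairs t. phi2 (int i + int j) * phi2 (int i - int j))"
    unfolding K_prod_eq
  proof (rule prod.cong[OF refl], clarify)
    fix i j
    have "z i * z j = \<zeta> powi (int i + int j)" "inverse (z i) * inverse (z j) = \<zeta> powi (- (int i + int j))"
      "z i * inverse (z j) = \<zeta> powi (int i - int j)" "inverse (z i) * z j = \<zeta> powi (- (int i - int j))"
      unfolding z_def by (simp_all add: zeta_nonzero power_int_add power_int_diff power_int_minus field_simps del: power_int_of_nat)
    then show "qpoch_inf (fps_X * fps_const (z i * z j)) fps_X * qpoch_inf (fps_X * fps_const (z i * inverse (z j))) fps_X
       * qpoch_inf (fps_X * fps_const (inverse (z i) * z j)) fps_X * qpoch_inf (fps_X * fps_const (inverse (z i) * inverse (z j))) fps_X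
       = phi2 (int i + int j) * phi2 (int i - int j)"
      by (simp only: phi2_def phi_def mult_ac)
  qed
  then show "(K_prod t z * (\<Prod>i=1..t. phi2 (int i))) ^ 2 = ((\<Prod>i=1..t. phi2 (int i)) ^ t) ^ 2"
    using prod_pairs_even_periodic[of phi2 t] periodic by simp
  have phi2_0: "phi2 k $ 0 = 1" for k by (simp add: phi2_def phi_def qpoch_nth_0)
  show "(K_prod t z * (\<Prod>i=1..t. phi2 (int i))) $ 0 = 1" "((\<Prod>i=1..t. phi2 (int i)) ^ t) $ 0 = 1"
    by (simp_all add: K_prod_eq fps_prod_nth_0 phi2_0 fps_power_zeroth qpoch_nth_0 case_prod_unfold prod.neutral)
qed (rule two)

text \<open>By \<open>K_prod_mult\<close> the product becomes \<open>E\<close>^t times the product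
  of the \<open>psi2\<close>, with E = (T^g;T^g). Euler's product for q = T^g and for q = T shows
  that both sides become \<open>E\<close>^t when multiplied by \<open>N * W2\<close>.\<close>

lemma macdonald_prod_root: "macdonald_prod t z = (\<Prod>j=1..t. tau t j)"
proof -
  define W where "W = qpoch_inf fps_X (fps_X :: 'a fps)"
  define W2 where "W2 = qpoch_inf fps_X (fps_X ^ 2 :: 'a fps)"
  define E where "E = qpoch_inf (fps_X ^ g) (fps_X ^ g :: 'a fps)"
  define N where "N = qpoch_inf (- (fps_X ^ g)) (fps_X ^ g :: 'a fps)"
  let ?H = "\<Prod>i=1..t. phi2 (int i)"
  let ?S = "\<Prod>i=1..t. psi2 (int i)"
  have sq: "z i ^ 2 = \<zeta> powi int (2 * i)" "inverse (z i) ^ 2 = \<zeta> powi (- int (2 * i))" for i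
    by (simp_all only: z_def power_int_minus power_int_of_nat power_inverse power_mult[symmetric] mult.commute)
  have "(\<Prod>i = 1..t. qpoch_inf (fps_X * fps_const (z i)) fps_X
         * qpoch_inf (fps_X * fps_const (inverse (z i))) fps_X
         * qpoch_inf (fps_X * fps_const (z i ^ 2)) (fps_X ^ 2)
         * qpoch_inf (fps_X * fps_const (inverse (z i) ^ 2)) (fps_X ^ 2)) = (\<Prod>i=1..t. phi2 (int i) * psi2 (int (2 * i)))"
    unfolding sq by (simp only: phi2_def psi2_def phi_def psi_def z_def power_int_minus mult.assoc)
  also have "\<dots> = ?H * ?S"
    unfolding prod.distrib using prod_even_periodic_double[of psi2 t] periodic by simp
  finally have "macdonald_prod t z = W ^ t * (K_prod t z * ?H) * ?S"
    unfolding macdonald_prod_def W_def by (simp only: mult.assoc)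
  also have "\<dots> = (W * ?H) ^ t * ?S" by (simp only: K_prod_mult power_mult_distrib mult.assoc)
  also have "W * ?H = E"
  proof -
    have "W * ?H = (\<Prod>r<g. phi (\<zeta> ^ r))"
      unfolding prod_powers_split by (simp add: phi2_def phi_def W_def)
    also have "\<dots> = E" using prod_qpoch_powers[of 1 1] by (simp add: phi_def E_def)
    finally show ?thesis .
  qed
  finally have M: "macdonald_prod t z = E ^ t * ?S" .
  have "W2 * ?S = (\<Prod>r<g. psi (\<zeta> ^ r))"
    unfolding prod_powers_split by (simp add: psi2_def psi_def W2_def)
  also have "\<dots> = qpoch_inf (fps_X ^ g) ((fps_X ^ g) ^ 2)"
    using prod_qpoch_powers[of 2 1, OF pos2] by (simp only: psi_def power_one_right mult_1_right power_mult)
  finally have S: "N * (W2 * ?S) = 1" unfolding N_def by (simp add: qpoch_euler)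
  have "macdonald_prod t z * (N * W2) = E ^ t"
    unfolding M using S by (metis mult.assoc mult.commute mult.right_neutral)
  moreover have "(\<Prod>j=1..t. tau t j) * (N * W2) = E ^ t"
  proof -
    have "(\<Prod>j=1..t. tau t j) * (N * W2) = E ^ t * (qpoch_inf (- fps_X) fps_X * W2)"
      using prod_tau[of t, where 'a = 'a] unfolding N_def[symmetric] E_def[symmetric] by (simp only: mult.assoc[symmetric])
    also have "qpoch_inf (- fps_X) fps_X * W2 = 1" unfolding W2_def by (rule qpoch_euler) simp
    finally show ?thesis by simp
  qed
  moreover have "N * W2 \<noteq> 0"
  proof
    assume "N * W2 = 0"
    then have "N * W2 * ?S = 0" by (simp only: mult_zero_left)
    then show False using S by (simp only: mult.assoc) simp
  qed
  ultimately show ?thesis by (metis mult_right_cancel)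
qed

lemma z_inj:
  assumes "i \<in> {1..t}" "j \<in> {1..t}" "i \<noteq> j"
  shows "z i \<noteq> z j" "z i * z j \<noteq> 1" "z i \<noteq> 1"
proof -
  have lt: "z i \<noteq> z j" if "i < j" "j \<le> t" for i j
  proof
    assume "z i = z j"
    moreover have "z j = z i * \<zeta> ^ (j - i)" using that by (simp add: z_def flip: power_add)
    ultimately have "\<zeta> ^ (j - i) = 1" using zeta_nonzero by (simp add: z_def)
    then show False using primitive[of "j - i"] that by simp
  qed
  show "z i \<noteq> z j" using lt[of i j] lt[of j i] assms by (cases "i < j") auto
  show "z i * z j \<noteq> 1" using primitive[of "i + j"] assms by (auto simp: z_def power_add)
  show "z i \<noteq> 1" using primitive[of i] assms by (auto simp: z_def)
qed

text \<open>No x_i is a g-th root of unity, so a coordinate of x never equals or inverts one of z.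
  Together with the conditions on x, this makes the Weyl denominator nonzero at all mixed
  points.\<close>

theorem macdonald_identity:
  fixes x :: "nat \<Rightarrow> 'a"
  assumes t: "t \<ge> 1"
    and x: "\<And>i. i \<in> {1..t} \<Longrightarrow> x i \<noteq> 0 \<and> x i ^ g \<noteq> 1"
    "\<And>i j. i \<in> {1..t} \<Longrightarrow> j \<in> {1..t} \<Longrightarrow> i < j \<Longrightarrow> x i \<noteq> x j \<and> x i * x j \<noteq> 1"
  shows "theta_det t x = fps_const (theta_const t x) * macdonald_prod t x"
proof -
  define W where "W = (qpoch_inf fps_X fps_X :: 'a fps) ^ t"
  have W: "W \<noteq> 0"
  proof
    assume "W = 0"
    then have "W $ 0 = 0" by simp
    then show False by (simp add: W_def fps_power_zeroth qpoch_nth_0)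
  qed
  have zg: "z i ^ g = 1" for i
  proof -
    have "z i ^ g = (\<zeta> ^ g) ^ i" by (simp only: z_def power_int_of_nat power_mult[symmetric] mult.commute)
    then show ?thesis using root by simp
  qed
  have z0: "z i \<noteq> 0" for i using zeta_nonzero by (simp add: z_def)
  have x1: "x i \<noteq> 1" if "i \<in> {1..t}" for i using x(1)[OF that] by auto
  have z1: "z i \<noteq> 1" if "i \<in> {1..t}" for i using primitive[of i] that by (auto simp: z_def)
  have zx: "z i \<noteq> x j" "z i * x j \<noteq> 1" if "j \<in> {1..t}" for i j
  proof -
    show "z i \<noteq> x j" using zg[of i] x(1)[OF that] by auto
    show "z i * x j \<noteq> 1"
    proof
      assume "z i * x j = 1"
      then have "z i ^ g * x j ^ g = 1" by (metis power_mult_distrib power_one)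
      then show False using zg[of i] x(1)[OF that] by simp
    qed
  qed
  have mixed: "weyl_const t (\<lambda>i. if i \<le> m then z i else x i) \<noteq> 0" for m
  proof (rule weyl_const_nonzero)
    fix i assume "i \<in> {1..t}"
    then show "(if i \<le> m then z i else x i) \<noteq> 0 \<and> (if i \<le> m then z i else x i) \<noteq> 1"
      using z0 z1 x(1) x1 by auto
  next
    fix i j assume ij: "i \<in> {1..t}" "j \<in> {1..t}" "i < j"
    then show "(if i \<le> m then z i else x i) \<noteq> (if j \<le> m then z j else x j) \<and>
      (if i \<le> m then z i else x i) * (if j \<le> m then z j else x j) \<noteq> 1"
      using z_inj[OF ij(1,2)] x(2)[OF ij] zx[OF ij(2), of i] by auto
  qed
  have P: "theta_det t x * weyl_prod t z = theta_det t z * weyl_prod t x"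
  proof (rule theta_det_weyl_prod_proportional[OF t two])
    fix m
    show "weyl_prod t (\<lambda>i. if i \<le> m then z i else x i) \<noteq> 0"
      using mixed[of m] weyl_prod_nth_0[of t "\<lambda>i. if i \<le> m then z i else x i"] by auto
  qed (use z0 x(1) in auto)
  have zt: "theta_det t z = (\<Prod>j=1..t. tau t j) * fps_const (theta_const t z)"
    by (rule theta_det_root) (use z0 zg in auto)
  have "weyl_const t (\<lambda>i. if i \<le> t then z i else x i) = weyl_const t z"
    unfolding weyl_const_def by (intro arg_cong2[where f = times] prod.cong) (auto simp: pairs_def)
  then have wz: "weyl_const t z \<noteq> 0" using mixed[of t] by simp
  \<comment> \<open>The constant term of \<open>P\<close>: the determinant form and the product form
    of the Weyl denominator have the same ratio at x and at z.\<close>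
  have c: "theta_const t x * weyl_const t z = theta_const t z * weyl_const t x"
    using arg_cong[OF P, of "\<lambda>f. f $ 0"] by (simp add: theta_det_nth_0 weyl_prod_nth_0)
  have "theta_det t x * (fps_const (weyl_const t z) * macdonald_prod t z)
    = theta_det t z * (fps_const (weyl_const t x) * macdonald_prod t x)"
    using P unfolding weyl_prod_eq[symmetric] by (metis mult.left_commute)
  then have "macdonald_prod t z * (fps_const (weyl_const t z) * theta_det t x)
    = macdonald_prod t z * (fps_const (theta_const t z * weyl_const t x) * macdonald_prod t x)"
    unfolding zt macdonald_prod_root[symmetric] fps_const_mult[symmetric] by (simp only: mult_ac)
  moreover have "macdonald_prod t z \<noteq> 0" using macdonald_prod_nth_0[of t z] by auto
  ultimately have "fps_const (weyl_const t z) * theta_det t x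
    = fps_const (theta_const t z * weyl_const t x) * macdonald_prod t x" by (metis mult_left_cancel)
  then have "fps_const (weyl_const t z) * theta_det t x
    = fps_const (weyl_const t z) * (fps_const (theta_const t x) * macdonald_prod t x)"
    unfolding c[symmetric] fps_const_mult[symmetric] by (simp only: mult_ac)
  moreover have "fps_const (weyl_const t z) \<noteq> 0" using wz by simp
  ultimately show ?thesis by (metis mult_left_cancel)
qed

end

section \<open>Primitive roots of unity in algebraically closed fields\<close>

text \<open>A multiple root of x^n - 1 would be a root of n x^(n-1), hence 0 in characteristic 0,
  but 0 is no root. So every root has multiplicity 1 in the complete factorization.\<close>

lemma card_roots_of_unity:
  assumes n: "n > 0"
  shows "card {x :: 'a :: {alg_closed_field, field_char_0}. x ^ n = 1} = n"
proof -
  define p where "p = (Polynomial.monom 1 n - 1 :: 'a poly)"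
  have pn: "poly p x = x ^ n - 1" for x by (simp add: p_def poly_monom)
  have deg: "Polynomial.degree p = n"
  proof (rule antisym)
    show "Polynomial.degree p \<le> n" unfolding p_def by (intro degree_diff_le) (auto simp: degree_monom_le)
    have "poly.coeff p n = 1" using n by (simp add: p_def)
    then show "n \<le> Polynomial.degree p" by (intro le_degree) simp
  qed
  have p0: "p \<noteq> 0" using deg n by auto
  obtain A where A: "size A = Polynomial.degree p" "p = Polynomial.smult (poly.coeff p (Polynomial.degree p)) (\<Prod>x\<in>#A. [:-x, 1:])"
    using alg_closed_imp_factorization[OF p0] by blast
  have roots: "set_mset A = {x. x ^ n = 1}"
  proof -
    have "poly p x = poly.coeff p (Polynomial.degree p) * (\<Prod>y\<in>#A. x - y)" for x
      by (subst A(2)) (simp add: poly_prod_mset image_mset.compositionality o_def)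
    then have "poly p x = 0 \<longleftrightarrow> 0 \<in># image_mset ((-) x) A" for x
      using p0 by (simp only: prod_mset_zero_iff mult_eq_0_iff leading_coeff_0_iff simp_thms)
    moreover have "poly p x = 0 \<longleftrightarrow> x ^ n = 1" for x by (simp add: pn)
    ultimately have "x ^ n = 1 \<longleftrightarrow> x \<in> set_mset A" for x by auto
    then show ?thesis by auto
  qed
  have count: "count A x = 1" if x: "x \<in> set_mset A" for x
  proof (rule ccontr)
    assume "count A x \<noteq> 1"
    then have "count A x \<ge> 2" using x by (metis One_nat_def Suc_1 Suc_leI count_greater_zero_iff le_neq_implies_less)
    then have "replicate_mset 2 x \<subseteq># A" by (simp add: count_le_replicate_mset_subset_eq)
    then obtain B where B: "A = replicate_mset 2 x + B" by (metis subset_mset.le_iff_add)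
    have "p = [:-x, 1:] * ([:-x, 1:] * Polynomial.smult (poly.coeff p (Polynomial.degree p)) (\<Prod>y\<in>#B. [:-y, 1:]))"
      by (subst A(2)) (simp add: B numeral_2_eq_2)
    then obtain r where r: "p = [:-x, 1:] * ([:-x, 1:] * r)" by blast
    define l where "l = [:-x, 1:]"
    have "poly l x = 0" by (simp add: l_def)
    then have "poly (pderiv p) x = 0" unfolding r l_def[symmetric] pderiv_mult by simp
    moreover have "poly (pderiv p) x = of_nat n * x ^ (n - 1)"
      by (simp add: p_def pderiv_diff pderiv_monom poly_monom)
    ultimately have "x = 0" using n by simp
    then show False using x n unfolding roots by (simp add: power_0_left)
  qed
  have "n = (\<Sum>x\<in>set_mset A. count A x)" using A(1) deg by (simp add: size_multiset_overloaded_eq)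
  also have "\<dots> = card (set_mset A)" by (simp add: count)
  finally show ?thesis by (simp add: roots)
qed

text \<open>Every n-th root of unity is primitive for exactly one divisor of n. The totients of the
  divisors also add up to n, so by strong induction the proper divisors cancel.\<close>

lemma card_primitive_roots_of_unity:
  assumes "n > 0"
  shows "card {x :: 'a :: {alg_closed_field, field_char_0}. x ^ n = 1 \<and> (\<forall>i. 0 < i \<and> i < n \<longrightarrow> x ^ i \<noteq> 1)} = totient n"
  using assms
proof (induction n rule: less_induct)
  case (less n)
  define U where "U d = {x :: 'a. x ^ d = 1 \<and> (\<forall>i. 0 < i \<and> i < d \<longrightarrow> x ^ i \<noteq> 1)}" for d
  have fin: "finite (U d)" if "d > 0" for d
  proof (rule finite_subset)
    show "U d \<subseteq> {x. x ^ d = 1}" by (auto simp: U_def)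
    show "finite {x :: 'a. x ^ d = 1}" using card_roots_of_unity[OF that, where 'a = 'a] that card.infinite by force
  qed
  have un: "{x :: 'a. x ^ n = 1} = (\<Union>d\<in>{d. d dvd n}. U d)"
  proof (intro equalityI subsetI)
    fix x :: 'a assume "x \<in> {x. x ^ n = 1}"
    then have x: "x ^ n = 1" by simp
    define d where "d = (LEAST d. 0 < d \<and> x ^ d = 1)"
    have d: "0 < d" "x ^ d = 1" using LeastI[of "\<lambda>d. 0 < d \<and> x ^ d = 1" n] x less(2) by (auto simp: d_def)
    have min: "x ^ i \<noteq> 1" if "0 < i" "i < d" for i
      using not_less_Least[of i "\<lambda>d. 0 < d \<and> x ^ d = 1"] that by (auto simp: d_def)
    have "x ^ n = (x ^ d) ^ (n div d) * x ^ (n mod d)" by (simp flip: power_mult power_add)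
    then have "x ^ (n mod d) = 1" using x d by simp
    then have "n mod d = 0" using min[of "n mod d"] d(1) by auto
    then show "x \<in> (\<Union>d\<in>{d. d dvd n}. U d)" using d min by (auto simp: U_def mod_eq_0_iff_dvd)
  next
    fix x assume "x \<in> (\<Union>d\<in>{d. d dvd n}. U d)"
    then show "x \<in> {x. x ^ n = 1}" by (auto simp: U_def power_mult elim!: dvdE)
  qed
  have dn: "finite {d. d dvd n}" "\<And>d. d dvd n \<Longrightarrow> d > 0" using less(2) by (auto intro!: Nat.gr0I)
  have disj: "U d \<inter> U e = {}" if "d < e" "d > 0" for d e using that by (auto simp: U_def)
  have "n = card (\<Union>d\<in>{d. d dvd n}. U d)" unfolding un[symmetric] by (rule card_roots_of_unity[OF less(2), symmetric])
  also have "\<dots> = (\<Sum>d | d dvd n. card (U d))"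
  proof (rule card_UN_disjoint)
    show "\<forall>i\<in>{d. d dvd n}. \<forall>j\<in>{d. d dvd n}. i \<noteq> j \<longrightarrow> U i \<inter> U j = {}"
      using disj dn(2) by (metis Int_commute mem_Collect_eq nat_neq_iff)
  qed (use dn fin in auto)
  also have "{d. d dvd n} = Set.insert n {d. d dvd n \<and> d < n}"
    using less(2) by (auto dest: dvd_imp_le)
  also have "(\<Sum>d\<in>\<dots>. card (U d)) = card (U n) + (\<Sum>d | d dvd n \<and> d < n. card (U d))"
    by (rule sum.insert) (use dn in auto)
  also have "(\<Sum>d | d dvd n \<and> d < n. card (U d)) = (\<Sum>d | d dvd n \<and> d < n. totient d)"
  proof (rule sum.cong[OF refl])
    fix d assume "d \<in> {d. d dvd n \<and> d < n}"
    then show "card (U d) = totient d" unfolding U_def using dn(2) by (intro less.IH) auto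
  qed
  finally have 1: "n = card (U n) + (\<Sum>d | d dvd n \<and> d < n. totient d)" .
  have "n = (\<Sum>d\<in>Set.insert n {d. d dvd n \<and> d < n}. totient d)"
  proof -
    have "Set.insert n {d. d dvd n \<and> d < n} = {d. d dvd n}" using less(2) by (auto dest: dvd_imp_le)
    then show ?thesis by (simp add: totient_divisor_sum)
  qed
  also have "\<dots> = totient n + (\<Sum>d | d dvd n \<and> d < n. totient d)"
    by (rule sum.insert) (use dn in auto)
  finally have "card (U n) = totient n" using 1 by linarith
  then show ?case by (simp add: U_def)
qed

lemma primitive_root_of_unity_exists:
  assumes "n > 0"
  obtains \<zeta> :: "'a :: {alg_closed_field, field_char_0}"
  where "\<zeta> ^ n = 1" "\<And>i. 0 < i \<Longrightarrow> i < n \<Longrightarrow> \<zeta> ^ i \<noteq> 1"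
proof -
  have "{x :: 'a. x ^ n = 1 \<and> (\<forall>i. 0 < i \<and> i < n \<longrightarrow> x ^ i \<noteq> 1)} \<noteq> {}"
    using card_primitive_roots_of_unity[OF assms, where 'a = 'a] assms by (metis card.empty totient_0_iff less_irrefl)
  then show ?thesis using that by blast
qed

section \<open>Partitions and their words\<close>

definition beads :: "nat list \<Rightarrow> int set" where
  "beads \<nu> = {int (part \<nu> i) - int i | i. i \<ge> 1}"

definition bead :: "nat list \<Rightarrow> nat \<Rightarrow> int" where
  "bead \<nu> i = int (part \<nu> i) - int i"

text \<open>The index of the horizontal step (letter 1) that ends column j, just as
  \<open>bead\<close> is the index of the vertical step of row i.\<close>

definition gap :: "nat list \<Rightarrow> nat \<Rightarrow> int" where
  "gap \<nu> j = int j - 1 - int (conj_part \<nu> j)"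

lemma word_eq_0_iff: "word \<nu> k = 0 \<longleftrightarrow> k \<in> beads \<nu>"
  by (auto simp: word_def beads_def)

lemma down_closed_eq:
  assumes fin: "finite S" and S: "0 \<notin> S" "\<And>i j. j \<in> S \<Longrightarrow> 1 \<le> i \<Longrightarrow> i \<le> j \<Longrightarrow> i \<in> S"
  shows "S = {1..card S}"
proof (cases "S = {}")
  case False
  define m where "m = Max S"
  have m: "m \<in> S" "\<And>i. i \<in> S \<Longrightarrow> i \<le> m" using False fin by (auto simp: m_def)
  have "S = {1..m}"
  proof (intro equalityI subsetI)
    fix i assume "i \<in> S"
    then show "i \<in> {1..m}" using m(2)[of i] S(1) by (cases i) auto
  next
    fix i assume "i \<in> {1..m}"
    then show "i \<in> S" using S(2)[OF m(1)] by auto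
  qed
  then show ?thesis by (metis card_atLeastAtMost diff_Suc_1)
qed simp

lemma part_antimono:
  assumes "\<nu> \<in> partitions" "1 \<le> i" "i \<le> j"
  shows "part \<nu> j \<le> part \<nu> i"
proof (cases "i = j \<or> j > length \<nu>")
  case True
  then show ?thesis by (auto simp: part_def)
next
  case False
  then show ?thesis using assms by (auto simp: part_def partitions_def sorted_wrt_iff_nth_less)
qed

lemma part_pos_iff:
  assumes "\<nu> \<in> partitions" "1 \<le> i"
  shows "part \<nu> i > 0 \<longleftrightarrow> i \<le> length \<nu>"
  using assms by (auto simp: part_def partitions_def in_set_conv_nth intro!: Nat.gr0I)

lemma le_conj_part_iff:
  assumes \<nu>: "\<nu> \<in> partitions" and i: "1 \<le> i" and j: "1 \<le> j"
  shows "i \<le> conj_part \<nu> j \<longleftrightarrow> j \<le> part \<nu> i"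
proof -
  define S where "S = {i. 1 \<le> i \<and> i \<le> length \<nu> \<and> j \<le> part \<nu> i}"
  have "S = {1..card S}"
    by (rule down_closed_eq) (use part_antimono[OF \<nu>] in \<open>auto simp: S_def intro: order_trans\<close>)
  then have "i \<in> S \<longleftrightarrow> i \<le> card S" using i by (metis atLeastAtMost_iff)
  moreover have "i \<in> S \<longleftrightarrow> j \<le> part \<nu> i" using i j by (auto simp: S_def part_def)
  ultimately show ?thesis by (simp add: conj_part_def S_def)
qed

lemma boxes_iff:
  "(i, j) \<in> boxes \<nu> \<longleftrightarrow> 1 \<le> i \<and> 1 \<le> j \<and> j \<le> part \<nu> i"
  by (auto simp: boxes_def part_def)

lemma bead_less:
  assumes "\<nu> \<in> partitions" "1 \<le> i" "i < j"
  shows "bead \<nu> j < bead \<nu> i"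
  using part_antimono[OF assms(1,2), of j] assms(3) by (simp add: bead_def)

lemma bead_less_iff:
  assumes "\<nu> \<in> partitions" "1 \<le> i" "1 \<le> j"
  shows "bead \<nu> j < bead \<nu> i \<longleftrightarrow> i < j"
  using bead_less[OF assms(1,2), of j] bead_less[OF assms(1,3), of i] by (cases i j rule: linorder_cases) auto

lemma bead_eq_iff:
  assumes "\<nu> \<in> partitions" "1 \<le> i" "1 \<le> j"
  shows "bead \<nu> j = bead \<nu> i \<longleftrightarrow> i = j"
  using bead_less_iff[OF assms] bead_less_iff[OF assms(1,3,2)] by (cases i j rule: linorder_cases) auto

lemma conj_part_antimono:
  assumes "1 \<le> i" "i \<le> j"
  shows "conj_part \<nu> j \<le> conj_part \<nu> i"
  unfolding conj_part_def by (rule card_mono) (use assms in auto)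

lemma gap_less:
  assumes "1 \<le> i" "i < j"
  shows "gap \<nu> i < gap \<nu> j"
  using conj_part_antimono[OF assms(1), of j \<nu>] assms(2) by (simp add: gap_def)

lemma gap_less_iff:
  assumes "1 \<le> i" "1 \<le> j"
  shows "gap \<nu> i < gap \<nu> j \<longleftrightarrow> i < j"
  using gap_less[OF assms(1), of j \<nu>] gap_less[OF assms(2), of i \<nu>] by (cases i j rule: linorder_cases) auto

lemma gap_eq_iff:
  assumes "1 \<le> i" "1 \<le> j"
  shows "gap \<nu> i = gap \<nu> j \<longleftrightarrow> i = j"
  using gap_less_iff[OF assms, of \<nu>] gap_less_iff[OF assms(2,1), of \<nu>] by (cases i j rule: linorder_cases) auto

lemma gap_less_bead_iff:
  assumes "\<nu> \<in> partitions" "1 \<le> i" "1 \<le> j"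
  shows "gap \<nu> j < bead \<nu> i \<longleftrightarrow> (i, j) \<in> boxes \<nu>"
  using le_conj_part_iff[OF assms] assms(2,3) by (cases "j \<le> part \<nu> i") (auto simp: gap_def bead_def boxes_iff)

lemma gap_neq_bead:
  assumes "\<nu> \<in> partitions" "1 \<le> i" "1 \<le> j"
  shows "gap \<nu> j \<noteq> bead \<nu> i"
  using le_conj_part_iff[OF assms] assms(2,3) by (cases "j \<le> part \<nu> i") (auto simp: gap_def bead_def)

lemma beads_eq: "beads \<nu> = bead \<nu> ` {1..}"
  by (auto simp: beads_def bead_def)

text \<open>For a position k without a bead, let i be the first row whose bead is below k. Then k
  lies between the beads of rows i - 1 and i, which forces column j = k + i to have height i -
  1.\<close>

lemma gaps_eq:
  assumes \<nu>: "\<nu> \<in> partitions"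
  shows "- beads \<nu> = gap \<nu> ` {1..}"
proof (intro equalityI subsetI)
  fix k assume k: "k \<in> - beads \<nu>"
  define P where "P i \<longleftrightarrow> 1 \<le> i \<and> bead \<nu> i < k" for i
  have "P (Suc (length \<nu> + nat \<bar>k\<bar>))" by (auto simp: P_def bead_def part_def)
  then have Pi: "P (LEAST i. P i)" by (rule LeastI)
  define i where "i = (LEAST i. P i)"
  have i: "1 \<le> i" "bead \<nu> i < k" using Pi unfolding i_def[symmetric] by (auto simp: P_def)
  have prev: "k < bead \<nu> (i - 1)" if "i > 1"
  proof -
    have "\<not> P (i - 1)" using not_less_Least[of "i - 1" P] that unfolding i_def[symmetric] by auto
    moreover have "bead \<nu> (i - 1) \<noteq> k" using k that by (auto simp: beads_eq)
    ultimately show ?thesis using that by (auto simp: P_def)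
  qed
  define j where "j = nat (k + int i)"
  have j: "int j = k + int i" "1 \<le> j" using i by (auto simp: j_def bead_def)
  have "conj_part \<nu> j = i - 1"
  proof (rule antisym)
    have "\<not> i \<le> conj_part \<nu> j" unfolding le_conj_part_iff[OF \<nu> i(1) j(2)] using i j by (auto simp: bead_def)
    then show "conj_part \<nu> j \<le> i - 1" by simp
    show "i - 1 \<le> conj_part \<nu> j"
    proof (cases "i > 1")
      case True
      then show ?thesis using le_conj_part_iff[OF \<nu> _ j(2), of "i - 1"] prev j by (auto simp: bead_def)
    qed simp
  qed
  then have "gap \<nu> j = k" using j i by (simp add: gap_def)
  then show "k \<in> gap \<nu> ` {1..}" using j by force
next
  fix k assume "k \<in> gap \<nu> ` {1..}"
  then show "k \<in> - beads \<nu>" using gap_neq_bead[OF \<nu>] by (auto simp: beads_eq)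
qed

lemma hook_eq:
  assumes \<nu>: "\<nu> \<in> partitions" and b: "(i, j) \<in> boxes \<nu>"
  shows "int (hook \<nu> (i, j)) = bead \<nu> i - gap \<nu> j"
proof -
  have ij: "1 \<le> i" "1 \<le> j" "j \<le> part \<nu> i" using b by (auto simp: boxes_iff)
  then have "i \<le> conj_part \<nu> j" using le_conj_part_iff[OF \<nu> ij(1,2)] by simp
  then show ?thesis using ij by (simp add: hook_def bead_def gap_def of_nat_diff)
qed

lemma bij_betw_boxes:
  assumes \<nu>: "\<nu> \<in> partitions"
  shows "bij_betw (\<lambda>(i, j). (gap \<nu> j, bead \<nu> i)) (boxes \<nu>) {(p, q). p \<notin> beads \<nu> \<and> q \<in> beads \<nu> \<and> p < q}"
  unfolding bij_betw_def
proof
  show "inj_on (\<lambda>(i, j). (gap \<nu> j, bead \<nu> i)) (boxes \<nu>)"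
    using bead_eq_iff[OF \<nu>] gap_eq_iff[of _ _ \<nu>] by (auto simp: inj_on_def boxes_iff)
  show "(\<lambda>(i, j). (gap \<nu> j, bead \<nu> i)) ` boxes \<nu> = {(p, q). p \<notin> beads \<nu> \<and> q \<in> beads \<nu> \<and> p < q}"
  proof (intro equalityI subsetI)
    fix x assume "x \<in> (\<lambda>(i, j). (gap \<nu> j, bead \<nu> i)) ` boxes \<nu>"
    then obtain i j where ij: "(i, j) \<in> boxes \<nu>" "x = (gap \<nu> j, bead \<nu> i)" by auto
    then have "1 \<le> i" "1 \<le> j" by (auto simp: boxes_iff)
    then show "x \<in> {(p, q). p \<notin> beads \<nu> \<and> q \<in> beads \<nu> \<and> p < q}"
      using gap_less_bead_iff[OF \<nu>, of i j] gap_neq_bead[OF \<nu>] ij by (auto simp: beads_eq)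
  next
    fix x assume "x \<in> {(p, q). p \<notin> beads \<nu> \<and> q \<in> beads \<nu> \<and> p < q}"
    then obtain p q where x: "x = (p, q)" "p \<in> - beads \<nu>" "q \<in> beads \<nu>" "p < q" by auto
    have "p \<in> gap \<nu> ` {1..}" using x(2) gaps_eq[OF \<nu>] by simp
    moreover have "q \<in> bead \<nu> ` {1..}" using x(3) beads_eq by simp
    ultimately obtain i j where "1 \<le> i" "1 \<le> j" "p = gap \<nu> j" "q = bead \<nu> i" by auto
    then show "x \<in> (\<lambda>(i, j). (gap \<nu> j, bead \<nu> i)) ` boxes \<nu>"
      using gap_less_bead_iff[OF \<nu>, of i j] x by force
  qed
qed

text \<open>A bead with a gap g positions below is a box of hook length g. Conversely, if beads may
  always be lowered by g, no bead is at a multiple of g above a gap.\<close>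

lemma core_iff:
  assumes \<nu>: "\<nu> \<in> partitions" and g: "g > 0"
  shows "core g \<nu> \<longleftrightarrow> (\<forall>k\<in>beads \<nu>. k - int g \<in> beads \<nu>)"
proof
  assume core: "core g \<nu>"
  show "\<forall>k\<in>beads \<nu>. k - int g \<in> beads \<nu>"
  proof (rule ballI, rule ccontr)
    fix k assume k: "k \<in> beads \<nu>" "k - int g \<notin> beads \<nu>"
    then have "(k - int g, k) \<in> (\<lambda>(i, j). (gap \<nu> j, bead \<nu> i)) ` boxes \<nu>"
      using bij_betw_boxes[OF \<nu>] g unfolding bij_betw_def by auto
    then obtain i j where ij: "(i, j) \<in> boxes \<nu>" "gap \<nu> j = k - int g" "bead \<nu> i = k" by auto
    then have "hook \<nu> (i, j) = g" using hook_eq[OF \<nu> ij(1)] by simp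
    then show False using core ij(1) by (auto simp: core_def)
  qed
next
  assume step: "\<forall>k\<in>beads \<nu>. k - int g \<in> beads \<nu>"
  have steps: "k - int m * int g \<in> beads \<nu>" if "k \<in> beads \<nu>" for k m
  proof (induction m)
    case (Suc m)
    then have "k - int m * int g - int g \<in> beads \<nu>" using step by blast
    then show ?case by (simp add: algebra_simps)
  qed (use that in simp)
  show "core g \<nu>"
    unfolding core_def
  proof (rule ballI, clarify)
    fix i j assume ij: "(i, j) \<in> boxes \<nu>" "g dvd hook \<nu> (i, j)"
    then have pos: "1 \<le> i" "1 \<le> j" by (auto simp: boxes_iff)
    from ij obtain m where "hook \<nu> (i, j) = g * m" by (elim dvdE)
    then have "gap \<nu> j = bead \<nu> i - int m * int g" using hook_eq[OF \<nu> ij(1)] by (simp add: mult.commute)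
    moreover have "bead \<nu> i \<in> beads \<nu>" using pos by (auto simp: beads_eq)
    ultimately have "gap \<nu> j \<in> beads \<nu>" using steps by simp
    then show False using gap_neq_bead[OF \<nu>] pos by (auto simp: beads_eq)
  qed
qed

lemma beads_above:
  assumes "\<nu> \<in> partitions" "1 \<le> i"
  shows "{k \<in> beads \<nu>. k > bead \<nu> i} = bead \<nu> ` {1..<i}"
  using bead_less_iff[OF assms(1)] assms(2) by (force simp: beads_eq)

lemma card_beads_above:
  assumes "\<nu> \<in> partitions" "1 \<le> i"
  shows "card {k \<in> beads \<nu>. k > bead \<nu> i} = i - 1"
proof -
  have "inj_on (bead \<nu>) {1..<i}" using bead_eq_iff[OF assms(1)] by (auto simp: inj_on_def)
  then show ?thesis unfolding beads_above[OF assms] by (simp add: card_image)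
qed

text \<open>The row of a bead is recovered as one more than the number of beads above it.\<close>

lemma beads_inj:
  assumes \<nu>: "\<nu> \<in> partitions" and \<nu>': "\<nu>' \<in> partitions" and eq: "beads \<nu> = beads \<nu>'"
  shows "\<nu> = \<nu>'"
proof -
  have part: "part \<nu> i = part \<nu>' i" if i: "1 \<le> i" for i
  proof -
    have "bead \<nu> i \<in> beads \<nu>'" using i eq by (metis atLeast_iff beads_eq imageI)
    then obtain j where j: "1 \<le> j" "bead \<nu> i = bead \<nu>' j" by (auto simp: beads_eq)
    have "i - 1 = j - 1"
      using card_beads_above[OF \<nu> i] card_beads_above[OF \<nu>' j(1)] unfolding eq j(2) by simp
    then have "i = j" using i j by simp
    then show ?thesis using j by (simp add: bead_def)
  qed
  have len: "length \<nu> = length \<nu>'"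
  proof (rule linorder_cases[of "length \<nu>" "length \<nu>'"])
    assume "length \<nu> < length \<nu>'"
    then show ?thesis using part[of "length \<nu>'"] part_pos_iff[OF \<nu>, of "length \<nu>'"] part_pos_iff[OF \<nu>', of "length \<nu>'"] by auto
  next
    assume "length \<nu>' < length \<nu>"
    then show ?thesis using part[of "length \<nu>"] part_pos_iff[OF \<nu>, of "length \<nu>"] part_pos_iff[OF \<nu>', of "length \<nu>"] by auto
  qed
  show ?thesis
  proof (rule nth_equalityI[OF len])
    fix i assume "i < length \<nu>"
    then show "\<nu> ! i = \<nu>' ! i" using part[of "i + 1"] len by (simp add: part_def)
  qed
qed

lemma partition_of_function:
  fixes f :: "nat \<Rightarrow> nat"
  assumes anti: "\<And>i j. 1 \<le> i \<Longrightarrow> i \<le> j \<Longrightarrow> f j \<le> f i" and zero: "\<And>i. i > L \<Longrightarrow> f i = 0"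
  obtains \<nu> where "\<nu> \<in> partitions" "\<And>i. 1 \<le> i \<Longrightarrow> part \<nu> i = f i"
proof -
  define S where "S = {i. 1 \<le> i \<and> f i > 0}"
  define m where "m = card S"
  have S: "S = {1..m}"
    unfolding m_def
  proof (rule down_closed_eq)
    have "S \<subseteq> {..L}"
    proof
      fix i assume "i \<in> S"
      then show "i \<in> {..L}" using zero[of i] by (cases "i > L") (auto simp: S_def)
    qed
    then show "finite S" by (rule finite_subset) simp
    show "i \<in> S" if "j \<in> S" "1 \<le> i" "i \<le> j" for i j using that anti[of i j] by (auto simp: S_def)
  qed (auto simp: S_def)
  define \<nu> where "\<nu> = map (\<lambda>i. f (i + 1)) [0..<m]"
  have "f (i + 1) > 0" if "i < m" for i
  proof -
    have "i + 1 \<in> S" unfolding S using that by simp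
    then show ?thesis by (simp add: S_def)
  qed
  then have "\<nu> \<in> partitions"
    unfolding partitions_def \<nu>_def using anti by (fastforce simp: sorted_wrt_iff_nth_less)
  moreover have "part \<nu> i = f i" if "1 \<le> i" for i
  proof (cases "i \<le> m")
    case True
    then have "i - 1 < m" "i - 1 + 1 = i" using that by auto
    then show ?thesis using that by (simp add: part_def \<nu>_def)
  next
    case False
    then have "i \<notin> S" unfolding S by simp
    then show ?thesis using that False by (simp add: part_def \<nu>_def S_def)
  qed
  ultimately show ?thesis by (rule that)
qed

section \<open>Doubled distinct partitions\<close>

lemma durfee_iff:
  assumes \<nu>: "\<nu> \<in> partitions" and i: "1 \<le> i"
  shows "i \<le> durfee \<nu> \<longleftrightarrow> i \<le> part \<nu> i"
proof -
  define S where "S = {s. 1 \<le> s \<and> s \<le> part \<nu> s}"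
  have fin: "finite S"
  proof (rule finite_subset)
    show "S \<subseteq> {..length \<nu>}" by (auto simp: S_def part_def)
  qed simp
  have S: "S = {1..card S}"
  proof (rule down_closed_eq[OF fin])
    fix i j assume ij: "j \<in> S" "1 \<le> i" "i \<le> j"
    have "i \<le> j" "j \<le> part \<nu> j" "part \<nu> j \<le> part \<nu> i" using ij part_antimono[OF \<nu> ij(2,3)] by (auto simp: S_def)
    then show "i \<in> S" using ij by (simp add: S_def)
  qed (auto simp: S_def)
  have "durfee \<nu> = Max (Set.insert 0 {1..card S})" unfolding durfee_def S_def[symmetric] by (subst S) (rule refl)
  also have "\<dots> = card S" by (rule Max_eqI) auto
  finally have "i \<le> durfee \<nu> \<longleftrightarrow> i \<in> {1..card S}" using i by simp
  also have "\<dots> \<longleftrightarrow> i \<in> S" using S by metis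
  finally show ?thesis using i by (simp add: S_def)
qed

lemma bead_pos_iff:
  assumes "\<nu> \<in> partitions" "1 \<le> i"
  shows "bead \<nu> i \<ge> 0 \<longleftrightarrow> i \<le> durfee \<nu>"
  unfolding durfee_iff[OF assms] by (simp add: bead_def)

lemma gap_neg_iff:
  assumes "\<nu> \<in> partitions" "1 \<le> i"
  shows "gap \<nu> i < 0 \<longleftrightarrow> i \<le> durfee \<nu>"
  unfolding durfee_iff[OF assms] le_conj_part_iff[OF assms assms(2), symmetric] by (auto simp: gap_def)

lemma DD_iff: "\<nu> \<in> DD \<longleftrightarrow> \<nu> \<in> partitions \<and> (\<forall>i\<in>{1..durfee \<nu>}. gap \<nu> i = - bead \<nu> i)"
  by (auto simp: DD_def gap_def bead_def)

text \<open>The doubled distinct partitions in terms of their words: 0 is a gap, and exactly one of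
  k and - k is a bead for k nonzero.\<close>

definition symmetric_beads :: "int set \<Rightarrow> bool" where
  "symmetric_beads Z \<longleftrightarrow> 0 \<notin> Z \<and> (\<forall>k. k \<noteq> 0 \<longrightarrow> (- k \<in> Z \<longleftrightarrow> k \<notin> Z))"

text \<open>The nonnegative beads belong to the first \<open>durfee\<close> rows and the negative
  gaps to the first \<open>durfee\<close> columns; the defining condition matches them by
  negation.\<close>

lemma symmetric_beads_DD:
  assumes "\<nu> \<in> DD"
  shows "symmetric_beads (beads \<nu>)"
proof -
  have \<nu>: "\<nu> \<in> partitions" and dd: "\<And>i. 1 \<le> i \<Longrightarrow> i \<le> durfee \<nu> \<Longrightarrow> gap \<nu> i = - bead \<nu> i"
    using assms by (auto simp: DD_iff)
  have neg: "- k \<notin> beads \<nu>" if k: "k \<in> beads \<nu>" "k \<ge> 0" for k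
  proof -
    obtain i where i: "1 \<le> i" "k = bead \<nu> i" using k by (auto simp: beads_eq)
    then have "- k = gap \<nu> i" using dd[of i] bead_pos_iff[OF \<nu>, of i] k by simp
    then show ?thesis using gaps_eq[OF \<nu>] i by (metis ComplD atLeast_iff imageI)
  qed
  have pos: "- k \<in> beads \<nu>" if k: "k \<notin> beads \<nu>" "k < 0" for k
  proof -
    have "k \<in> gap \<nu> ` {1..}" using k gaps_eq[OF \<nu>] by auto
    then obtain j where j: "1 \<le> j" "k = gap \<nu> j" by auto
    then have "- k = bead \<nu> j" using dd[of j] gap_neg_iff[OF \<nu>, of j] k by simp
    then show ?thesis using j by (auto simp: beads_eq)
  qed
  have "0 \<notin> beads \<nu>" using neg[of 0] by auto
  moreover have "- k \<in> beads \<nu> \<longleftrightarrow> k \<notin> beads \<nu>" if "k \<noteq> 0" for k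
    using neg[of k] neg[of "- k"] pos[of k] pos[of "- k"] that by (cases "k > 0") auto
  ultimately show ?thesis unfolding symmetric_beads_def by blast
qed

text \<open>The negative of the bead of row i is the gap of some column j. Negation maps the beads
  above the former onto the gaps below the latter, and counting them gives i = j.\<close>

lemma DD_of_symmetric_beads:
  assumes \<nu>: "\<nu> \<in> partitions" and sym: "symmetric_beads (beads \<nu>)"
  shows "\<nu> \<in> DD"
  unfolding DD_iff
proof (intro conjI ballI \<nu>)
  fix i assume "i \<in> {1..durfee \<nu>}"
  then have i: "1 \<le> i" "i \<le> durfee \<nu>" by auto
  have b: "bead \<nu> i \<in> beads \<nu>" "bead \<nu> i \<ge> 0" using i bead_pos_iff[OF \<nu>] by (auto simp: beads_eq)
  then have "bead \<nu> i > 0" using sym by (cases "bead \<nu> i = 0") (auto simp: symmetric_beads_def)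
  then have "- bead \<nu> i \<in> gap \<nu> ` {1..}" using sym b unfolding gaps_eq[OF \<nu>, symmetric] symmetric_beads_def by auto
  then obtain j where j: "1 \<le> j" "- bead \<nu> i = gap \<nu> j" by auto
  have "{k \<in> beads \<nu>. k > bead \<nu> i} = (\<lambda>j. - gap \<nu> j) ` {1..<j}"
  proof (intro equalityI subsetI)
    fix k assume "k \<in> {k \<in> beads \<nu>. k > bead \<nu> i}"
    then have k: "k \<in> beads \<nu>" "k > bead \<nu> i" "k > 0" using \<open>bead \<nu> i > 0\<close> by auto
    then have "- k \<in> gap \<nu> ` {1..}" using sym unfolding gaps_eq[OF \<nu>, symmetric] symmetric_beads_def by auto
    then obtain l where l: "1 \<le> l" "- k = gap \<nu> l" by auto
    then have "gap \<nu> l < gap \<nu> j" using k j by simp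
    then have "l < j" using gap_less_iff[OF l(1) j(1)] by simp
    then show "k \<in> (\<lambda>j. - gap \<nu> j) ` {1..<j}" using l by (auto intro!: image_eqI[of _ _ l])
  next
    fix k assume "k \<in> (\<lambda>j. - gap \<nu> j) ` {1..<j}"
    then obtain l where l: "1 \<le> l" "l < j" "k = - gap \<nu> l" by auto
    have "gap \<nu> l < gap \<nu> j" using l gap_less by simp
    then have "k > bead \<nu> i" "k > 0" using j l \<open>bead \<nu> i > 0\<close> by auto
    moreover have "- k \<notin> beads \<nu>" using l gaps_eq[OF \<nu>] by auto
    ultimately show "k \<in> {k \<in> beads \<nu>. k > bead \<nu> i}" using sym unfolding symmetric_beads_def by auto
  qed
  moreover have "inj_on (\<lambda>j. - gap \<nu> j) {1..<j}" using gap_eq_iff[of _ _ \<nu>] by (auto simp: inj_on_def)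
  ultimately have "i - 1 = j - 1" using card_beads_above[OF \<nu> i(1)] by (simp add: card_image)
  then have "i = j" using i(1) j(1) by linarith
  then show "gap \<nu> i = - bead \<nu> i" using j by simp
qed

text \<open>The row or the column of a box has an index up to \<open>durfee\<close>. There bead and
  gap are negatives of each other, so the sum in question is a difference of two gaps or of two
  beads, and its sign compares i with j.\<close>

lemma DD_box_position:
  assumes DD: "\<nu> \<in> DD" and b: "(i, j) \<in> boxes \<nu>"
  shows "gap \<nu> j + bead \<nu> i > 0 \<longleftrightarrow> i < j" "gap \<nu> j + bead \<nu> i = 0 \<longleftrightarrow> i = j"
proof -
  have \<nu>: "\<nu> \<in> partitions" and dd: "\<And>i. 1 \<le> i \<Longrightarrow> i \<le> durfee \<nu> \<Longrightarrow> gap \<nu> i = - bead \<nu> i"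
    using DD by (auto simp: DD_iff)
  have ij: "1 \<le> i" "1 \<le> j" "j \<le> part \<nu> i" using b by (auto simp: boxes_iff)
  have "i \<le> durfee \<nu> \<or> j \<le> durfee \<nu>"
  proof (cases "i \<le> j")
    case True
    then show ?thesis using durfee_iff[OF \<nu> ij(1)] ij by simp
  next
    case False
    then have "j \<le> part \<nu> j" using part_antimono[OF \<nu> ij(2), of i] ij by simp
    then show ?thesis using durfee_iff[OF \<nu> ij(2)] by simp
  qed
  then consider "gap \<nu> i = - bead \<nu> i" | "gap \<nu> j = - bead \<nu> j" using dd ij by blast
  then have "(gap \<nu> j + bead \<nu> i > 0 \<longleftrightarrow> i < j) \<and> (gap \<nu> j + bead \<nu> i = 0 \<longleftrightarrow> i = j)"
  proof cases
    case 1
    then have "gap \<nu> j + bead \<nu> i = gap \<nu> j - gap \<nu> i" by simp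
    then show ?thesis using gap_less_iff[OF ij(1,2), of \<nu>] gap_eq_iff[OF ij(1,2), of \<nu>] by auto
  next
    case 2
    then have "gap \<nu> j + bead \<nu> i = bead \<nu> i - bead \<nu> j" by simp
    then show ?thesis using bead_less_iff[OF \<nu> ij(1,2)] bead_eq_iff[OF \<nu> ij(1,2)] by auto
  qed
  then show "gap \<nu> j + bead \<nu> i > 0 \<longleftrightarrow> i < j" "gap \<nu> j + bead \<nu> i = 0 \<longleftrightarrow> i = j" by blast+
qed

lemma boxes_Sigma: "boxes \<nu> = (SIGMA i:{1..length \<nu>}. {1..part \<nu> i})"
  by (auto simp: boxes_def)

lemma finite_boxes: "finite (boxes \<nu>)"
  unfolding boxes_Sigma by blast

lemma card_boxes: "card (boxes \<nu>) = sum_list \<nu>"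
proof -
  have "card (boxes \<nu>) = (\<Sum>i\<in>{1..length \<nu>}. part \<nu> i)" unfolding boxes_Sigma by simp
  also have "\<dots> = (\<Sum>i<length \<nu>. \<nu> ! i)"
    by (rule sum.reindex_bij_witness[where i = Suc and j = "\<lambda>i. i - 1"]) (auto simp: part_def)
  also have "\<dots> = sum_list \<nu>" by (simp add: sum_list_sum_nth lessThan_atLeast0)
  finally show ?thesis .
qed

text \<open>The boxes are cut along the diagonal into hooks. Row i contributes part - i + 1 boxes
  including the diagonal one, column i contributes part - 1 - i below it, together twice the bead of
  row i.\<close>

lemma sum_list_DD:
  assumes DD: "\<nu> \<in> DD"
  shows "int (sum_list \<nu>) = 2 * (\<Sum>k | k \<in> beads \<nu> \<and> k > 0. k)"
proof -
  have \<nu>: "\<nu> \<in> partitions" and dd: "\<And>i. i \<in> {1..durfee \<nu>} \<Longrightarrow> gap \<nu> i = - bead \<nu> i"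
    using DD by (auto simp: DD_iff)
  have dd': "int (conj_part \<nu> i) = int (part \<nu> i) - 1" if "i \<in> {1..durfee \<nu>}" for i
    using dd[OF that] by (simp add: gap_def bead_def)
  have row: "i \<le> part \<nu> i" if "i \<in> {1..durfee \<nu>}" for i using durfee_iff[OF \<nu>] that by auto
  let ?U = "SIGMA i:{1..durfee \<nu>}. {i..part \<nu> i}" and ?L = "SIGMA j:{1..durfee \<nu>}. {j<..conj_part \<nu> j}"
  have eq: "boxes \<nu> = ?U \<union> prod.swap ` ?L"
  proof (intro equalityI subsetI)
    fix x assume x: "x \<in> boxes \<nu>"
    obtain i j where ij: "x = (i, j)" by (cases x)
    have b: "1 \<le> i" "1 \<le> j" "j \<le> part \<nu> i" using x ij by (auto simp: boxes_iff)
    show "x \<in> ?U \<union> prod.swap ` ?L"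
    proof (cases "i \<le> j")
      case True
      then show ?thesis using b ij durfee_iff[OF \<nu> b(1)] by auto
    next
      case False
      have "j \<le> part \<nu> j" using part_antimono[OF \<nu> b(2), of i] b False by simp
      moreover have "i \<le> conj_part \<nu> j" using le_conj_part_iff[OF \<nu> b(1,2)] b by simp
      ultimately have "(j, i) \<in> ?L" using False b durfee_iff[OF \<nu> b(2)] by auto
      then show ?thesis using ij by force
    qed
  next
    fix x assume "x \<in> ?U \<union> prod.swap ` ?L"
    then show "x \<in> boxes \<nu>" using le_conj_part_iff[OF \<nu>] by (auto simp: boxes_iff)
  qed
  have "card (boxes \<nu>) = card ?U + card (prod.swap ` ?L)"
    unfolding eq by (rule card_Un_disjoint) auto
  also have "card (prod.swap ` ?L) = card ?L" by (rule card_image) auto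
  finally have "int (sum_list \<nu>) = (\<Sum>i\<in>{1..durfee \<nu>}. int (Suc (part \<nu> i) - i)) + (\<Sum>j\<in>{1..durfee \<nu>}. int (conj_part \<nu> j - j))"
    by (simp add: card_boxes)
  also have "\<dots> = (\<Sum>i\<in>{1..durfee \<nu>}. 2 * bead \<nu> i)"
    unfolding sum.distrib[symmetric]
  proof (rule sum.cong[OF refl])
    fix i assume i: "i \<in> {1..durfee \<nu>}"
    then have "1 \<le> i" by simp
    have "i \<le> conj_part \<nu> i" using le_conj_part_iff[OF \<nu> \<open>1 \<le> i\<close> \<open>1 \<le> i\<close>] row[OF i] by simp
    then show "int (Suc (part \<nu> i) - i) + int (conj_part \<nu> i - i) = 2 * bead \<nu> i"
      using dd'[OF i] row[OF i] by (simp add: bead_def of_nat_diff)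
  qed
  also have "\<dots> = 2 * (\<Sum>i\<in>{1..durfee \<nu>}. bead \<nu> i)" by (simp only: sum_distrib_left)
  also have "(\<Sum>i\<in>{1..durfee \<nu>}. bead \<nu> i) = (\<Sum>k\<in>bead \<nu> ` {1..durfee \<nu>}. k)"
    by (subst sum.reindex) (auto simp: inj_on_def bead_eq_iff[OF \<nu>])
  also have "bead \<nu> ` {1..durfee \<nu>} = {k. k \<in> beads \<nu> \<and> k > 0}"
  proof -
    have "0 \<notin> beads \<nu>" using symmetric_beads_DD[OF DD] by (simp add: symmetric_beads_def)
    then have "bead \<nu> i \<noteq> 0" if "1 \<le> i" for i using that by (auto simp: beads_eq)
    then show ?thesis using bead_pos_iff[OF \<nu>] by (force simp: beads_eq)
  qed
  finally show ?thesis .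
qed

text \<open>By symmetry exactly L of the positions from - L on carry beads when L exceeds all of
  them, so the beads are balanced as in a word. In decreasing order they are the numbers part - i of
  the first L rows.\<close>

lemma partition_of_symmetric_beads:
  assumes sym: "symmetric_beads Z" and bdd: "\<And>k. k \<in> Z \<Longrightarrow> k \<le> b"
  obtains \<nu> where "\<nu> \<in> DD" "beads \<nu> = Z"
proof -
  \<comment> \<open>\<open>L\<close> exceeds every bead; being at least 1, it keeps - L away from
    the exceptional position 0 and provides a last bead \<open>zs ! (L - 1)\<close>.\<close>
  define L where "L = nat (max 1 (b + 1))"
  have L: "L \<ge> 1" "\<And>k. k \<in> Z \<Longrightarrow> k < int L" using bdd by (force simp: L_def)+
  have low: "k \<in> Z" if "k \<le> - int L" for k
  proof -
    have "- k \<notin> Z" using L(2)[of "- k"] that by auto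
    moreover have "k \<noteq> 0" using that L(1) by auto
    ultimately show ?thesis using sym unfolding symmetric_beads_def by blast
  qed
  define ZL where "ZL = Z \<inter> {- int L..}"
  have ZL: "ZL \<subseteq> {- int L..int L}" using L(2) by (force simp: ZL_def)
  then have fin: "finite ZL" by (rule finite_subset) simp
  have "card ZL = L"
  proof -
    have "bij_betw (\<lambda>k. nat \<bar>k\<bar>) ZL {1..L}"
      unfolding bij_betw_def
    proof
      show "inj_on (\<lambda>k. nat \<bar>k\<bar>) ZL"
      proof (rule inj_onI)
        fix k l assume kl: "k \<in> ZL" "l \<in> ZL" "nat \<bar>k\<bar> = nat \<bar>l\<bar>"
        then have "k = l \<or> k = - l" by linarith
        moreover have "k \<noteq> - l \<or> l = 0" using kl sym by (auto simp: ZL_def symmetric_beads_def)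
        ultimately show "k = l" by auto
      qed
      show "(\<lambda>k. nat \<bar>k\<bar>) ` ZL = {1..L}"
      proof (intro equalityI subsetI)
        fix m assume "m \<in> (\<lambda>k. nat \<bar>k\<bar>) ` ZL"
        then obtain k where k: "k \<in> ZL" "m = nat \<bar>k\<bar>" by auto
        then have "k \<noteq> 0" using sym by (auto simp: ZL_def symmetric_beads_def)
        then show "m \<in> {1..L}" using k ZL by force
      next
        fix m assume m: "m \<in> {1..L}"
        then have "int m \<in> Z \<or> - int m \<in> Z" using sym unfolding symmetric_beads_def by (metis of_nat_0_eq_iff atLeastAtMost_iff not_one_le_zero)
        then have "int m \<in> ZL \<or> - int m \<in> ZL" using m by (auto simp: ZL_def)
        then show "m \<in> (\<lambda>k. nat \<bar>k\<bar>) ` ZL" by (force simp: image_iff)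
      qed
    qed
    then show ?thesis by (simp add: bij_betw_same_card)
  qed
  define zs where "zs = rev (sorted_list_of_set ZL)"
  have zs: "length zs = L" "set zs = ZL" "sorted_wrt (>) zs"
    using fin \<open>card ZL = L\<close> by (auto simp: zs_def sorted_wrt_rev)
  have dec: "zs ! j + int (j - i) \<le> zs ! i" if "i \<le> j" "j < L" for i j
    using that
  proof (induction j rule: dec_induct)
    case (step j)
    have "zs ! Suc j < zs ! j" using zs step by (simp add: sorted_wrt_iff_nth_less)
    then show ?case using step by (simp add: Suc_diff_le)
  qed simp
  define f where "f i = (if i \<le> L then nat (zs ! (i - 1) + int i) else 0)" for i
  have nonneg: "zs ! (i - 1) + int i \<ge> 0" if "1 \<le> i" "i \<le> L" for i
  proof -
    have "zs ! (L - 1) \<in> ZL" unfolding zs(2)[symmetric] by (rule nth_mem) (use L zs in auto)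
    then have "zs ! (L - 1) \<ge> - int L" by (simp add: ZL_def)
    moreover have "i - 1 \<le> L - 1" "L - 1 < L" using that by auto
    then have "zs ! (L - 1) + int (L - 1 - (i - 1)) \<le> zs ! (i - 1)" by (rule dec)
    moreover have "int (L - 1 - (i - 1)) = int L - int i" using that by (simp add: of_nat_diff)
    ultimately show ?thesis by linarith
  qed
  have "f j \<le> f i" if "1 \<le> i" "i \<le> j" for i j
  proof (cases "j \<le> L")
    case True
    have "i - 1 \<le> j - 1" "j - 1 < L" using that True by auto
    then have "zs ! (j - 1) + int (j - 1 - (i - 1)) \<le> zs ! (i - 1)" by (rule dec)
    moreover have "int (j - 1 - (i - 1)) = int j - int i" using that by (simp add: of_nat_diff)
    ultimately show ?thesis using True that by (simp add: f_def)
  qed (simp add: f_def)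
  moreover have "f i = 0" if "i > L" for i using that by (simp add: f_def)
  ultimately obtain \<nu> where \<nu>: "\<nu> \<in> partitions" "\<And>i. 1 \<le> i \<Longrightarrow> part \<nu> i = f i"
    using partition_of_function[of f L] by blast
  have bead1: "bead \<nu> i = zs ! (i - 1)" if "1 \<le> i" "i \<le> L" for i
    using \<nu>(2)[OF that(1)] nonneg[OF that] that by (simp add: bead_def f_def)
  have bead2: "bead \<nu> i = - int i" if "i > L" for i
    using \<nu>(2)[of i] that by (simp add: bead_def f_def)
  have "beads \<nu> = Z"
  proof (intro equalityI subsetI)
    fix k assume "k \<in> beads \<nu>"
    then obtain i where i: "1 \<le> i" "k = bead \<nu> i" by (auto simp: beads_eq)
    show "k \<in> Z"
    proof (cases "i \<le> L")
      case True
      then have "k \<in> set zs" using bead1[of i] i zs(1) by auto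
      then show ?thesis unfolding zs(2) by (simp add: ZL_def)
    next
      case False
      then show ?thesis using bead2[of i] i low[of k] by simp
    qed
  next
    fix k assume k: "k \<in> Z"
    show "k \<in> beads \<nu>"
    proof (cases "k \<ge> - int L")
      case True
      then have "k \<in> set zs" using k unfolding zs(2) by (simp add: ZL_def)
      then obtain i where "i < L" "k = zs ! i" using zs(1) by (auto simp: in_set_conv_nth)
      then show ?thesis using bead1[of "i + 1"] unfolding beads_eq by (intro image_eqI[of _ _ "i + 1"]) auto
    next
      case False
      then show ?thesis using bead2[of "nat (- k)"] unfolding beads_eq by (intro image_eqI[of _ _ "nat (- k)"]) auto
    qed
  qed
  then show ?thesis using that[of \<nu>] DD_of_symmetric_beads[OF \<nu>(1)] sym by simp
qed

section \<open>Doubled distinct cores and integer vectors\<close>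

text \<open>The entry \<open>n r\<close> is the signed number of beads on runner r in comparison
  with the empty partition, whose beads are the negative positions; the runners beyond t follow from
  the symmetry.\<close>

definition core_beta :: "nat \<Rightarrow> (nat \<Rightarrow> int) \<Rightarrow> nat \<Rightarrow> int" where
  "core_beta t n r = (if r = 0 then 0 else if r \<le> t then int r + int (2 * t + 1) * n r
     else int r - int (2 * t + 1) * n (2 * t + 1 - r))"

definition core_beads :: "nat \<Rightarrow> (nat \<Rightarrow> int) \<Rightarrow> int set" where
  "core_beads t n = {k. k < core_beta t n (nat (k mod int (2 * t + 1)))}"

text \<open>The choice exists by \<open>partition_of_symmetric_beads\<close> and is unique by
  \<open>beads_inj\<close>.\<close>

definition core_of :: "nat \<Rightarrow> (nat \<Rightarrow> int) \<Rightarrow> nat list" where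
  "core_of t n = (SOME \<nu>. \<nu> \<in> DD \<and> beads \<nu> = core_beads t n)"

lemma core_beta_reflect:
  assumes "0 < r" "r < 2 * t + 1"
  shows "core_beta t n (2 * t + 1 - r) = int (2 * t + 1) - core_beta t n r"
  using assms by (auto simp: core_beta_def of_nat_diff)

lemma core_beta_eq:
  assumes "r < 2 * t + 1"
  obtains m where "core_beta t n r = int r + int (2 * t + 1) * m"
proof -
  consider "r = 0" | "0 < r" "r \<le> t" | "t < r" by linarith
  then show ?thesis
  proof cases
    case 1
    then show ?thesis using that[of 0] by (simp add: core_beta_def)
  next
    case 2
    then show ?thesis using that[of "n r"] by (simp add: core_beta_def)
  next
    case 3
    then show ?thesis using that[of "- n (2 * t + 1 - r)"] by (simp add: core_beta_def)
  qed
qed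

lemma residue_cases:
  fixes k :: int
  obtains r m where "r < 2 * t + 1" "k = int r + int (2 * t + 1) * m" "nat (k mod int (2 * t + 1)) = r"
proof -
  have "k = int (nat (k mod int (2 * t + 1))) + int (2 * t + 1) * (k div int (2 * t + 1))"
    by (simp add: mult.commute)
  moreover have "nat (k mod int (2 * t + 1)) < 2 * t + 1"
    using pos_mod_bound[of "int (2 * t + 1)" k] pos_mod_sign[of "int (2 * t + 1)" k] by linarith
  ultimately show ?thesis using that by blast
qed

lemma residue_eq:
  assumes "r < 2 * t + 1"
  shows "nat ((int r + int (2 * t + 1) * m) mod int (2 * t + 1)) = r"
proof -
  have "(int r + int (2 * t + 1) * m) mod int (2 * t + 1) = int r"
    using assms by (simp only: mod_mult_self2) simp
  then show ?thesis by simp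
qed

lemma mem_core_beads_iff:
  assumes "r < 2 * t + 1"
  shows "int r + int (2 * t + 1) * m \<in> core_beads t n \<longleftrightarrow> int r + int (2 * t + 1) * m < core_beta t n r"
  unfolding core_beads_def mem_Collect_eq residue_eq[OF assms] ..

lemma mult_less_cancel_int: "(g :: int) > 0 \<Longrightarrow> g * a < g * b \<longleftrightarrow> a < b"
  by simp

text \<open>For r nonzero, negation takes height m on runner r to height - m - 1 on runner g - r,
  and by \<open>core_beta_reflect\<close> it exchanges the positions below one bound with those at
  or above the other.\<close>

lemma symmetric_core_beads: "symmetric_beads (core_beads t n)"
  unfolding symmetric_beads_def
proof (intro conjI allI impI)
  let ?g = "int (2 * t + 1)"
  show "0 \<notin> core_beads t n" by (simp add: core_beads_def core_beta_def)
  fix k :: int assume k: "k \<noteq> 0"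
  obtain r m where r: "r < 2 * t + 1" "k = int r + ?g * m" by (rule residue_cases[of t k]) auto
  obtain m' where m': "core_beta t n r = int r + ?g * m'" using core_beta_eq[OF r(1)] by blast
  have kin: "k \<in> core_beads t n \<longleftrightarrow> m < m'"
    unfolding r(2) mem_core_beads_iff[OF r(1)] m' using mult_less_cancel_int[of ?g m m'] by linarith
  show "- k \<in> core_beads t n \<longleftrightarrow> k \<notin> core_beads t n"
  proof (cases "r = 0")
    case True
    then have "m' = 0" using m' by (simp add: core_beta_def)
    have "m \<noteq> 0" using k r True by auto
    have "- k = int 0 + ?g * (- m)" using r True by simp
    then have "- k \<in> core_beads t n \<longleftrightarrow> int 0 + ?g * (- m) < core_beta t n 0"
      using mem_core_beads_iff[of 0 t "- m" n] by simp
    also have "\<dots> \<longleftrightarrow> - m < 0" by (simp add: core_beta_def zero_less_mult_iff)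
    finally show ?thesis using kin \<open>m' = 0\<close> \<open>m \<noteq> 0\<close> by auto
  next
    case False
    let ?s = "2 * t + 1 - r"
    have s: "?s < 2 * t + 1" using False r by simp
    have "- k = int ?s + ?g * (- m - 1)" using r by (simp add: of_nat_diff algebra_simps)
    then have "- k \<in> core_beads t n \<longleftrightarrow> int ?s + ?g * (- m - 1) < core_beta t n ?s"
      using mem_core_beads_iff[OF s] by simp
    also have "core_beta t n ?s = int ?s + ?g * (- m')"
      using core_beta_reflect[of r t n] False r m' by (simp add: of_nat_diff algebra_simps)
    also have "int ?s + ?g * (- m - 1) < int ?s + ?g * (- m') \<longleftrightarrow> - m - 1 < - m'"
      using mult_less_cancel_int[of ?g "- m - 1" "- m'"] by linarith
    finally show ?thesis using kin by auto
  qed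
qed

lemma core_beads_bounded: "\<exists>b. \<forall>k\<in>core_beads t n. k \<le> b"
proof (intro exI ballI)
  fix k assume "k \<in> core_beads t n"
  then have k: "k < core_beta t n (nat (k mod int (2 * t + 1)))" by (simp add: core_beads_def)
  obtain r where r: "r < 2 * t + 1" "nat (k mod int (2 * t + 1)) = r" by (rule residue_cases[of t k]) auto
  then have "k \<le> core_beta t n r" using k by simp
  also have "\<dots> \<le> Max (core_beta t n ` {..<2 * t + 1})" by (rule Max_ge) (use r in auto)
  finally show "k \<le> Max (core_beta t n ` {..<2 * t + 1})" .
qed

lemma core_of:
  shows core_of_DD: "core_of t n \<in> DD" and beads_core_of: "beads (core_of t n) = core_beads t n"
proof -
  obtain b where b: "\<And>k. k \<in> core_beads t n \<Longrightarrow> k \<le> b" using core_beads_bounded[of t n] by blast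
  have "\<exists>\<nu>. \<nu> \<in> DD \<and> beads \<nu> = core_beads t n"
    using partition_of_symmetric_beads[OF symmetric_core_beads b] by metis
  then have "core_of t n \<in> DD \<and> beads (core_of t n) = core_beads t n"
    unfolding core_of_def by (rule someI_ex)
  then show "core_of t n \<in> DD" "beads (core_of t n) = core_beads t n" by blast+
qed

lemma core_of_in: "core_of t n \<in> DD_cores (2 * t + 1)"
proof -
  have "k - int (2 * t + 1) \<in> core_beads t n" if "k \<in> core_beads t n" for k
    using that by (auto simp: core_beads_def minus_mod_self2)
  then show ?thesis
    using core_of_DD[of t n] core_iff[of "core_of t n" "2 * t + 1"] beads_core_of[of t n]
    by (auto simp: DD_cores_def DD_def)
qed

lemma down_closed_int:
  fixes S :: "int set"
  assumes ne: "S \<noteq> {}" and bdd: "\<And>m. m \<in> S \<Longrightarrow> m \<le> b" and down: "\<And>m. m \<in> S \<Longrightarrow> m - 1 \<in> S"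
  obtains n where "\<And>m. m \<in> S \<longleftrightarrow> m < n"
proof -
  obtain m0 where m0: "m0 \<in> S" using ne by blast
  define M where "M = Max (S \<inter> {m0..b})"
  have fin: "finite (S \<inter> {m0..b})" by simp
  have m0': "m0 \<in> S \<inter> {m0..b}" using m0 bdd by auto
  then have "M \<in> S \<inter> {m0..b}" unfolding M_def by (intro Max_in fin) blast
  then have M: "M \<in> S" "m0 \<le> M" by auto
  have up: "m \<le> M" if "m \<in> S" for m
  proof (cases "m \<ge> m0")
    case True
    then show ?thesis unfolding M_def using that bdd by (intro Max_ge fin) auto
  qed (use M in simp)
  have down': "M - int j \<in> S" for j
  proof (induction j)
    case (Suc j)
    then have "M - int j - 1 \<in> S" by (rule down)
    then show ?case by (simp add: algebra_simps)
  qed (use M in simp)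
  have "m \<in> S \<longleftrightarrow> m < M + 1" for m
    using up[of m] down'[of "nat (M - m)"] by (cases "m \<le> M") auto
  then show ?thesis by (rule that)
qed

text \<open>On a runner r between 1 and t the beads form a nonempty set of heights, bounded above
  and closed downwards; its bound is \<open>n r\<close>. Runner 0 and the runners beyond t are
  determined by the symmetry.\<close>

lemma core_beads_of_core:
  assumes "\<omega> \<in> DD_cores (2 * t + 1)"
  obtains n where "n \<in> {1..t} \<rightarrow>\<^sub>E UNIV" "beads \<omega> = core_beads t n"
proof -
  let ?g = "int (2 * t + 1)"
  have DD: "\<omega> \<in> DD" "core (2 * t + 1) \<omega>" and \<omega>: "\<omega> \<in> partitions"
    using assms by (auto simp: DD_cores_def DD_def)
  have sym: "0 \<notin> beads \<omega>" "\<And>k. k \<noteq> 0 \<Longrightarrow> - k \<in> beads \<omega> \<longleftrightarrow> k \<notin> beads \<omega>"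
    using symmetric_beads_DD[OF DD(1)] by (auto simp: symmetric_beads_def)
  have step: "k - ?g \<in> beads \<omega>" if "k \<in> beads \<omega>" for k
    using that DD(2) core_iff[OF \<omega>, of "2 * t + 1"] by auto
  have steps: "k - ?g * int j \<in> beads \<omega>" if "k \<in> beads \<omega>" for k j
  proof (induction j)
    case (Suc j)
    then have "k - ?g * int j - ?g \<in> beads \<omega>" by (rule step)
    then show ?case by (simp add: algebra_simps)
  qed (use that in simp)
  define b where "b = max 0 (bead \<omega> 1)"
  have bdd: "k \<le> b" if k: "k \<in> beads \<omega>" for k
  proof -
    obtain i where "1 \<le> i" "k = bead \<omega> i" using k by (auto simp: beads_eq)
    then show ?thesis using bead_less[OF \<omega>, of 1 i] by (cases "i = 1") (auto simp: b_def)
  qed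
  have "\<exists>n. \<forall>m. int r + ?g * m \<in> beads \<omega> \<longleftrightarrow> m < n" if r: "1 \<le> r" "r \<le> t" for r
  proof -
    define S where "S = {m. int r + ?g * m \<in> beads \<omega>}"
    have ge: "m \<le> int r + ?g * m" if "m \<ge> 0" for m using that by (simp add: mult_le_cancel_right1 algebra_simps)
    have "S \<noteq> {}"
    proof -
      \<comment> \<open>So low that the opposite position lies above all beads, hence is a gap; by
        symmetry the position itself carries a bead.\<close>
      define m where "m = - (b + 1) - 1"
      have "?g * (b + 1) \<ge> 1 * (b + 1)" by (rule mult_right_mono) (auto simp: b_def)
      moreover have "int r < ?g" using r by simp
      ultimately have "- (int r + ?g * m) > b" by (simp add: m_def algebra_simps)
      then have "- (int r + ?g * m) \<notin> beads \<omega>" "int r + ?g * m \<noteq> 0" using bdd by (force simp: b_def)+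
      then have "m \<in> S" unfolding S_def mem_Collect_eq using sym(2)[of "int r + ?g * m"] by blast
      then show ?thesis by blast
    qed
    moreover have "m \<le> b" if "m \<in> S" for m
    proof (cases "m \<ge> 0")
      case True
      then show ?thesis using bdd[of "int r + ?g * m"] ge[of m] that by (simp add: S_def)
    qed (simp add: b_def)
    moreover have "m - 1 \<in> S" if "m \<in> S" for m
      using step[of "int r + ?g * m"] that by (simp add: S_def algebra_simps)
    ultimately obtain n where "\<And>m. m \<in> S \<longleftrightarrow> m < n" using down_closed_int[of S b] by blast
    then show ?thesis by (auto simp: S_def)
  qed
  then obtain N where N: "\<And>r m. 1 \<le> r \<Longrightarrow> r \<le> t \<Longrightarrow> int r + ?g * m \<in> beads \<omega> \<longleftrightarrow> m < N r" by metis
  define n where "n = restrict N {1..t}"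
  have n: "int r + ?g * m \<in> beads \<omega> \<longleftrightarrow> m < n r" if "1 \<le> r" "r \<le> t" for r m
    using N[OF that] that by (simp add: n_def)
  have "k \<in> beads \<omega> \<longleftrightarrow> k \<in> core_beads t n" for k
  proof -
    obtain r m where r: "r < 2 * t + 1" "k = int r + ?g * m" by (rule residue_cases[of t k]) auto
    consider "r = 0" | "1 \<le> r" "r \<le> t" | "t < r" by linarith
    then show ?thesis
    proof cases
      case 1
      \<comment> \<open>A bead at a nonnegative multiple of g could be lowered to 0, which is always
        a gap.\<close>
      have "k \<in> beads \<omega> \<longleftrightarrow> m < 0"
      proof (cases "m \<ge> 0")
        case True
        have "k \<notin> beads \<omega>"
        proof
          assume "k \<in> beads \<omega>"
          then have "k - ?g * int (nat m) \<in> beads \<omega>" by (rule steps)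
          then show False using sym(1) True r 1 by simp
        qed
        then show ?thesis using True by simp
      next
        case False
        have "- k \<notin> beads \<omega>"
        proof
          assume "- k \<in> beads \<omega>"
          then have "- k - ?g * int (nat (- m)) \<in> beads \<omega>" by (rule steps)
          then show False using sym(1) False r 1 by simp
        qed
        moreover have "k \<noteq> 0" using False r 1 by auto
        ultimately show ?thesis using sym(2)[of k] False by simp
      qed
      also have "\<dots> \<longleftrightarrow> k \<in> core_beads t n"
        unfolding r(2) mem_core_beads_iff[OF r(1)] using 1 by (simp add: core_beta_def mult_less_0_iff)
      finally show ?thesis .
    next
      case 2
      have "k \<in> core_beads t n \<longleftrightarrow> int r + ?g * m < int r + ?g * n r"
        unfolding r(2) mem_core_beads_iff[OF r(1)] using 2 by (simp add: core_beta_def)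
      also have "\<dots> \<longleftrightarrow> m < n r" using mult_less_cancel_int[of ?g m "n r"] by linarith
      finally show ?thesis using n[OF 2] r by simp
    next
      case 3
      let ?s = "2 * t + 1 - r"
      have s: "1 \<le> ?s" "?s \<le> t" using 3 r by auto
      have "- k = int ?s + ?g * (- m - 1)" using r by (simp add: of_nat_diff algebra_simps)
      then have "- k \<in> beads \<omega> \<longleftrightarrow> - m - 1 < n ?s" using n[OF s] by simp
      moreover have "k \<noteq> 0"
      proof
        assume "k = 0"
        then have "int r = ?g * (- m)" using r(2) by simp
        moreover have "0 < int r" "int r < ?g" using 3 r by auto
        ultimately have "0 < ?g * (- m)" "?g * (- m) < ?g * 1" by simp_all
        then show False using mult_less_cancel_int[of ?g "- m" 1] mult_less_cancel_int[of ?g 0 "- m"] by simp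
      qed
      ultimately have "k \<in> beads \<omega> \<longleftrightarrow> m < - n ?s" using sym(2)[of k] by auto
      moreover have "k \<in> core_beads t n \<longleftrightarrow> int r + ?g * m < int r + ?g * (- n ?s)"
        unfolding r(2) mem_core_beads_iff[OF r(1)] using 3 by (simp add: core_beta_def)
      moreover have "int r + ?g * m < int r + ?g * (- n ?s) \<longleftrightarrow> m < - n ?s"
        using mult_less_cancel_int[of ?g m "- n ?s"] by linarith
      ultimately show ?thesis by simp
    qed
  qed
  then show ?thesis using that[of n] by (auto simp: n_def)
qed

lemma core_beads_inj:
  assumes n: "n \<in> {1..t} \<rightarrow>\<^sub>E UNIV" "n' \<in> {1..t} \<rightarrow>\<^sub>E UNIV" and eq: "core_beads t n = core_beads t n'"
  shows "n = n'"
proof (rule PiE_ext[OF n])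
  fix i assume i: "i \<in> {1..t}"
  let ?g = "int (2 * t + 1)"
  have mem: "int i + ?g * m \<in> core_beads t u \<longleftrightarrow> m < u i" for m u
  proof -
    have "int i + ?g * m \<in> core_beads t u \<longleftrightarrow> int i + ?g * m < int i + ?g * u i"
      using mem_core_beads_iff[of i t m u] i by (simp add: core_beta_def)
    then show ?thesis using mult_less_cancel_int[of ?g m "u i"] by linarith
  qed
  have "m < n i \<longleftrightarrow> m < n' i" for m using mem[of m n] mem[of m n'] eq by simp
  from this[of "n i"] this[of "n' i"] show "n i = n' i" by auto
qed

theorem bij_betw_core_of: "bij_betw (core_of t) ({1..t} \<rightarrow>\<^sub>E UNIV) (DD_cores (2 * t + 1))"
  unfolding bij_betw_def
proof
  show "inj_on (core_of t) ({1..t} \<rightarrow>\<^sub>E UNIV)"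
    by (rule inj_onI) (metis beads_core_of core_beads_inj)
  show "core_of t ` ({1..t} \<rightarrow>\<^sub>E UNIV) = DD_cores (2 * t + 1)"
  proof (intro equalityI subsetI)
    fix \<omega> assume \<omega>: "\<omega> \<in> DD_cores (2 * t + 1)"
    obtain n where n: "n \<in> {1..t} \<rightarrow>\<^sub>E UNIV" "beads \<omega> = core_beads t n"
      using core_beads_of_core[OF \<omega>] by blast
    have "core_of t n = \<omega>"
      by (rule beads_inj) (use core_of_DD[of t n] \<omega> n beads_core_of[of t n] in \<open>auto simp: DD_cores_def DD_def\<close>)
    then show "\<omega> \<in> core_of t ` ({1..t} \<rightarrow>\<^sub>E UNIV)" using n by blast
  qed (use core_of_in in auto)
qed

lemma beta_core_of:
  assumes r: "r < 2 * t + 1"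
  shows "beta (2 * t + 1) (core_of t n) r = core_beta t n r"
  unfolding beta_def
proof (rule Greatest_equality)
  let ?g = "int (2 * t + 1)"
  obtain m where m: "core_beta t n r = int r + ?g * m" using core_beta_eq[OF r] by blast
  have w: "word (core_of t n) (k * ?g + int r) = 0 \<longleftrightarrow> k < m" for k
  proof -
    have "word (core_of t n) (k * ?g + int r) = 0 \<longleftrightarrow> int r + ?g * k < int r + ?g * m"
      unfolding word_eq_0_iff beads_core_of m[symmetric] mem_core_beads_iff[OF r, symmetric]
      by (simp only: add.commute mult.commute)
    then show ?thesis using mult_less_cancel_int[of ?g k m] by linarith
  qed
  show "\<exists>k. core_beta t n r = (k + 1) * ?g + int r \<and> word (core_of t n) (k * ?g + int r) = 0"
    unfolding w by (rule exI[of _ "m - 1"]) (simp add: m algebra_simps)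
  fix y assume "\<exists>k. y = (k + 1) * ?g + int r \<and> word (core_of t n) (k * ?g + int r) = 0"
  then obtain k where "y = (k + 1) * ?g + int r" "k < m" unfolding w by blast
  moreover from this have "(k + 1) * ?g \<le> m * ?g" by (intro mult_right_mono) auto
  ultimately show "y \<le> core_beta t n r" by (simp add: m algebra_simps)
qed

text \<open>\<open>big_beta t n i\<close> is the larger one of the numbers \<open>\<beta>\<close> of the conjugate runners \<open>i\<close> and
  \<open>2 t + 1 - i\<close>; it is the first position without a bead above the positive beads on its runner, and the
  conjugate runner has no positive bead.\<close>

definition big_res :: "nat \<Rightarrow> (nat \<Rightarrow> int) \<Rightarrow> nat \<Rightarrow> nat" where
  "big_res t n i = (if n i \<ge> 1 then i else 2 * t + 1 - i)"

text \<open>The number of positive beads on the runners i and 2t + 1 - i together; it is the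
  absolute value of \<open>n i\<close>.\<close>

definition big_quot :: "(nat \<Rightarrow> int) \<Rightarrow> nat \<Rightarrow> nat" where
  "big_quot n i = (if n i \<ge> 1 then nat (n i) else nat (- n i))"

definition big_beta :: "nat \<Rightarrow> (nat \<Rightarrow> int) \<Rightarrow> nat \<Rightarrow> int" where
  "big_beta t n i = int (big_res t n i) + int (2 * t + 1) * int (big_quot n i)"

lemma big_res_bounds:
  assumes "i \<in> {1..t}"
  shows "1 \<le> big_res t n i" "big_res t n i < 2 * t + 1"
  using assms by (auto simp: big_res_def)

lemma core_beta_big_res:
  assumes "i \<in> {1..t}"
  shows "core_beta t n (big_res t n i) = big_beta t n i"
  using assms by (auto simp: core_beta_def big_res_def big_beta_def big_quot_def)

lemma core_beta_small:
  assumes i: "i \<in> {1..t}"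
  shows "core_beta t n i = (if n i \<ge> 1 then big_beta t n i else int (2 * t + 1) - big_beta t n i)"
    and "core_beta t n (2 * t + 1 - i) = (if n i \<ge> 1 then int (2 * t + 1) - big_beta t n i else big_beta t n i)"
proof -
  have r: "0 < i" "i < 2 * t + 1" using i by auto
  show 1: "core_beta t n i = (if n i \<ge> 1 then big_beta t n i else int (2 * t + 1) - big_beta t n i)"
    using core_beta_big_res[OF i, of n] core_beta_reflect[OF r, of n] by (auto simp: big_res_def)
  show "core_beta t n (2 * t + 1 - i) = (if n i \<ge> 1 then int (2 * t + 1) - big_beta t n i else big_beta t n i)"
    unfolding core_beta_reflect[OF r, of n] 1 by simp
qed

text \<open>This bound separates the larger numbers of the conjugate pairs from the smaller ones,
  which are then at most t.\<close>

lemma big_beta_gt: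
  assumes i: "i \<in> {1..t}"
  shows "big_beta t n i > int t"
proof (cases "n i \<ge> 1")
  case True
  define P where "P = int (2 * t + 1) * int (big_quot n i)"
  have "P \<ge> int (2 * t + 1) * 1"
    unfolding P_def using True by (intro mult_left_mono) (auto simp: big_quot_def)
  then show ?thesis unfolding big_beta_def P_def[symmetric] by simp
next
  case False
  then have "int (big_res t n i) > int t" using i by (simp add: big_res_def)
  moreover have "int (2 * t + 1) * int (big_quot n i) \<ge> 0" by simp
  ultimately show ?thesis unfolding big_beta_def by linarith
qed

lemma big_res_eq_iff:
  assumes "i \<in> {1..t}" "j \<in> {1..t}"
  shows "big_res t n i = big_res t n j \<longleftrightarrow> i = j"
  using assms by (auto simp: big_res_def)

lemma big_beta_mod:
  assumes "i \<in> {1..t}"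
  shows "nat (big_beta t n i mod int (2 * t + 1)) = big_res t n i"
  unfolding big_beta_def by (rule residue_eq) (use big_res_bounds[OF assms] in auto)

lemma big_beta_eq_iff:
  assumes "i \<in> {1..t}" "j \<in> {1..t}"
  shows "big_beta t n i = big_beta t n j \<longleftrightarrow> i = j"
  using big_beta_mod[OF assms(1), of n] big_beta_mod[OF assms(2), of n] big_res_eq_iff[OF assms, of n] by auto

lemma bij_betw_pos_beads:
  "bij_betw (\<lambda>(i, k). int (big_res t n i) + int (2 * t + 1) * int k) (SIGMA i:{1..t}. {..<big_quot n i})
     {k \<in> core_beads t n. k > 0}"
  unfolding bij_betw_def
proof
  let ?g = "int (2 * t + 1)" and ?f = "\<lambda>(i, k). int (big_res t n i) + int (2 * t + 1) * int k"
  show "inj_on ?f (SIGMA i:{1..t}. {..<big_quot n i})"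
  proof (rule inj_onI, clarify)
    fix i k i' k' assume h: "i \<in> {1..t}" "i' \<in> {1..t}"
      "int (big_res t n i) + ?g * int k = int (big_res t n i') + ?g * int k'"
    then have "big_res t n i = big_res t n i'"
      using residue_eq[OF big_res_bounds(2)[OF h(1), of n], of "int k"] residue_eq[OF big_res_bounds(2)[OF h(2), of n], of "int k'"] by simp
    then have "i = i'" using big_res_eq_iff[OF h(1,2)] by simp
    moreover have "?g * int k = ?g * int k'" using h \<open>i = i'\<close> by simp
    then have "k = k'" by (simp only: mult_cancel_left of_nat_eq_iff of_nat_0_eq_iff) simp
    ultimately show "i = i' \<and> k = k'" by simp
  qed
  show "?f ` (SIGMA i:{1..t}. {..<big_quot n i}) = {k \<in> core_beads t n. k > 0}"
  proof (intro equalityI subsetI)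
    fix x assume "x \<in> ?f ` (SIGMA i:{1..t}. {..<big_quot n i})"
    then obtain i k where x: "i \<in> {1..t}" "k < big_quot n i" "x = int (big_res t n i) + ?g * int k" by auto
    have "?g * int k < ?g * int (big_quot n i)" using x(2) by simp
    then have "x \<in> core_beads t n"
      unfolding x(3) mem_core_beads_iff[OF big_res_bounds(2)[OF x(1)]] core_beta_big_res[OF x(1)] big_beta_def by linarith
    moreover have "?g * int k \<ge> 0" by simp
    then have "x > 0" using big_res_bounds(1)[OF x(1), of n] x(3) by linarith
    ultimately show "x \<in> {k \<in> core_beads t n. k > 0}" by simp
  next
    fix x assume "x \<in> {k \<in> core_beads t n. k > 0}"
    then have x: "x \<in> core_beads t n" "x > 0" by auto
    obtain r m where r: "r < 2 * t + 1" "x = int r + ?g * m" by (rule residue_cases[of t x]) auto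
    have "m \<ge> 0"
    proof (rule ccontr)
      assume "\<not> m \<ge> 0"
      then have "?g * m \<le> ?g * (- 1)" by (intro mult_left_mono) auto
      moreover have "int r < ?g" using r by simp
      ultimately show False using r(2) x(2) by simp
    qed
    have lt: "x < core_beta t n r" using x(1) mem_core_beads_iff[OF r(1)] r(2) by simp
    have "r \<noteq> 0" using lt x(2) by (intro notI) (simp add: core_beta_def)
    have gm: "?g * m \<ge> 0" using \<open>m \<ge> 0\<close> by simp
    define i where "i = (if r \<le> t then r else 2 * t + 1 - r)"
    have i: "i \<in> {1..t}" using r \<open>r \<noteq> 0\<close> by (auto simp: i_def)
    have "r = big_res t n i"
    proof (cases "r \<le> t")
      case True
      have "n r \<ge> 1"
        using lt True \<open>r \<noteq> 0\<close> r \<open>m \<ge> 0\<close> by (simp add: core_beta_def)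
      then show ?thesis using True by (simp add: big_res_def i_def)
    next
      case False
      have "\<not> n (2 * t + 1 - r) \<ge> 1"
      proof
        assume "n (2 * t + 1 - r) \<ge> 1"
        then have "?g * n (2 * t + 1 - r) \<ge> 0" by simp
        then show False using lt False r gm by (simp add: core_beta_def)
      qed
      then show ?thesis using False r by (simp add: big_res_def i_def)
    qed
    then have "?g * m < ?g * int (big_quot n i)"
      using lt r(2) core_beta_big_res[OF i, of n] by (simp add: big_beta_def)
    then have "nat m < big_quot n i" using mult_less_cancel_int[of ?g m "int (big_quot n i)"] \<open>m \<ge> 0\<close> by simp
    moreover have "x = ?f (i, nat m)" using r(2) \<open>r = big_res t n i\<close> \<open>m \<ge> 0\<close> by simp
    ultimately show "x \<in> ?f ` (SIGMA i:{1..t}. {..<big_quot n i})" using i by blast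
  qed
qed

text \<open>Half the size is the sum of the positive beads. On one runner these form an arithmetic
  progression with sum r m + g m (m - 1) / 2, which is the exponent of T in the theta series; for n
  i <= 0 the symmetry of \<open>qexp\<close> is used.\<close>

lemma sum_list_core_of: "sum_list (core_of t n) = 2 * (\<Sum>i=1..t. qexp i (2 * t + 1 - i) (n i))"
proof -
  let ?g = "int (2 * t + 1)"
  have tri: "(\<Sum>k<m. int r + ?g * int k) = int r * int m + ?g * tri (int m)" for r m
  proof (induction m)
    case (Suc m)
    have "tri (int (Suc m)) = tri (int m) + int m" using tri_add_one[of "int m"] by (simp add: add.commute)
    then show ?case using Suc by (simp add: algebra_simps)
  qed simp
  have inner: "int (big_res t n i) * int (big_quot n i) + ?g * tri (int (big_quot n i)) = int (qexp i (2 * t + 1 - i) (n i))"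
    if i: "i \<in> {1..t}" for i
  proof -
    have g: "i + (2 * t + 1 - i) = 2 * t + 1" "(2 * t + 1 - i) + i = 2 * t + 1" using i by auto
    show ?thesis
    proof (cases "n i \<ge> 1")
      case True
      then show ?thesis unfolding int_qexp g by (simp add: big_res_def big_quot_def)
    next
      case False
      have "int (qexp i (2 * t + 1 - i) (n i)) = int (2 * t + 1 - i) * (- n i) + ?g * tri (- n i)"
        using int_qexp[of "2 * t + 1 - i" i "- n i"] unfolding g qexp_uminus .
      then show ?thesis using False by (simp add: big_res_def big_quot_def)
    qed
  qed
  have "(\<Sum>k | k \<in> core_beads t n \<and> k > 0. k)
     = (\<Sum>(i, k)\<in>(SIGMA i:{1..t}. {..<big_quot n i}). int (big_res t n i) + ?g * int k)"
    using sum.reindex_bij_betw[OF bij_betw_pos_beads[of t n], of "\<lambda>k. k"] by (simp add: case_prod_unfold)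
  also have "\<dots> = (\<Sum>i=1..t. \<Sum>k<big_quot n i. int (big_res t n i) + ?g * int k)"
    by (rule sum.Sigma[symmetric]) auto
  also have "\<dots> = (\<Sum>i=1..t. int (qexp i (2 * t + 1 - i) (n i)))"
    unfolding tri by (rule sum.cong[OF refl]) (rule inner)
  finally have "int (sum_list (core_of t n)) = 2 * (\<Sum>i=1..t. int (qexp i (2 * t + 1 - i) (n i)))"
    using sum_list_DD[OF core_of_DD[of t n]] by (simp add: beads_core_of)
  then have "int (sum_list (core_of t n)) = int (2 * (\<Sum>i=1..t. qexp i (2 * t + 1 - i) (n i)))" by simp
  then show ?thesis by (simp only: of_nat_eq_iff)
qed

lemma sorted_list_of_set_Un:
  fixes A B :: "'a::linorder set"
  assumes fin: "finite A" "finite B" and lt: "\<And>a b. a \<in> A \<Longrightarrow> b \<in> B \<Longrightarrow> a < b"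
  shows "sorted_list_of_set (A \<union> B) = sorted_list_of_set A @ sorted_list_of_set B"
proof (rule sorted_distinct_set_unique)
  show "sorted (sorted_list_of_set A @ sorted_list_of_set B)"
    using fin lt by (auto simp: sorted_append less_imp_le)
  show "distinct (sorted_list_of_set A @ sorted_list_of_set B)"
    using fin lt by fastforce
qed (use fin in auto)

text \<open>The 2t + 1 numbers \<beta> are 0, the t larger ones of the conjugate pairs, and 2t + 1
  minus these. The larger ones exceed t and all others do not, so they are the t largest.\<close>

lemma V_coding_core_of: "V_coding (2 * t + 1) t (core_of t n) = rev (sorted_list_of_set (big_beta t n ` {1..t}))"
proof -
  let ?g = "2 * t + 1"
  define S where "S = Set.insert 0 ((\<lambda>b. int ?g - b) ` big_beta t n ` {1..t})"
  define B where "B = big_beta t n ` {1..t}"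
  have R: "{0..<?g} = {0} \<union> ({1..t} \<union> (\<lambda>i. ?g - i) ` {1..t})"
  proof (intro equalityI subsetI)
    fix r assume r: "r \<in> {0..<?g}"
    consider "r = 0" | "r \<in> {1..t}" | "t < r" by force
    then show "r \<in> {0} \<union> ({1..t} \<union> (\<lambda>i. ?g - i) ` {1..t})"
    proof cases
      case 3
      then have "r = ?g - (?g - r)" "?g - r \<in> {1..t}" using r by auto
      then show ?thesis by blast
    qed auto
  qed auto
  have "beta ?g (core_of t n) ` {0..<?g} = core_beta t n ` {0..<?g}"
    by (rule image_cong[OF refl], rule beta_core_of) simp
  also have "core_beta t n ` {0..<?g} = Set.insert 0 (\<Union>i\<in>{1..t}. {core_beta t n i, core_beta t n (?g - i)})"
    unfolding R by (auto simp: core_beta_def[of t n 0])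
  also have "(\<Union>i\<in>{1..t}. {core_beta t n i, core_beta t n (?g - i)}) = (\<Union>i\<in>{1..t}. {int ?g - big_beta t n i, big_beta t n i})"
  proof (rule SUP_cong[OF refl])
    fix i assume i: "i \<in> {1..t}"
    show "{core_beta t n i, core_beta t n (?g - i)} = {int ?g - big_beta t n i, big_beta t n i}"
      unfolding core_beta_small[OF i] by auto
  qed
  finally have eq: "beta ?g (core_of t n) ` {0..<?g} = S \<union> B" by (auto simp: S_def B_def)
  have "card B = t" unfolding B_def by (subst card_image) (auto simp: inj_on_def big_beta_eq_iff)
  have "sorted_list_of_set (S \<union> B) = sorted_list_of_set S @ sorted_list_of_set B"
  proof (rule sorted_list_of_set_Un)
    fix a b assume "a \<in> S" "b \<in> B"
    then have "b > int t" using big_beta_gt by (auto simp: B_def)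
    moreover have "a \<le> int t"
    proof (cases "a = 0")
      case False
      then obtain i where "i \<in> {1..t}" "a = int ?g - big_beta t n i" using \<open>a \<in> S\<close> by (auto simp: S_def)
      then show ?thesis using big_beta_gt[of i t n] by simp
    qed simp
    ultimately show "a < b" by simp
  qed (auto simp: S_def B_def)
  then show ?thesis
    unfolding V_coding_def eq B_def[symmetric] using \<open>card B = t\<close> by simp
qed

section \<open>Signs\<close>

text \<open>Relative to decreasing order, since the coding is listed decreasingly.\<close>

definition inversions :: "nat \<Rightarrow> (nat \<Rightarrow> int) \<Rightarrow> (nat \<times> nat) set" where
  "inversions n F = {(a, b). a < b \<and> b < n \<and> F a < F b}"

lemma finite_inversions: "finite (inversions n F)"
  by (rule finite_subset[of _ "{..<n} \<times> {..<n}"]) (auto simp: inversions_def)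

lemma det_swap_columns:
  fixes M :: "nat \<Rightarrow> nat \<Rightarrow> 'a::comm_ring_1"
  assumes k: "Suc k < n"
  shows "det (mat n n (\<lambda>(i, j). M (Transposition.transpose k (Suc k) j) i)) = - det (mat n n (\<lambda>(i, j). M j i))"
proof -
  let ?p = "Transposition.transpose k (Suc k)"
  have p: "?p permutes {0..<n}" by (rule permutes_swap_id) (use k in auto)
  define A where "A = mat n n (\<lambda>(i, j). M i j)"
  have A: "A \<in> carrier_mat n n" by (simp add: A_def)
  have "mat n n (\<lambda>(i, j). M (?p j) i) = transpose_mat (mat n n (\<lambda>(i, j). A $$ (?p i, j)))"
    by (rule eq_matI) (use permutes_in_image[OF p] in \<open>auto simp: A_def\<close>)
  then have "det (mat n n (\<lambda>(i, j). M (?p j) i)) = det (mat n n (\<lambda>(i, j). A $$ (?p i, j)))"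
    by (simp add: det_transpose[where n = n])
  also have "\<dots> = signof ?p * det A" by (rule det_permute_rows[OF A p])
  also have "signof ?p = (- 1 :: 'a)" by (simp add: sign_swap_id)
  also have "det A = det (transpose_mat A)" by (rule det_transpose[OF A, symmetric])
  also have "transpose_mat A = mat n n (\<lambda>(i, j). M j i)" by (rule eq_matI) (auto simp: A_def)
  finally show ?thesis by simp
qed

text \<open>An adjacent transposition permutes all pairs of positions except the swapped one while
  keeping their order.\<close>

lemma card_inversions_swap:
  assumes k: "Suc k < n" and lt: "F k < F (Suc k)"
  shows "card (inversions n F) = Suc (card (inversions n (F \<circ> Transposition.transpose k (Suc k))))"
proof -
  let ?p = "Transposition.transpose k (Suc k)"
  have mono: "?p a < ?p b \<and> ?p b < n" if "a < b" "b < n" "\<not> (a = k \<and> b = Suc k)" for a b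
    using that k by (auto simp: Transposition.transpose_def)
  have inv: "?p (?p a) = a" for a by simp
  have "bij_betw (\<lambda>(a, b). (?p a, ?p b)) (inversions n F - {(k, Suc k)}) (inversions n (F \<circ> ?p))"
  proof (rule bij_betwI[where g = "\<lambda>(a, b). (?p a, ?p b)"])
    show "(\<lambda>(a, b). (?p a, ?p b)) \<in> inversions n F - {(k, Suc k)} \<rightarrow> inversions n (F \<circ> ?p)"
      using mono by (auto simp: inversions_def)
    show "(\<lambda>(a, b). (?p a, ?p b)) \<in> inversions n (F \<circ> ?p) \<rightarrow> inversions n F - {(k, Suc k)}"
    proof (clarify, intro DiffI)
      fix a b assume "(a, b) \<in> inversions n (F \<circ> ?p)"
      then have ab: "a < b" "b < n" "F (?p a) < F (?p b)" by (auto simp: inversions_def)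
      have ne: "\<not> (a = k \<and> b = Suc k)" using ab(3) lt by auto
      show "(?p a, ?p b) \<in> inversions n F" using mono[OF ab(1,2) ne] ab(3) by (simp add: inversions_def)
      show "(?p a, ?p b) \<notin> {(k, Suc k)}"
      proof
        assume "(?p a, ?p b) \<in> {(k, Suc k)}"
        then have "?p (?p a) = ?p k" "?p (?p b) = ?p (Suc k)" by simp_all
        then have "a = Suc k" "b = k" by simp_all
        then show False using ab(1) by simp
      qed
    qed
  qed auto
  then have "card (inversions n F - {(k, Suc k)}) = card (inversions n (F \<circ> ?p))" by (rule bij_betw_same_card)
  moreover have "(k, Suc k) \<in> inversions n F" using assms by (simp add: inversions_def)
  ultimately show ?thesis using finite_inversions[of n F] by (metis card_Suc_Diff1)
qed

text \<open>Bubble sort: every exchange of adjacent columns removes one inversion and changes the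
  sign of the determinant once.\<close>

lemma det_sort_columns:
  fixes C :: "int \<Rightarrow> nat \<Rightarrow> 'a::comm_ring_1"
  assumes "inj_on F {..<n}"
  shows "det (mat n n (\<lambda>(i, j). C (rev (sorted_list_of_set (F ` {..<n})) ! j) i))
    = (- 1) ^ card (inversions n F) * det (mat n n (\<lambda>(i, j). C (F j) i))"
  using assms
proof (induction "card (inversions n F)" arbitrary: F rule: less_induct)
  case less
  show ?case
  proof (cases "\<exists>k. Suc k < n \<and> F k < F (Suc k)")
    case False
    have dec: "F b < F a" if "a < b" "b < n" for a b
      using that
    proof (induction b rule: less_Suc_induct)
      case (1 a)
      then have "\<not> F a < F (Suc a)" using False by blast
      moreover have "F a \<noteq> F (Suc a)" using inj_onD[OF less.prems, of a "Suc a"] 1 by auto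
      ultimately show ?case by simp
    next
      case (2 a b c)
      then show ?case by (meson less_trans)
    qed
    define xs where "xs = rev (map F [0..<n])"
    have "sorted_wrt (<) xs" unfolding xs_def sorted_wrt_rev sorted_wrt_map using dec by (simp add: sorted_wrt_iff_nth_less)
    then have "sorted_list_of_set (set xs) = xs"
      by (intro sorted_list_of_set.idem_if_sorted_distinct) (auto simp: strict_sorted_iff)
    moreover have "set xs = F ` {..<n}" by (auto simp: xs_def lessThan_atLeast0)
    ultimately have "rev (sorted_list_of_set (F ` {..<n})) = map F [0..<n]" by (simp add: xs_def)
    moreover have "inversions n F = {}" using dec by (force simp: inversions_def)
    ultimately show ?thesis by (auto intro!: arg_cong[where f = det] eq_matI)
  next
    case True
    then obtain k where k: "Suc k < n" "F k < F (Suc k)" by blast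
    let ?p = "Transposition.transpose k (Suc k)"
    have card: "card (inversions n F) = Suc (card (inversions n (F \<circ> ?p)))" by (rule card_inversions_swap[OF k])
    have p: "?p permutes {..<n}" by (rule permutes_swap_id) (use k in auto)
    have "inj_on (F \<circ> ?p) {..<n}"
      by (rule comp_inj_on) (use less.prems permutes_image[OF p] permutes_inj_on[OF p] in auto)
    moreover have "(F \<circ> ?p) ` {..<n} = F ` {..<n}" by (simp only: image_comp[symmetric] permutes_image[OF p])
    ultimately have "det (mat n n (\<lambda>(i, j). C (rev (sorted_list_of_set (F ` {..<n})) ! j) i))
      = (- 1) ^ card (inversions n (F \<circ> ?p)) * det (mat n n (\<lambda>(i, j). C ((F \<circ> ?p) j) i))"
      using less.hyps[of "F \<circ> ?p"] card by simp
    also have "det (mat n n (\<lambda>(i, j). C ((F \<circ> ?p) j) i)) = - det (mat n n (\<lambda>(i, j). C (F j) i))"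
      using det_swap_columns[OF k(1), of "\<lambda>j i. C (F j) i"] by (simp add: o_def)
    finally show ?thesis unfolding card by (simp add: o_def)
  qed
qed

text \<open>\<open>p\<close> is the gap of the column and \<open>q\<close> the bead of the row of a box; for a partition in \<open>DD\<close>, the box
  lies strictly above the diagonal iff \<open>p + q > 0\<close>.\<close>

lemma card_H_small_pos:
  assumes DD: "\<omega> \<in> DD"
  shows "card (H_small_pos g \<omega>) + card (H_small_pos g \<omega> \<inter> diag \<omega>)
    = card {(p, q). p \<notin> beads \<omega> \<and> q \<in> beads \<omega> \<and> p < q \<and> q - p < int g \<and> p + q > 0}
      + 2 * card (H_small_pos g \<omega> \<inter> diag \<omega>)"
proof -
  let ?H = "H_small_pos g \<omega>"
  let ?f = "\<lambda>(i, j). (gap \<omega> j, bead \<omega> i)"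
  have \<omega>: "\<omega> \<in> partitions" using DD by (simp add: DD_def)
  have fin: "finite ?H" by (rule finite_subset[OF _ finite_boxes[of \<omega>]]) (auto simp: H_small_pos_def)
  have "bij_betw ?f (?H - diag \<omega>) {(p, q). p \<notin> beads \<omega> \<and> q \<in> beads \<omega> \<and> p < q \<and> q - p < int g \<and> p + q > 0}"
  proof (rule bij_betw_subset[OF bij_betw_boxes[OF \<omega>]])
    show "?H - diag \<omega> \<subseteq> boxes \<omega>" by (auto simp: H_small_pos_def)
    have mem: "(i, j) \<in> ?H - diag \<omega> \<longleftrightarrow> bead \<omega> i - gap \<omega> j < int g \<and> gap \<omega> j + bead \<omega> i > 0" if b: "(i, j) \<in> boxes \<omega>" for i j
      using hook_eq[OF \<omega> b] DD_box_position[OF DD b] b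
      by (auto simp: H_small_pos_def diag_def eps_def)
    show "?f ` (?H - diag \<omega>) = {(p, q). p \<notin> beads \<omega> \<and> q \<in> beads \<omega> \<and> p < q \<and> q - p < int g \<and> p + q > 0}"
    proof (intro equalityI subsetI)
      fix x assume "x \<in> ?f ` (?H - diag \<omega>)"
      then obtain i j where ij: "(i, j) \<in> ?H - diag \<omega>" "x = (gap \<omega> j, bead \<omega> i)" by auto
      then have b: "(i, j) \<in> boxes \<omega>" by (auto simp: H_small_pos_def)
      then have "x \<in> {(p, q). p \<notin> beads \<omega> \<and> q \<in> beads \<omega> \<and> p < q}"
        using bij_betw_apply[OF bij_betw_boxes[OF \<omega>] b] ij(2) by simp
      then show "x \<in> {(p, q). p \<notin> beads \<omega> \<and> q \<in> beads \<omega> \<and> p < q \<and> q - p < int g \<and> p + q > 0}"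
        using mem[OF b] ij by auto
    next
      fix x assume x: "x \<in> {(p, q). p \<notin> beads \<omega> \<and> q \<in> beads \<omega> \<and> p < q \<and> q - p < int g \<and> p + q > 0}"
      then have "x \<in> {(p, q). p \<notin> beads \<omega> \<and> q \<in> beads \<omega> \<and> p < q}" by auto
      then have "x \<in> ?f ` boxes \<omega>" unfolding bij_betw_imp_surj_on[OF bij_betw_boxes[OF \<omega>]] .
      then obtain i j where ij: "(i, j) \<in> boxes \<omega>" "x = (gap \<omega> j, bead \<omega> i)" by auto
      then have "(i, j) \<in> ?H - diag \<omega>" using mem[OF ij(1)] x by auto
      then show "x \<in> ?f ` (?H - diag \<omega>)" using ij(2) by force
    qed
  qed
  then have "card (?H - diag \<omega>) = card {(p, q). p \<notin> beads \<omega> \<and> q \<in> beads \<omega> \<and> p < q \<and> q - p < int g \<and> p + q > 0}"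
    by (rule bij_betw_same_card)
  \<comment> \<open>Diagonal boxes have \<open>eps\<close> 1, so they are counted in
    \<open>?H\<close> and once more by the extra term of the exponent; they drop out of the
    parity.\<close>
  moreover have "card ?H = card (?H \<inter> diag \<omega>) + card (?H - diag \<omega>)"
    by (subst card_Un_disjoint[symmetric]) (use fin in \<open>auto intro: arg_cong[where f = card]\<close>)
  ultimately show ?thesis by simp
qed

text \<open>For q <= t the bound on q - p is automatic, and what remains is |p| < q. By symmetry
  each absolute value below q belongs to exactly one gap.\<close>

lemma card_gaps_small:
  assumes sym: "symmetric_beads Z" and q: "0 < q" "q \<le> int t"
  shows "card {p. p \<notin> Z \<and> p < q \<and> q - p < int (2 * t + 1) \<and> p + q > 0} = nat q"
proof -
  have "bij_betw (\<lambda>p. \<bar>p\<bar>) {p. p \<notin> Z \<and> p < q \<and> q - p < int (2 * t + 1) \<and> p + q > 0} {0..<q}"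
    unfolding bij_betw_def
  proof
    show "inj_on (\<lambda>p. \<bar>p\<bar>) {p. p \<notin> Z \<and> p < q \<and> q - p < int (2 * t + 1) \<and> p + q > 0}"
    proof (rule inj_onI)
      fix p p' assume h: "p \<in> {p. p \<notin> Z \<and> p < q \<and> q - p < int (2 * t + 1) \<and> p + q > 0}"
        "p' \<in> {p. p \<notin> Z \<and> p < q \<and> q - p < int (2 * t + 1) \<and> p + q > 0}" "\<bar>p\<bar> = \<bar>p'\<bar>"
      then have "p = p' \<or> p = - p'" by linarith
      moreover have "p = - p' \<Longrightarrow> p' = 0" using h sym unfolding symmetric_beads_def by auto
      ultimately show "p = p'" by auto
    qed
    show "(\<lambda>p. \<bar>p\<bar>) ` {p. p \<notin> Z \<and> p < q \<and> q - p < int (2 * t + 1) \<and> p + q > 0} = {0..<q}"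
    proof (intro equalityI subsetI)
      fix m assume m: "m \<in> {0..<q}"
      have "m \<notin> Z \<or> - m \<notin> Z" using sym unfolding symmetric_beads_def by (cases "m = 0") auto
      then have "(m \<notin> Z \<and> m < q \<and> q - m < int (2 * t + 1) \<and> m + q > 0)
        \<or> (- m \<notin> Z \<and> - m < q \<and> q - - m < int (2 * t + 1) \<and> - m + q > 0)" using m q by auto
      then show "m \<in> (\<lambda>p. \<bar>p\<bar>) ` {p. p \<notin> Z \<and> p < q \<and> q - p < int (2 * t + 1) \<and> p + q > 0}"
        using m by (auto simp: image_iff intro: exI[of _ m] exI[of _ "- m"])
    qed auto
  qed
  then show ?thesis using bij_betw_same_card by fastforce
qed

text \<open>For q > t the condition p + q > 0 is automatic. The window between q - g and q meets
  every runner but that of q once, at the last position below q, and this is a gap iff the bound of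
  the runner is below q. On the runner of q itself the bound is above q.\<close>

lemma card_gaps_big:
  assumes q: "q \<in> core_beads t n" "q > int t"
  shows "card {p. p \<notin> core_beads t n \<and> p < q \<and> q - p < int (2 * t + 1) \<and> p + q > 0}
    = card {r. r < 2 * t + 1 \<and> core_beta t n r < q}"
proof -
  let ?g = "int (2 * t + 1)"
  let ?P = "{p. p \<notin> core_beads t n \<and> p < q \<and> q - p < ?g \<and> p + q > 0}"
  let ?R = "{r. r < 2 * t + 1 \<and> core_beta t n r < q}"
  have "bij_betw (\<lambda>p. nat (p mod ?g)) ?P ?R"
    unfolding bij_betw_def
  proof
    show "inj_on (\<lambda>p. nat (p mod ?g)) ?P"
    proof (rule inj_onI)
      fix p p' assume h: "p \<in> ?P" "p' \<in> ?P" "nat (p mod ?g) = nat (p' mod ?g)"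
      have "p mod ?g \<ge> 0" "p' mod ?g \<ge> 0" by (rule pos_mod_sign, simp)+
      then have "p mod ?g = p' mod ?g" using h(3) by (simp only: eq_nat_nat_iff)
      then have "?g dvd p - p'" by (simp only: mod_eq_dvd_iff)
      moreover have "\<bar>p - p'\<bar> < ?g" using h by auto
      ultimately have "p - p' = 0" using dvd_imp_le_int[of "p - p'" ?g] by fastforce
      then show "p = p'" by simp
    qed
    show "(\<lambda>p. nat (p mod ?g)) ` ?P = ?R"
    proof (intro equalityI subsetI)
      fix r assume "r \<in> (\<lambda>p. nat (p mod ?g)) ` ?P"
      then obtain p where p: "p \<in> ?P" "r = nat (p mod ?g)" by blast
      then have "core_beta t n r \<le> p" by (simp add: core_beads_def)
      moreover have "r < 2 * t + 1" using p(2) pos_mod_bound[of ?g p] pos_mod_sign[of ?g p] by linarith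
      ultimately show "r \<in> ?R" using p by auto
    next
      fix r assume r: "r \<in> ?R"
      \<comment> \<open>The last position below q on runner r.\<close>
      define p where "p = q - 1 - (q - 1 - int r) mod ?g"
      define m where "m = (q - 1 - int r) div ?g"
      have "p = int r + ((q - 1 - int r) - (q - 1 - int r) mod ?g)" by (simp add: p_def)
      then have m: "p = int r + ?g * m" unfolding m_def minus_mod_eq_mult_div .
      have pm: "nat (p mod ?g) = r" unfolding m by (rule residue_eq) (use r in simp)
      have bounds: "q - ?g \<le> p" "p < q"
      proof -
        have "(q - 1 - int r) mod ?g < ?g" by (rule pos_mod_bound) simp
        moreover have "0 \<le> (q - 1 - int r) mod ?g" by (rule pos_mod_sign) simp
        ultimately show "q - ?g \<le> p" "p < q" unfolding p_def by linarith+
      qed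
      obtain m' where m': "core_beta t n r = int r + ?g * m'" using core_beta_eq[of r t n] r by blast
      have "m' \<le> m"
      proof (rule ccontr)
        assume "\<not> m' \<le> m"
        then have "?g * (m + 1) \<le> ?g * m'" by (intro mult_left_mono) auto
        then have "p + ?g \<le> core_beta t n r" unfolding m m' by (simp add: algebra_simps)
        then show False using r bounds by simp
      qed
      then have "?g * m' \<le> ?g * m" by (intro mult_left_mono) auto
      then have "core_beta t n r \<le> p" unfolding m m' by simp
      then have notin: "p \<notin> core_beads t n" unfolding core_beads_def mem_Collect_eq pm by simp
      \<comment> \<open>Otherwise r would be the runner of q, whose bound exceeds q because q is a
        bead.\<close>
      have "p \<noteq> q - ?g"
      proof
        assume "p = q - ?g"
        then have "nat (q mod ?g) = r" using pm by (simp add: mod_diff_right_eq)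
        then show False using q(1) r by (simp add: core_beads_def)
      qed
      then have "p \<in> ?P" using notin bounds q(2) by auto
      then show "r \<in> (\<lambda>p. nat (p mod ?g)) ` ?P" using pm by force
    qed
  qed
  then show ?thesis by (rule bij_betw_same_card)
qed

text \<open>The numbers 0 and 2t + 1 - \<open>big_beta\<close> are at most t and always count, which
  gives t + 1; the others are the numbers \<open>big_beta\<close>.\<close>

lemma card_core_beta_less:
  assumes q: "q > int t"
  shows "card {r. r < 2 * t + 1 \<and> core_beta t n r < q} = t + 1 + card {b \<in> {1..t}. big_beta t n b < q}"
proof -
  let ?s = "\<lambda>i. 2 * t + 1 - big_res t n i"
  define A where "A = ?s ` {1..t}"
  define B where "B = big_res t n ` {b \<in> {1..t}. big_beta t n b < q}"
  have inj: "inj_on (big_res t n) {1..t}" by (auto simp: inj_on_def big_res_eq_iff)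
  have injs: "inj_on ?s {1..t}"
  proof (rule inj_onI)
    fix i j assume ij: "i \<in> {1..t}" "j \<in> {1..t}" "?s i = ?s j"
    then have "big_res t n i = big_res t n j" using big_res_bounds[OF ij(1), of n] big_res_bounds[OF ij(2), of n] by linarith
    then show "i = j" using big_res_eq_iff[OF ij(1,2)] by simp
  qed
  have ne: "?s i \<noteq> big_res t n j" if "i \<in> {1..t}" "j \<in> {1..t}" for i j
  proof
    assume eq: "?s i = big_res t n j"
    have "big_res t n i = i \<or> big_res t n i = 2 * t + 1 - i" "big_res t n j = j \<or> big_res t n j = 2 * t + 1 - j"
      by (auto simp: big_res_def)
    moreover have "1 \<le> i" "i \<le> t" "1 \<le> j" "j \<le> t" using that by auto
    ultimately have "i = j" using eq by arith
    then have "2 * big_res t n i = 2 * t + 1" using eq big_res_bounds[OF that(1), of n] by arith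
    then show False by presburger
  qed
  have small: "core_beta t n (?s i) < q" if i: "i \<in> {1..t}" for i
  proof -
    have "core_beta t n (?s i) = int (2 * t + 1) - big_beta t n i"
      using core_beta_reflect[of "big_res t n i" t n] big_res_bounds[OF i, of n] core_beta_big_res[OF i, of n] by simp
    then show ?thesis using big_beta_gt[OF i, of n] q by simp
  qed
  have cover: "r \<in> {0} \<union> (?s ` {1..t} \<union> big_res t n ` {1..t})" if "r < 2 * t + 1" for r
  proof (cases "r = 0")
    case False
    define i where "i = (if r \<le> t then r else 2 * t + 1 - r)"
    have i: "i \<in> {1..t}" using False that by (auto simp: i_def)
    have "r = big_res t n i \<or> r = ?s i" using that by (auto simp: i_def big_res_def)
    then show ?thesis using i by blast
  qed simp
  have "{r. r < 2 * t + 1 \<and> core_beta t n r < q} = {0} \<union> (?s ` {1..t} \<union> big_res t n ` {b \<in> {1..t}. big_beta t n b < q})"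
  proof (intro equalityI subsetI)
    fix r assume r: "r \<in> {r. r < 2 * t + 1 \<and> core_beta t n r < q}"
    then show "r \<in> {0} \<union> (?s ` {1..t} \<union> big_res t n ` {b \<in> {1..t}. big_beta t n b < q})"
      using cover[of r] core_beta_big_res[of _ t n] by auto
  next
    fix r assume "r \<in> {0} \<union> (?s ` {1..t} \<union> big_res t n ` {b \<in> {1..t}. big_beta t n b < q})"
    then consider "r = 0" | i where "i \<in> {1..t}" "r = ?s i" | i where "i \<in> {1..t}" "big_beta t n i < q" "r = big_res t n i" by blast
    then show "r \<in> {r. r < 2 * t + 1 \<and> core_beta t n r < q}"
    proof cases
      case 1
      then show ?thesis using q by (simp add: core_beta_def)
    next
      case 2
      then show ?thesis using small[OF 2(1)] big_res_bounds[OF 2(1), of n] by simp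
    next
      case 3
      then show ?thesis using core_beta_big_res[OF 3(1), of n] big_res_bounds[OF 3(1), of n] by simp
    qed
  qed
  then have "card {r. r < 2 * t + 1 \<and> core_beta t n r < q} = card ({0} \<union> (A \<union> B))" by (simp only: A_def B_def)
  moreover have "card ({0} \<union> (A \<union> B)) = card {0 :: nat} + card (A \<union> B)"
  proof (rule card_Un_disjoint)
    have "0 \<notin> A" "0 \<notin> B" using big_res_bounds[of _ t n] by (fastforce simp: A_def B_def)+
    then show "{0} \<inter> (A \<union> B) = {}" by blast
  qed (auto simp: A_def B_def)
  moreover have "card (A \<union> B) = card A + card B"
  proof (rule card_Un_disjoint)
    show "A \<inter> B = {}" using ne by (auto simp: A_def B_def)
  qed (auto simp: A_def B_def)
  moreover have "card A = t" unfolding A_def card_image[OF injs] by simp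
  moreover have "card B = card {b \<in> {1..t}. big_beta t n b < q}"
    unfolding B_def by (rule card_image) (rule inj_on_subset[OF inj], auto)
  ultimately show ?thesis by simp
qed

text \<open>The pairs are counted by their positive bead q. If q > t, there are t + 1 gaps plus one
  for each \<open>big_beta\<close> below q. The positive beads up to t are the lowest ones of the
  runners i with n i >= 1; such a bead i has only i gaps, and the deficit t + 1 - i is added on the
  left.\<close>

lemma card_above_diagonal:
  "card {(p, q). p \<notin> core_beads t n \<and> q \<in> core_beads t n \<and> p < q \<and> q - p < int (2 * t + 1) \<and> p + q > 0}
     + (\<Sum>i | i \<in> {1..t} \<and> n i \<ge> 1. t + 1 - i)
   = (t + 1) * (\<Sum>i=1..t. big_quot n i)
     + (\<Sum>i=1..t. \<Sum>b=1..t. card {k. k < big_quot n i \<and> big_beta t n b < int (big_res t n i) + int (2 * t + 1) * int k})"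
proof -
  let ?g = "int (2 * t + 1)" and ?Z = "core_beads t n"
  let ?pos = "{q \<in> ?Z. q > 0}"
  define f where "f q = card {p. p \<notin> ?Z \<and> p < q \<and> q - p < ?g \<and> p + q > 0}" for q
  define c where "c q = card {b \<in> {1..t}. big_beta t n b < q}" for q
  have sym: "symmetric_beads ?Z" by (rule symmetric_core_beads)
  have finpos: "finite ?pos" using bij_betw_finite[OF bij_betw_pos_beads[of t n]] by auto
  define W where "W q = {p. p \<notin> ?Z \<and> p < q \<and> q - p < ?g \<and> p + q > 0}" for q
  have finW: "finite (W q)" for q by (rule finite_subset[of _ "{- q..q}"]) (auto simp: W_def)
  have "{(p, q). p \<notin> ?Z \<and> q \<in> ?Z \<and> p < q \<and> q - p < ?g \<and> p + q > 0} = prod.swap ` (SIGMA q:?pos. W q)"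
    unfolding W_def by force
  then have "card {(p, q). p \<notin> ?Z \<and> q \<in> ?Z \<and> p < q \<and> q - p < ?g \<and> p + q > 0} = card (SIGMA q:?pos. W q)"
    by (simp only: card_image[OF inj_on_subset[OF inj_swap subset_UNIV]])
  also have "\<dots> = (\<Sum>q\<in>?pos. card (W q))" by (rule card_SigmaI[OF finpos]) (simp add: finW)
  also have "\<dots> = (\<Sum>q\<in>?pos. f q)" by (simp only: f_def W_def)
  also have "\<dots> = (\<Sum>(i, k)\<in>(SIGMA i:{1..t}. {..<big_quot n i}). f (int (big_res t n i) + ?g * int k))"
    using sum.reindex_bij_betw[OF bij_betw_pos_beads[of t n], of f] by (simp add: case_prod_unfold)
  also have "\<dots> = (\<Sum>i=1..t. \<Sum>k<big_quot n i. f (int (big_res t n i) + ?g * int k))"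
    by (rule sum.Sigma[symmetric]) auto
  finally have N: "card {(p, q). p \<notin> ?Z \<and> q \<in> ?Z \<and> p < q \<and> q - p < ?g \<and> p + q > 0}
    = (\<Sum>i=1..t. \<Sum>k<big_quot n i. f (int (big_res t n i) + ?g * int k))" .
  have fbig: "f q = t + 1 + c q" if "q \<in> ?Z" "q > int t" for q
    unfolding f_def c_def using card_gaps_big[OF that] card_core_beta_less[OF that(2)] by simp
  have fsmall: "f q = nat q" if "0 < q" "q \<le> int t" for q
    unfolding f_def using card_gaps_small[OF sym that] .
  have csmall: "c q = 0" if "q \<le> int t" for q
  proof -
    have "{b \<in> {1..t}. big_beta t n b < q} = {}" using big_beta_gt[of _ t n] that by force
    then show ?thesis unfolding c_def by simp
  qed
  have inZ: "int (big_res t n i) + ?g * int k \<in> ?Z" if "i \<in> {1..t}" "k < big_quot n i" for i k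
    using bij_betw_apply[OF bij_betw_pos_beads[of t n], of "(i, k)"] that by simp
  have row: "(\<Sum>k<big_quot n i. f (int (big_res t n i) + ?g * int k)) + (if n i \<ge> 1 then t + 1 - i else 0)
    = (t + 1) * big_quot n i + (\<Sum>k<big_quot n i. c (int (big_res t n i) + ?g * int k))" if i: "i \<in> {1..t}" for i
  proof (cases "n i \<ge> 1")
    case False
    have "f (int (big_res t n i) + ?g * int k) = t + 1 + c (int (big_res t n i) + ?g * int k)" if k: "k < big_quot n i" for k
    proof (rule fbig[OF inZ[OF i k]])
      have "?g * int k \<ge> 0" by simp
      moreover have "int (big_res t n i) > int t" using False i by (simp add: big_res_def)
      ultimately show "int t < int (big_res t n i) + ?g * int k" by linarith
    qed
    then have e: "(\<Sum>k<big_quot n i. f (int (big_res t n i) + ?g * int k))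
        = (\<Sum>k<big_quot n i. t + 1 + c (int (big_res t n i) + ?g * int k))" by (intro sum.cong) auto
    show ?thesis unfolding e sum.distrib using False by (simp add: algebra_simps)
  next
    case True
    \<comment> \<open>The lowest bead, k = 0, is the small one at i; the beads with k >= 1 lie
      beyond t.\<close>
    then obtain m where m: "big_quot n i = Suc m" by (cases "big_quot n i") (auto simp: big_quot_def)
    have res: "big_res t n i = i" using True by (simp add: big_res_def)
    have "f (int i + ?g * int (Suc k)) = t + 1 + c (int i + ?g * int (Suc k))" if k: "k < m" for k
    proof (rule fbig)
      show "int i + ?g * int (Suc k) \<in> ?Z" using inZ[OF i, of "Suc k"] k m res by simp
      define P where "P = ?g * int (Suc k)"
      have "P \<ge> ?g * 1" unfolding P_def by (intro mult_left_mono) auto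
      then show "int t < int i + ?g * int (Suc k)" unfolding P_def[symmetric] by simp
    qed
    then have tail: "(\<Sum>k<m. f (int i + ?g * int (Suc k))) = (\<Sum>k<m. t + 1 + c (int i + ?g * int (Suc k)))"
      by (intro sum.cong) auto
    have "f (int i + ?g * int 0) = i" "c (int i + ?g * int 0) = 0" using fsmall[of "int i"] csmall[of "int i"] i by auto
    then show ?thesis
      unfolding m res sum.lessThan_Suc_shift o_def tail sum.distrib using True i by (simp add: algebra_simps)
  qed
  have swap: "(\<Sum>k<m. c (int r + ?g * int k)) = (\<Sum>b=1..t. card {k. k < m \<and> big_beta t n b < int r + ?g * int k})" for m r
  proof -
    have "(\<Sum>k<m. c (int r + ?g * int k)) = (\<Sum>k<m. \<Sum>b=1..t. of_bool (big_beta t n b < int r + ?g * int k))"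
      unfolding c_def by (simp add: Int_def Collect_conj_eq[symmetric])
    also have "\<dots> = (\<Sum>b=1..t. \<Sum>k<m. of_bool (big_beta t n b < int r + ?g * int k))" by (rule sum.swap)
    also have "\<dots> = (\<Sum>b=1..t. card {k. k < m \<and> big_beta t n b < int r + ?g * int k})"
      by (simp add: Int_def)
    finally show ?thesis .
  qed
  have "(\<Sum>i | i \<in> {1..t} \<and> n i \<ge> 1. t + 1 - i) = (\<Sum>i=1..t. if n i \<ge> 1 then t + 1 - i else 0)"
    by (rule sum.inter_filter) simp
  then have "card {(p, q). p \<notin> ?Z \<and> q \<in> ?Z \<and> p < q \<and> q - p < ?g \<and> p + q > 0} + (\<Sum>i | i \<in> {1..t} \<and> n i \<ge> 1. t + 1 - i)
    = (\<Sum>i=1..t. (\<Sum>k<big_quot n i. f (int (big_res t n i) + ?g * int k)) + (if n i \<ge> 1 then t + 1 - i else 0))"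
    unfolding N by (simp only: sum.distrib)
  also have "\<dots> = (\<Sum>i=1..t. (t + 1) * big_quot n i + (\<Sum>k<big_quot n i. c (int (big_res t n i) + ?g * int k)))"
    by (rule sum.cong[OF refl]) (rule row)
  also have "\<dots> = (t + 1) * (\<Sum>i=1..t. big_quot n i) + (\<Sum>i=1..t. \<Sum>k<big_quot n i. c (int (big_res t n i) + ?g * int k))"
    by (simp only: sum.distrib sum_distrib_left)
  finally show ?thesis unfolding swap .
qed

lemma sum_square_pairs:
  fixes f :: "nat \<Rightarrow> nat \<Rightarrow> 'b::comm_monoid_add"
  assumes "\<And>i. f i i = 0"
  shows "(\<Sum>i=1..t. \<Sum>b=1..t. f i b) = (\<Sum>(i, b)\<in>pairs t. f i b + f b i)"
proof -
  have "(\<Sum>i=1..t. \<Sum>b=1..t. f i b) = (\<Sum>(i, b)\<in>{1..t} \<times> {1..t}. f i b)" by (rule sum.cartesian_product)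
  also have "\<dots> = (\<Sum>(i, b)\<in>pairs t \<union> prod.swap ` pairs t. f i b)"
  proof (rule sum.mono_neutral_right)
    show "\<forall>i\<in>{1..t} \<times> {1..t} - (pairs t \<union> prod.swap ` pairs t). (case i of (i, b) \<Rightarrow> f i b) = 0"
    proof
      fix x assume x: "x \<in> {1..t} \<times> {1..t} - (pairs t \<union> prod.swap ` pairs t)"
      obtain i b where ib: "x = (i, b)" by (cases x)
      have "\<not> i < b" "\<not> b < i" using x unfolding ib by (auto simp: pairs_def image_iff)
      then have "i = b" by simp
      then show "(case x of (i, b) \<Rightarrow> f i b) = 0" using assms by (simp add: ib)
    qed
  qed (auto simp: pairs_def)
  also have "\<dots> = (\<Sum>(i, b)\<in>pairs t. f i b) + (\<Sum>(i, b)\<in>prod.swap ` pairs t. f i b)"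
  proof (rule sum.union_disjoint)
    show "pairs t \<inter> prod.swap ` pairs t = {}" by (auto simp: pairs_def)
  qed simp_all
  also have "(\<Sum>(i, b)\<in>prod.swap ` pairs t. f i b) = (\<Sum>(i, b)\<in>pairs t. f b i)"
    by (subst sum.reindex) (auto simp: case_prod_unfold)
  finally show ?thesis by (simp add: sum.distrib case_prod_unfold)
qed

lemma sum_pairs_fst: "(\<Sum>(i, b)\<in>pairs t. f i) = (\<Sum>i=1..t. (t - i) * (f i :: nat))"
proof -
  have "pairs t = (SIGMA i:{1..t}. {i<..t})" by (auto simp: pairs_def)
  then have "(\<Sum>(i, b)\<in>pairs t. f i) = (\<Sum>(i, b)\<in>(SIGMA i:{1..t}. {i<..t}). f i)" by simp
  also have "\<dots> = (\<Sum>i=1..t. \<Sum>b\<in>{i<..t}. f i)" by (rule sum.Sigma[symmetric]) auto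
  finally show ?thesis by simp
qed

lemma sum_pairs_snd: "(\<Sum>(i, b)\<in>pairs t. f b) = (\<Sum>b=1..t. (b - 1) * (f b :: nat))"
proof -
  have "pairs t = prod.swap ` (SIGMA b:{1..t}. {1..<b})" by (auto simp: pairs_def image_iff)
  then have "(\<Sum>(i, b)\<in>pairs t. f b) = (\<Sum>(b, i)\<in>(SIGMA b:{1..t}. {1..<b}). f b)"
    by (simp add: sum.reindex case_prod_unfold)
  also have "\<dots> = (\<Sum>b=1..t. \<Sum>i\<in>{1..<b}. f b)" by (rule sum.Sigma[symmetric]) auto
  finally show ?thesis by simp
qed

text \<open>Write m for \<open>big_quot\<close> and r for \<open>big_res\<close>. Height k on the
  runner of i lies above \<open>big_beta t n b\<close> iff k >= m_b + [r_i < r_b]. In the opposite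
  direction nothing is counted, because all beads of b lie below its own bound.\<close>

lemma card_multiples_above:
  assumes i: "i \<in> {1..t}" and b: "b \<in> {1..t}" and lt: "big_beta t n b < big_beta t n i"
  shows "card {k. k < big_quot n i \<and> big_beta t n b < int (big_res t n i) + int (2 * t + 1) * int k}
      + (big_quot n b + of_bool (big_res t n i < big_res t n b)) = big_quot n i"
    and "card {k. k < big_quot n b \<and> big_beta t n i < int (big_res t n b) + int (2 * t + 1) * int k} = 0"
proof -
  let ?g = "int (2 * t + 1)"
  define e where "e = (of_bool (big_res t n i < big_res t n b) :: nat)"
  have "i \<noteq> b" using lt by auto
  then have ne: "big_res t n i \<noteq> big_res t n b" using big_res_eq_iff[OF i b] by simp
  have r: "int (big_res t n i) < ?g" "int (big_res t n b) < ?g" "0 \<le> int (big_res t n i)" "0 \<le> int (big_res t n b)"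
    using big_res_bounds[OF i, of n] big_res_bounds[OF b, of n] by auto
  have iff: "big_beta t n b < int (big_res t n i) + ?g * int k \<longleftrightarrow> big_quot n b + e \<le> k" for k
  proof (cases k "big_quot n b" rule: linorder_cases)
    case less
    then have "?g * (int k + 1) \<le> ?g * int (big_quot n b)" by (intro mult_left_mono) auto
    then have "?g * int k + ?g \<le> ?g * int (big_quot n b)" by (simp only: distrib_left mult_1_right)
    then have "\<not> big_beta t n b < int (big_res t n i) + ?g * int k"
      unfolding big_beta_def using r(1,4) by linarith
    then show ?thesis using less by simp
  next
    case equal
    then show ?thesis using ne by (auto simp: big_beta_def e_def)
  next
    case greater
    then have "?g * (int (big_quot n b) + 1) \<le> ?g * int k" by (intro mult_left_mono) auto
    then have "?g * int (big_quot n b) + ?g \<le> ?g * int k" by (simp only: distrib_left mult_1_right)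
    then have "big_beta t n b < int (big_res t n i) + ?g * int k"
      unfolding big_beta_def using r(2,3) by linarith
    then show ?thesis using greater by (simp add: e_def)
  qed
  have "big_quot n b + e \<le> big_quot n i" using lt iff[of "big_quot n i"] by (simp only: big_beta_def[of t n i])
  moreover have "{k. k < big_quot n i \<and> big_beta t n b < int (big_res t n i) + ?g * int k} = {big_quot n b + e..<big_quot n i}"
    unfolding iff by auto
  ultimately show "card {k. k < big_quot n i \<and> big_beta t n b < int (big_res t n i) + ?g * int k}
      + (big_quot n b + of_bool (big_res t n i < big_res t n b)) = big_quot n i"
    by (simp add: e_def)
  have "\<not> big_beta t n i < int (big_res t n b) + ?g * int k" if k: "k < big_quot n b" for k
  proof -
    have "?g * int k \<le> ?g * int (big_quot n b)" using k by (intro mult_left_mono) auto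
    then have "int (big_res t n b) + ?g * int k \<le> big_beta t n b" unfolding big_beta_def[of t n b] by linarith
    then show ?thesis using lt by linarith
  qed
  then show "card {k. k < big_quot n b \<and> big_beta t n i < int (big_res t n b) + ?g * int k} = 0" by auto
qed

text \<open>Let \<open>N\<close> count the pairs above the diagonal, \<open>M\<close> the positive
  beads, \<open>J\<close> the inversions, and \<open>P\<close> the indices with n i >= 1.
  \<open>card_above_diagonal\<close> reads N + Y + P = (t + 1) M + C. By
  \<open>card_multiples_above\<close> every pair of indices contributes an even number to C + (t -
  1) M + J + Y. Adding both leaves N + J + P even.\<close>

theorem sign_core_of:
  assumes t: "t \<ge> 1"
  shows "even (card (H_small_pos (2 * t + 1) (core_of t n)) + card (H_small_pos (2 * t + 1) (core_of t n) \<inter> diag (core_of t n))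
    + card (inversions t (\<lambda>j. big_beta t n (j + 1))) + card {i \<in> {1..t}. n i \<ge> 1})"
proof -
  let ?g = "int (2 * t + 1)"
  let ?c = "\<lambda>i b. card {k. k < big_quot n i \<and> big_beta t n b < int (big_res t n i) + ?g * int k}"
  let ?m = "big_quot n"
  define N where "N = card {(p, q). p \<notin> core_beads t n \<and> q \<in> core_beads t n \<and> p < q \<and> q - p < ?g \<and> p + q > 0}"
  define M where "M = (\<Sum>i=1..t. ?m i)"
  define J where "J = card (inversions t (\<lambda>j. big_beta t n (j + 1)))"
  define P where "P = card {i \<in> {1..t}. n i \<ge> 1}"
  define Y where "Y = (\<Sum>i | i \<in> {1..t} \<and> n i \<ge> 1. t - i)"
  define C where "C = (\<Sum>i=1..t. \<Sum>b=1..t. ?c i b)"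
  have E1: "N + (Y + P) = (t + 1) * M + C"
  proof -
    have "(\<Sum>i | i \<in> {1..t} \<and> n i \<ge> 1. t + 1 - i) = (\<Sum>i | i \<in> {1..t} \<and> n i \<ge> 1. (t - i) + 1)"
      by (rule sum.cong) auto
    also have "\<dots> = Y + P" unfolding sum.distrib by (simp add: Y_def P_def)
    finally show ?thesis using card_above_diagonal[of t n] by (simp only: N_def M_def C_def)
  qed
  have E2: "even (C + (t - 1) * M + J + Y)"
  proof -
    have c0: "?c i i = 0" for i
    proof -
      have "\<not> big_beta t n i < int (big_res t n i) + ?g * int k" if "k < ?m i" for k
      proof -
        have "?g * int k \<le> ?g * int (?m i)" using that by (intro mult_left_mono) auto
        then show ?thesis unfolding big_beta_def by linarith
      qed
      then show ?thesis by auto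
    qed
    have C: "C = (\<Sum>(i, b)\<in>pairs t. ?c i b + ?c b i)" unfolding C_def by (rule sum_square_pairs) (rule c0)
    have M: "(t - 1) * M = (\<Sum>(i, b)\<in>pairs t. ?m i + ?m b)"
    proof -
      have "(\<Sum>(i, b)\<in>pairs t. ?m i + ?m b) = (\<Sum>(i, b)\<in>pairs t. ?m i) + (\<Sum>(i, b)\<in>pairs t. ?m b)"
        by (simp add: sum.distrib case_prod_unfold)
      also have "\<dots> = (\<Sum>i=1..t. (t - i) * ?m i + (i - 1) * ?m i)"
        unfolding sum_pairs_fst sum_pairs_snd by (simp only: sum.distrib)
      also have "\<dots> = (\<Sum>i=1..t. (t - 1) * ?m i)"
        by (rule sum.cong) (auto simp: add_mult_distrib[symmetric])
      finally show ?thesis by (simp only: M_def sum_distrib_left)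
    qed
    have J: "J = (\<Sum>(i, b)\<in>pairs t. of_bool (big_beta t n i < big_beta t n b))"
    proof -
      have "bij_betw (\<lambda>(a, b). (a + 1, b + 1)) (inversions t (\<lambda>j. big_beta t n (j + 1))) {(i, b). (i, b) \<in> pairs t \<and> big_beta t n i < big_beta t n b}"
        by (rule bij_betwI[where g = "\<lambda>(a, b). (a - 1, b - 1)"]) (auto simp: inversions_def pairs_def)
      then have "J = card {(i, b). (i, b) \<in> pairs t \<and> big_beta t n i < big_beta t n b}"
        unfolding J_def by (rule bij_betw_same_card)
      also have "{(i, b). (i, b) \<in> pairs t \<and> big_beta t n i < big_beta t n b} = pairs t \<inter> {p. big_beta t n (fst p) < big_beta t n (snd p)}"
        by auto
      finally show ?thesis by (simp add: case_prod_unfold)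
    qed
    have Y: "Y = (\<Sum>(i, b)\<in>pairs t. of_bool (n i \<ge> 1))"
    proof -
      have "Y = (\<Sum>i=1..t. if n i \<ge> 1 then t - i else 0)" unfolding Y_def by (rule sum.inter_filter) simp
      also have "\<dots> = (\<Sum>i=1..t. (t - i) * of_bool (n i \<ge> 1))" by (rule sum.cong) auto
      finally show ?thesis by (simp only: sum_pairs_fst)
    qed
    have "even (?c i b + ?c b i + (?m i + ?m b) + of_bool (big_beta t n i < big_beta t n b) + of_bool (n i \<ge> 1))"
      if ib: "(i, b) \<in> pairs t" for i b
    proof -
      have i: "i \<in> {1..t}" and b: "b \<in> {1..t}" and "i < b" using ib by (auto simp: pairs_def)
      \<comment> \<open>For i < b both b and 2t + 1 - b lie between i and 2t + 1 - i, so the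
        comparison depends on the sign of \<open>n i\<close> only.\<close>
      have res: "big_res t n i < big_res t n b \<longleftrightarrow> n i \<ge> 1" "big_res t n b < big_res t n i \<longleftrightarrow> \<not> n i \<ge> 1"
        using i b \<open>i < b\<close> by (auto simp: big_res_def)
      have "big_beta t n i \<noteq> big_beta t n b" using big_beta_eq_iff[OF i b] \<open>i < b\<close> by simp
      then consider "big_beta t n b < big_beta t n i" | "big_beta t n i < big_beta t n b" by linarith
      then show ?thesis
      proof cases
        case 1
        note c = card_multiples_above[OF i b 1]
        have z: "of_bool (big_beta t n i < big_beta t n b) = (0 :: nat)" using 1 by simp
        have arith: "u + w + (mi + mb) + o2 + o1 = 2 * mi" if "u + (mb + o1) = mi" "w = 0" "o2 = 0" for u w mi mb o1 o2 :: nat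
          using that by simp
        have eq: "?c i b + ?c b i + (?m i + ?m b) + of_bool (big_beta t n i < big_beta t n b) + of_bool (n i \<ge> 1) = 2 * ?m i"
          by (rule arith[OF c[unfolded res] z])
        show ?thesis unfolding eq by simp
      next
        case 2
        note c = card_multiples_above[OF b i 2]
        have z: "of_bool (big_beta t n i < big_beta t n b) = (1 :: nat)" using 2 by simp
        have o: "of_bool (\<not> n i \<ge> 1) + of_bool (n i \<ge> 1) = (1 :: nat)" by simp
        have arith: "u + w + (mi + mb) + o2 + o1 = 2 * (mb + o1)"
          if "w + (mi + o3) = mb" "u = 0" "o2 = 1" "o3 + o1 = 1" for u w mi mb o1 o2 o3 :: nat
          using that by simp
        have eq: "?c i b + ?c b i + (?m i + ?m b) + of_bool (big_beta t n i < big_beta t n b) + of_bool (n i \<ge> 1)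
          = 2 * (?m b + of_bool (n i \<ge> 1))"
          by (rule arith[OF c[unfolded res] z o])
        show ?thesis unfolding eq by simp
      qed
    qed
    then have "even (\<Sum>(i, b)\<in>pairs t. ?c i b + ?c b i + (?m i + ?m b) + of_bool (big_beta t n i < big_beta t n b) + of_bool (n i \<ge> 1))"
      by (intro dvd_sum) auto
    also have "(\<Sum>(i, b)\<in>pairs t. ?c i b + ?c b i + (?m i + ?m b) + of_bool (big_beta t n i < big_beta t n b) + of_bool (n i \<ge> 1))
      = C + (t - 1) * M + J + Y"
      unfolding C M J Y by (simp only: sum.distrib case_prod_unfold)
    finally show ?thesis .
  qed
  have e: "even (N + J + P)"
  proof -
    obtain u where u: "t = Suc u" using t by (cases t) auto
    have "N + Y + P = u * M + M + M + C" using E1 by (simp add: u algebra_simps)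
    moreover have "even (C + u * M + J + Y)" using E2 by (simp add: u)
    ultimately show ?thesis by presburger
  qed
  have h: "card (H_small_pos (2 * t + 1) (core_of t n)) + card (H_small_pos (2 * t + 1) (core_of t n) \<inter> diag (core_of t n))
    = N + 2 * card (H_small_pos (2 * t + 1) (core_of t n) \<inter> diag (core_of t n))"
    using card_H_small_pos[OF core_of_DD[of t n], of "2 * t + 1"] unfolding beads_core_of N_def .
  show ?thesis unfolding h J_def[symmetric] P_def[symmetric] using e by simp
qed

section \<open>The sum side\<close>

text \<open>A kernel vector yields a polynomial \<open>R\<close> of degree at most 2t - 1,
  antisymmetric under reversal of its coefficients, that vanishes at all x_i and hence at all 1/x_i.
  These are 2t distinct points, so \<open>R\<close> is 0.\<close>

lemma theta_const_nonzero:
  fixes x :: "nat \<Rightarrow> 'a::field"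
  assumes x: "\<And>i. i \<in> {1..t} \<Longrightarrow> x i \<noteq> 0" "\<And>i j. i \<in> {1..t} \<Longrightarrow> j \<in> {1..t} \<Longrightarrow> i \<noteq> j \<Longrightarrow> x i \<noteq> x j"
    "\<And>i j. i \<in> {1..t} \<Longrightarrow> j \<in> {1..t} \<Longrightarrow> x i * x j \<noteq> 1"
  shows "theta_const t x \<noteq> 0"
proof
  assume zero: "theta_const t x = 0"
  define A where "A = mat t t (\<lambda>(i, j). x (i + 1) powi (int j + 1 - int t) - x (i + 1) powi (int t - int j))"
  have "A \<in> carrier_mat t t" by (simp add: A_def)
  then obtain v where v: "v \<in> carrier_vec t" "v \<noteq> 0\<^sub>v t" "A *\<^sub>v v = 0\<^sub>v t"
    using zero det_0_iff_vec_prod_zero_field[of A t] unfolding theta_const_def A_def[symmetric] by blast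
  define c where "c j = vec_index v j" for j
  have row: "(\<Sum>j<t. (x (i + 1) powi (int j + 1 - int t) - x (i + 1) powi (int t - int j)) * c j) = 0" if i: "i < t" for i
  proof -
    have "vec_index (A *\<^sub>v v) i = (\<Sum>j<t. (x (i + 1) powi (int j + 1 - int t) - x (i + 1) powi (int t - int j)) * c j)"
      using i v(1) by (simp add: A_def scalar_prod_def lessThan_atLeast0 c_def)
    then show ?thesis using i v(3) by simp
  qed
  define R where "R = (\<Sum>j<t. Polynomial.smult (c j) (Polynomial.monom 1 j - Polynomial.monom 1 (2 * t - 1 - j)))"
  have polyR: "poly R y = (\<Sum>j<t. c j * (y ^ j - y ^ (2 * t - 1 - j)))" for y
    by (simp add: R_def poly_sum poly_monom)
  have root1: "poly R (x i) = 0" if i: "i \<in> {1..t}" for i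
  proof -
    have nz: "x i \<noteq> 0" using x(1) i by blast
    have "poly R (x i) = (\<Sum>j<t. x i powi (int t - 1) * ((x i powi (int j + 1 - int t) - x i powi (int t - int j)) * c j))"
      unfolding polyR
    proof (rule sum.cong[OF refl])
      fix j assume "j \<in> {..<t}"
      then have j: "j < t" by simp
      have "x i ^ j = x i powi (int t - 1 + (int j + 1 - int t))" by simp
      moreover have "int t - 1 + (int t - int j) = int (2 * t - 1 - j)" using j by (simp add: of_nat_diff)
      then have "x i ^ (2 * t - 1 - j) = x i powi (int t - 1 + (int t - int j))" by (simp only: power_int_of_nat)
      ultimately show "c j * (x i ^ j - x i ^ (2 * t - 1 - j))
        = x i powi (int t - 1) * ((x i powi (int j + 1 - int t) - x i powi (int t - int j)) * c j)"
        using nz by (simp only: power_int_add[OF disjI1[OF nz]]) (simp add: algebra_simps)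
    qed
    also have "\<dots> = 0"
    proof -
      have i': "i - 1 < t" "i - 1 + 1 = i" using i by auto
      show ?thesis unfolding sum_distrib_left[symmetric] using row[OF i'(1)] unfolding i'(2) by simp
    qed
    finally show ?thesis .
  qed
  have root2: "poly R (inverse (x i)) = 0" if i: "i \<in> {1..t}" for i
  proof -
    have nz: "x i \<noteq> 0" using x(1) i by blast
    have "x i ^ (2 * t - 1) * poly R (inverse (x i)) = (\<Sum>j<t. - (c j * (x i ^ j - x i ^ (2 * t - 1 - j))))"
      unfolding polyR sum_distrib_left
    proof (rule sum.cong[OF refl])
      fix j assume "j \<in> {..<t}"
      then have "x i ^ (2 * t - 1) = x i ^ j * x i ^ (2 * t - 1 - j)" by (simp flip: power_add)
      then show "x i ^ (2 * t - 1) * (c j * (inverse (x i) ^ j - inverse (x i) ^ (2 * t - 1 - j)))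
        = - (c j * (x i ^ j - x i ^ (2 * t - 1 - j)))"
        using nz by (simp add: field_simps)
    qed
    also have "\<dots> = - poly R (x i)" unfolding polyR sum_negf ..
    finally show ?thesis using nz root1[OF i] by simp
  qed
  define P where "P = x ` {1..t} \<union> (\<lambda>i. inverse (x i)) ` {1..t}"
  have "card P = t + t"
  proof -
    have "inj_on x {1..t}" by (rule inj_onI) (use x(2) in blast)
    moreover have "inj_on (\<lambda>i. inverse (x i)) {1..t}"
      by (rule inj_onI) (metis inverse_inverse_eq x(2))
    moreover have "x ` {1..t} \<inter> (\<lambda>i. inverse (x i)) ` {1..t} = {}"
    proof -
      have "x i \<noteq> inverse (x j)" if "i \<in> {1..t}" "j \<in> {1..t}" for i j
        using x(1)[OF that(2)] x(3)[OF that] by (metis left_inverse)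
      then show ?thesis by auto
    qed
    ultimately show ?thesis unfolding P_def by (subst card_Un_disjoint) (simp_all add: card_image)
  qed
  have deg: "Polynomial.degree R \<le> 2 * t - 1" unfolding R_def
  proof (rule degree_sum_le)
    fix j assume "j \<in> {..<t}"
    then show "Polynomial.degree (Polynomial.smult (c j) (Polynomial.monom 1 j - Polynomial.monom 1 (2 * t - 1 - j))) \<le> 2 * t - 1"
      by (intro order_trans[OF degree_smult_le] degree_diff_le order_trans[OF degree_monom_le]) auto
  qed simp
  have "t > 0" using v(1,2) by (cases t) auto
  have "R = 0"
  proof (rule poly_eqI_degree[of P])
    show "poly R y = poly 0 y" if "y \<in> P" for y using that root1 root2 by (auto simp: P_def)
    show "Polynomial.degree R < card P" using deg \<open>t > 0\<close> unfolding \<open>card P = t + t\<close> by linarith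
    show "Polynomial.degree (0 :: 'a poly) < card P" using \<open>t > 0\<close> unfolding \<open>card P = t + t\<close> by simp
  qed
  have "c j = 0" if j: "j < t" for j
  proof -
    \<comment> \<open>The mirrored exponents 2t - 1 - l are at least t, so below t the coefficients
      of \<open>R\<close> are those of the vector.\<close>
    have "poly.coeff R j = (\<Sum>l<t. if l = j then c l else 0)"
      unfolding R_def coeff_sum by (rule sum.cong) (use j in auto)
    then show ?thesis using \<open>R = 0\<close> j by simp
  qed
  then have "v = 0\<^sub>v t" using v(1) by (intro eq_vecI) (auto simp: c_def)
  then show False using v(2) by contradiction
qed

text \<open>The column of the character numerator for \<mu>_j = v + j - g: the exponents become v -
  t and 1 - (v - t). They no longer depend on j, so the columns can be permuted.\<close>

definition core_column :: "nat \<Rightarrow> (nat \<Rightarrow> 'a::field) \<Rightarrow> int \<Rightarrow> nat \<Rightarrow> 'a" where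
  "core_column t x v i = x (i + 1) powi (v - int t) - x (i + 1) powi (1 - (v - int t))"

definition core_det :: "nat \<Rightarrow> (nat \<Rightarrow> 'a::field) \<Rightarrow> (nat \<Rightarrow> int) \<Rightarrow> 'a" where
  "core_det t x n = det (mat t t (\<lambda>(i, j). core_column t x (core_beta t n (j + 1)) i))"

lemma core_column_reflect: "core_column t x (int (2 * t + 1) - v) i = - core_column t x v i"
proof -
  have e: "int (2 * t + 1) - v - int t = 1 - (v - int t)" "1 - (1 - (v - int t)) = v - int t" by simp_all
  show ?thesis unfolding core_column_def e by (simp only: minus_diff_eq)
qed

lemma so_det_0: "so_det t x (\<lambda>_. 0) = (- 1) ^ t * theta_const t x"
proof -
  have "so_det t x (\<lambda>_. 0) = det (mat t t (\<lambda>(i, j). (- 1) * (x (i + 1) powi (int j + 1 - int t) - x (i + 1) powi (int t - int j))))"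
    unfolding so_det_def by (intro arg_cong[where f = det] eq_matI) (auto simp: algebra_simps)
  also have "\<dots> = (\<Prod>j<t. - 1) * theta_const t x"
    unfolding theta_const_def by (rule det_scale_columns)
  finally show ?thesis by simp
qed

text \<open>Sorting produces the sign of the inversions. Replacing the larger number of a pair by
  that of runner i negates the column when n i < 1, by \<open>core_column_reflect\<close>; the
  number of these indices has the parity of t plus the number of the others.\<close>

lemma so_det_mu:
  "so_det t x (mu (2 * t + 1) t (core_of t n))
    = (- 1) ^ card (inversions t (\<lambda>j. big_beta t n (j + 1))) * (- 1) ^ (t + card {i \<in> {1..t}. n i \<ge> 1}) * core_det t x n"
proof -
  let ?V = "rev (sorted_list_of_set (big_beta t n ` {1..t}))"
  let ?F = "\<lambda>j. big_beta t n (j + 1)"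
  have img: "big_beta t n ` {1..t} = ?F ` {..<t}"
  proof -
    have "{1..t} = (\<lambda>j. j + 1) ` {..<t}" using image_Suc_lessThan[of t] by simp
    then show ?thesis by (simp only: image_image)
  qed
  have "so_det t x (mu (2 * t + 1) t (core_of t n)) = det (mat t t (\<lambda>(i, j). core_column t x (?V ! j) i))"
    unfolding so_det_def mu_def V_coding_core_of core_column_def
    by (intro arg_cong[where f = det] eq_matI) (auto simp: algebra_simps)
  also have "\<dots> = (- 1) ^ card (inversions t ?F) * det (mat t t (\<lambda>(i, j). core_column t x (?F j) i))"
    unfolding img by (rule det_sort_columns) (auto simp: inj_on_def big_beta_eq_iff)
  also have "mat t t (\<lambda>(i, j). core_column t x (?F j) i)
    = mat t t (\<lambda>(i, j). (if n (j + 1) \<ge> 1 then 1 else - 1) * core_column t x (core_beta t n (j + 1)) i)"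
  proof (rule eq_matI)
    fix i j assume "i < dim_row (mat t t (\<lambda>(i, j). (if n (j + 1) \<ge> 1 then 1 else - 1) * core_column t x (core_beta t n (j + 1)) i))"
      "j < dim_col (mat t t (\<lambda>(i, j). (if n (j + 1) \<ge> 1 then 1 else - 1) * core_column t x (core_beta t n (j + 1)) i))"
    then have ij: "i < t" "j < t" by auto
    then have j: "j + 1 \<in> {1..t}" by auto
    have "core_column t x (?F j) i = (if n (j + 1) \<ge> 1 then 1 else - 1) * core_column t x (core_beta t n (j + 1)) i"
      unfolding core_beta_small(1)[OF j] by (simp add: core_column_reflect[simplified])
    then show "mat t t (\<lambda>(i, j). core_column t x (?F j) i) $$ (i, j)
      = mat t t (\<lambda>(i, j). (if n (j + 1) \<ge> 1 then 1 else - 1) * core_column t x (core_beta t n (j + 1)) i) $$ (i, j)"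
      using ij by simp
  qed auto
  also have "det \<dots> = (\<Prod>j<t. if n (j + 1) \<ge> 1 then 1 else - 1) * core_det t x n"
    unfolding core_det_def by (rule det_scale_columns)
  also have "(\<Prod>j<t. if n (j + 1) \<ge> 1 then 1 else - 1) = ((- 1) ^ (t + card {i \<in> {1..t}. n i \<ge> 1}) :: 'a)"
  proof -
    have "(\<Prod>j<t. if n (j + 1) \<ge> 1 then 1 else - 1) = (\<Prod>i=1..t. if n i \<ge> 1 then 1 else - 1 :: 'a)"
      by (rule prod.reindex_bij_witness[where i = "\<lambda>i. i - 1" and j = Suc]) auto
    also have "\<dots> = (\<Prod>i=1..t. (- 1) * (if n i \<ge> 1 then - 1 else 1))" by (rule prod.cong) auto
    also have "\<dots> = (- 1) ^ t * (\<Prod>i=1..t. if n i \<ge> 1 then - 1 else 1)" by (simp only: prod.distrib prod_constant card_atLeastAtMost diff_Suc_1)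
    also have "(\<Prod>i=1..t. if n i \<ge> 1 then - 1 else 1 :: 'a) = (- 1) ^ card {i \<in> {1..t}. n i \<ge> 1}"
      by (subst prod.inter_filter[symmetric]) simp_all
    finally show ?thesis by (simp add: power_add)
  qed
  finally show ?thesis by (simp only: mult.assoc)
qed

text \<open>Replacing m by - m in the second series gives both series the same exponent of T; the
  difference of the powers of y is then an entry of \<open>core_column\<close> for v = j + g
  m.\<close>

lemma theta_entry_has_sum:
  fixes y :: "'a::field"
  assumes j: "j \<in> {1..t}"
  shows "((\<lambda>m. fps_X ^ qexp j (2 * t + 1 - j) m *
      fps_const (y powi (int j + int (2 * t + 1) * m - int t) - y powi (1 - (int j + int (2 * t + 1) * m - int t))))
    has_sum (Phi t j y - Phi t (2 * t + 1 - j) y)) UNIV"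
proof -
  let ?g = "2 * t + 1"
  have 1: "((\<lambda>m. fps_X ^ qexp j (?g - j) m * fps_const (y powi (int j - int t + m * int ?g))) has_sum Phi t j y) UNIV"
    by (rule Phi_has_sum) (use j in simp)
  have "((\<lambda>m. (\<lambda>m. fps_X ^ qexp (?g - j) (?g - (?g - j)) m * fps_const (y powi (int (?g - j) - int t + m * int ?g))) (- m))
    has_sum Phi t (?g - j) y) UNIV \<longleftrightarrow>
    ((\<lambda>m. fps_X ^ qexp (?g - j) (?g - (?g - j)) m * fps_const (y powi (int (?g - j) - int t + m * int ?g))) has_sum Phi t (?g - j) y) UNIV"
    by (rule has_sum_reindex_bij_betw) (rule bij_betwI[where g = uminus], auto)
  moreover have "((\<lambda>m. fps_X ^ qexp (?g - j) (?g - (?g - j)) m * fps_const (y powi (int (?g - j) - int t + m * int ?g))) has_sum Phi t (?g - j) y) UNIV"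
    by (rule Phi_has_sum) simp
  ultimately have 2: "((\<lambda>m. fps_X ^ qexp (?g - j) (?g - (?g - j)) (- m) * fps_const (y powi (int (?g - j) - int t + - m * int ?g)))
    has_sum Phi t (?g - j) y) UNIV" by simp
  have "((\<lambda>m. fps_X ^ qexp j (?g - j) m * fps_const (y powi (int j - int t + m * int ?g))
      + - (fps_X ^ qexp (?g - j) (?g - (?g - j)) (- m) * fps_const (y powi (int (?g - j) - int t + - m * int ?g))))
    has_sum (Phi t j y + - Phi t (?g - j) y)) UNIV"
    by (intro has_sum_add 1 has_sum_uminusI 2)
  also have "(\<lambda>m. fps_X ^ qexp j (?g - j) m * fps_const (y powi (int j - int t + m * int ?g))
      + - (fps_X ^ qexp (?g - j) (?g - (?g - j)) (- m) * fps_const (y powi (int (?g - j) - int t + - m * int ?g))))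
    = (\<lambda>m. fps_X ^ qexp j (?g - j) m *
      fps_const (y powi (int j + int ?g * m - int t) - y powi (1 - (int j + int ?g * m - int t))))"
  proof
    fix m
    have e1: "?g - (?g - j) = j" using j by auto
    have e2: "int (?g - j) - int t + - m * int ?g = 1 - (int j + int ?g * m - int t)"
      using j by (simp add: of_nat_diff algebra_simps)
    have e3: "int j - int t + m * int ?g = int j + int ?g * m - int t" by (simp add: algebra_simps)
    show "fps_X ^ qexp j (?g - j) m * fps_const (y powi (int j - int t + m * int ?g))
      + - (fps_X ^ qexp (?g - j) (?g - (?g - j)) (- m) * fps_const (y powi (int (?g - j) - int t + - m * int ?g)))
      = fps_X ^ qexp j (?g - j) m *
      fps_const (y powi (int j + int ?g * m - int t) - y powi (1 - (int j + int ?g * m - int t)))"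
      unfolding e1 e2 e3 qexp_uminus fps_const_sub[symmetric] right_diff_distrib by (simp only: diff_conv_add_uminus)
  qed
  finally show ?thesis by simp
qed

text \<open>In the Leibniz formula every product over the columns is expanded by
  \<open>has_sum_fps_PiE\<close>. The exponent of T depends on the integer vector but not on the
  permutation, so for each vector the permutations recombine to a determinant.\<close>

lemma theta_det_has_sum:
  fixes x :: "nat \<Rightarrow> 'a::field"
  shows "((\<lambda>n. fps_X ^ (\<Sum>i=1..t. qexp i (2 * t + 1 - i) (n i)) * fps_const (core_det t x n)) has_sum theta_det t x)
    ({1..t} \<rightarrow>\<^sub>E UNIV)"
proof -
  let ?g = "2 * t + 1"
  define a where "a i j m = x (i + 1) powi (int j + int ?g * m - int t) - x (i + 1) powi (1 - (int j + int ?g * m - int t))"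
    for i j m
  define f where "f p n = (\<Prod>j\<in>{1..t}. fps_X ^ qexp j (?g - j) (n j) * fps_const (a (p (j - 1)) j (n j)))" for p :: "nat \<Rightarrow> nat" and n
  have "((\<lambda>n. signof p * f p n) has_sum (signof p * (\<Prod>j<t. theta_mat t x $$ (p j, j)))) ({1..t} \<rightarrow>\<^sub>E UNIV)"
    if "p \<in> {p. p permutes {0..<t}}" for p
  proof (rule has_sum_cmult_right)
    have p: "p permutes {0..<t}" using that by simp
    have pj: "p j < t" if "j < t" for j using permutes_in_image[OF p, of j] that by simp
    have "(f p has_sum (\<Prod>j\<in>{1..t}. Phi t j (x (p (j - 1) + 1)) - Phi t (?g - j) (x (p (j - 1) + 1)))) ({1..t} \<rightarrow>\<^sub>E UNIV)"
      unfolding f_def[abs_def] a_def by (intro has_sum_fps_PiE theta_entry_has_sum) auto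
    also have "(\<Prod>j\<in>{1..t}. Phi t j (x (p (j - 1) + 1)) - Phi t (?g - j) (x (p (j - 1) + 1))) = (\<Prod>j<t. theta_mat t x $$ (p j, j))"
      by (rule prod.reindex_bij_witness[where i = Suc and j = "\<lambda>j. j - 1"])
         (auto simp: theta_mat_def pj)
    finally show "(f p has_sum (\<Prod>j<t. theta_mat t x $$ (p j, j))) ({1..t} \<rightarrow>\<^sub>E UNIV)" .
  qed
  then have "((\<lambda>n. \<Sum>p | p permutes {0..<t}. signof p * f p n) has_sum
      (\<Sum>p | p permutes {0..<t}. signof p * (\<Prod>j<t. theta_mat t x $$ (p j, j)))) ({1..t} \<rightarrow>\<^sub>E UNIV)"
    by (intro has_sum_fps_sum) (auto intro: finite_permutations)
  also have "(\<Sum>p | p permutes {0..<t}. signof p * (\<Prod>j<t. theta_mat t x $$ (p j, j))) = theta_det t x"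
    unfolding theta_det_def by (rule det_col[symmetric]) (simp add: theta_mat_def)
  also have "(\<lambda>n. \<Sum>p | p permutes {0..<t}. signof p * f p n)
    = (\<lambda>n. fps_X ^ (\<Sum>i=1..t. qexp i (?g - i) (n i)) * fps_const (core_det t x n))"
  proof
    fix n
    have f: "f p n = fps_X ^ (\<Sum>i=1..t. qexp i (?g - i) (n i)) * fps_const (\<Prod>j<t. a (p j) (j + 1) (n (j + 1)))" for p
    proof -
      have "f p n = fps_X ^ (\<Sum>i=1..t. qexp i (?g - i) (n i)) * fps_const (\<Prod>j\<in>{1..t}. a (p (j - 1)) j (n j))"
        unfolding f_def prod.distrib fps_const_prod power_sum ..
      also have "(\<Prod>j\<in>{1..t}. a (p (j - 1)) j (n j)) = (\<Prod>j<t. a (p j) (j + 1) (n (j + 1)))"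
        by (rule prod.reindex_bij_witness[where i = Suc and j = "\<lambda>j. j - 1"]) auto
      finally show ?thesis .
    qed
    have col: "core_column t x (core_beta t n (j + 1)) i = a i (j + 1) (n (j + 1))" if "j < t" for i j
      using that by (simp add: core_column_def a_def core_beta_def)
    have "core_det t x n = (\<Sum>p | p permutes {0..<t}. signof p * (\<Prod>j<t. a (p j) (j + 1) (n (j + 1))))"
    proof -
      have "core_det t x n = (\<Sum>p | p permutes {0..<t}. signof p *
          (\<Prod>j<t. mat t t (\<lambda>(i, j). core_column t x (core_beta t n (j + 1)) i) $$ (p j, j)))"
        unfolding core_det_def by (rule det_col) simp
      also have "\<dots> = (\<Sum>p | p permutes {0..<t}. signof p * (\<Prod>j<t. a (p j) (j + 1) (n (j + 1))))"
      proof (intro sum.cong refl arg_cong2[where f = times] prod.cong)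
        fix p j assume p: "p \<in> {p. p permutes {0..<t}}" and j: "j \<in> {..<t}"
        have "p j < t" using permutes_in_image[of p "{0..<t}" j] p j by auto
        then show "mat t t (\<lambda>(i, j). core_column t x (core_beta t n (j + 1)) i) $$ (p j, j) = a (p j) (j + 1) (n (j + 1))"
          using j col by simp
      qed
      finally show ?thesis .
    qed
    then have "fps_const (core_det t x n) = (\<Sum>p | p permutes {0..<t}. signof p * fps_const (\<Prod>j<t. a (p j) (j + 1) (n (j + 1))))"
      by (simp only: fps_const_hom.hom_sum fps_const_hom.hom_mult fps_const_hom.hom_signof)
    then show "(\<Sum>p | p permutes {0..<t}. signof p * f p n)
      = fps_X ^ (\<Sum>i=1..t. qexp i (?g - i) (n i)) * fps_const (core_det t x n)"
      unfolding f by (simp only: sum_distrib_left mult.left_commute)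
  qed
  finally show ?thesis .
qed

context root_of_unity
begin

text \<open>The sign of a core, of the sorting and of the exchanged runners multiply to (-1)^t by
  \<open>sign_core_of\<close>, and this cancels the sign in \<open>so_det_0\<close>.\<close>

theorem character_sum:
  fixes x :: "nat \<Rightarrow> 'a"
  assumes t: "t \<ge> 1"
    and x: "\<And>i. i \<in> {1..t} \<Longrightarrow> x i \<noteq> 0 \<and> x i ^ g \<noteq> 1"
    "\<And>i j. i \<in> {1..t} \<Longrightarrow> j \<in> {1..t} \<Longrightarrow> i \<noteq> j \<Longrightarrow> x i \<noteq> x j"
    "\<And>i j. i \<in> {1..t} \<Longrightarrow> j \<in> {1..t} \<Longrightarrow> x i * x j \<noteq> 1"
  shows "((\<lambda>\<omega>. (- 1) ^ (card (H_small_pos g \<omega>) + card (H_small_pos g \<omega> \<inter> diag \<omega>))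
              * fps_X ^ (sum_list \<omega> div 2) * fps_const (so_char t x (mu g t \<omega>)))
        has_sum macdonald_prod t x) (DD_cores g)"
proof -
  define F where "F \<omega> = (- 1) ^ (card (H_small_pos g \<omega>) + card (H_small_pos g \<omega> \<inter> diag \<omega>))
              * fps_X ^ (sum_list \<omega> div 2) * fps_const (so_char t x (mu g t \<omega>))" for \<omega>
  have nz: "theta_const t x \<noteq> 0" by (rule theta_const_nonzero) (use x in auto)
  have M: "theta_det t x = fps_const (theta_const t x) * macdonald_prod t x"
    by (rule macdonald_identity[OF t]) (use x in auto)
  have "((\<lambda>n. fps_const (inverse (theta_const t x)) *
      (fps_X ^ (\<Sum>i=1..t. qexp i (g - i) (n i)) * fps_const (core_det t x n)))
      has_sum fps_const (inverse (theta_const t x)) * theta_det t x) ({1..t} \<rightarrow>\<^sub>E UNIV)"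
    by (intro has_sum_cmult_right theta_det_has_sum)
  also have "fps_const (inverse (theta_const t x)) * theta_det t x = macdonald_prod t x"
    unfolding M using nz by (simp flip: mult.assoc)
  also have "(\<lambda>n. fps_const (inverse (theta_const t x)) *
      (fps_X ^ (\<Sum>i=1..t. qexp i (g - i) (n i)) * fps_const (core_det t x n)))
    = (\<lambda>n. F (core_of t n))"
  proof
    fix n
    let ?\<omega> = "core_of t n"
    define N where "N = card (H_small_pos g ?\<omega>) + card (H_small_pos g ?\<omega> \<inter> diag ?\<omega>)"
    define J where "J = card (inversions t (\<lambda>j. big_beta t n (j + 1)))"
    define P where "P = card {i \<in> {1..t}. n i \<ge> 1}"
    have "even (N + J + P)" unfolding N_def J_def P_def by (rule sign_core_of[OF t])
    then have sgn: "(- 1 :: 'a) ^ N * ((- 1) ^ J * (- 1) ^ (t + P)) = (- 1) ^ t"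
    proof -
      have "(- 1 :: 'a) ^ N * ((- 1) ^ J * (- 1) ^ (t + P)) = (- 1) ^ (N + J + P) * (- 1) ^ t"
        by (simp only: power_add mult_ac)
      then show ?thesis using \<open>even (N + J + P)\<close> by simp
    qed
    have "(- 1) ^ N * so_char t x (mu g t ?\<omega>) = ((- 1) ^ N * ((- 1) ^ J * (- 1) ^ (t + P))) * core_det t x n / ((- 1) ^ t * theta_const t x)"
      unfolding so_char_def so_det_0 so_det_mu J_def[symmetric] P_def[symmetric] by simp
    also have "\<dots> = inverse (theta_const t x) * core_det t x n" unfolding sgn using nz by (simp add: field_simps)
    finally have c: "(- 1) ^ N * so_char t x (mu g t ?\<omega>) = inverse (theta_const t x) * core_det t x n" .
    have "(- 1 :: 'a fps) ^ N = fps_const ((- 1) ^ N)" by (simp flip: fps_const_power fps_const_neg)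
    then have "(- 1) ^ N * fps_X ^ (sum_list ?\<omega> div 2) * fps_const (so_char t x (mu g t ?\<omega>))
      = fps_X ^ (sum_list ?\<omega> div 2) * fps_const ((- 1) ^ N * so_char t x (mu g t ?\<omega>))"
      by (simp only: fps_const_mult[symmetric] mult_ac)
    also have "\<dots> = fps_const (inverse (theta_const t x)) *
      (fps_X ^ (\<Sum>i=1..t. qexp i (g - i) (n i)) * fps_const (core_det t x n))"
      unfolding c fps_const_mult[symmetric] sum_list_core_of by (simp add: mult.left_commute)
    finally show "fps_const (inverse (theta_const t x)) *
      (fps_X ^ (\<Sum>i=1..t. qexp i (g - i) (n i)) * fps_const (core_det t x n))
      = F (core_of t n)"
      by (simp only: F_def N_def)
  qed
  finally have "(F has_sum macdonald_prod t x) (DD_cores g)"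
    by (simp only: has_sum_reindex_bij_betw[OF bij_betw_core_of])
  then show ?thesis by (simp only: F_def[abs_def])
qed

end

section \<open>Independent variables\<close>

text \<open>Characteristic 0 is what the count of roots of unity in the algebraic closure
  uses.\<close>

instance fract :: ("{idom, ring_char_0}") field_char_0
  by standard (auto simp: inj_on_def of_nat_fract eq_fract)

lemma indet_power: "indet i ^ n = to_fract (Poly_Mapping.single (Poly_Mapping.single i (int n)) 1)"
proof (induction n)
  case 0
  then show ?case by simp
next
  case (Suc n)
  have "indet i ^ Suc n = to_fract (Poly_Mapping.single (Poly_Mapping.single i 1) 1 *
      Poly_Mapping.single (Poly_Mapping.single i (int n)) 1)"
    unfolding power_Suc Suc.IH by (simp add: indet_def)
  also have "\<dots> = to_fract (Poly_Mapping.single (Poly_Mapping.single i (int (Suc n))) 1)"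
    by (simp add: mult_single flip: single_add)
  finally show ?case .
qed

lemma single_one_eq_iff:
  "Poly_Mapping.single a (1 :: 'b::zero_neq_one) = Poly_Mapping.single b 1 \<longleftrightarrow> a = b"
  by (metis lookup_single_eq lookup_single_not_eq zero_neq_one)

lemma indet_nonzero: "indet i \<noteq> 0"
  by (simp add: indet_def)

lemma single_one_neq_one:
  assumes "a \<noteq> 0"
  shows "to_fract (Poly_Mapping.single (a :: nat \<Rightarrow>\<^sub>0 int) (1 :: int)) \<noteq> 1"
proof
  assume "to_fract (Poly_Mapping.single a (1 :: int)) = 1"
  then have "Poly_Mapping.single a (1 :: int) = Poly_Mapping.single 0 1"
    by (metis single_one to_fract_1 to_fract_eq_iff)
  then have "a = 0" by (rule single_one_eq_iff[THEN iffD1])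
  then show False using assms by contradiction
qed

lemma indet_power_neq_one: "n > 0 \<Longrightarrow> indet i ^ n \<noteq> 1"
  unfolding indet_power
  by (rule single_one_neq_one) (metis lookup_single_eq lookup_zero of_nat_0_eq_iff less_irrefl)

lemma indet_eq_iff: "indet i = indet j \<longleftrightarrow> i = j"
  unfolding indet_def to_fract_eq_iff single_one_eq_iff ..

lemma indet_mult_neq_one: "indet i * indet j \<noteq> 1"
proof -
  have "Poly_Mapping.lookup (Poly_Mapping.single i (1 :: int) + Poly_Mapping.single j 1) i \<noteq> 0"
    by (simp add: lookup_add lookup_single when_def)
  then have "Poly_Mapping.single i (1 :: int) + Poly_Mapping.single j 1 \<noteq> 0"
    by (metis lookup_zero)
  moreover have "indet i * indet j =
      to_fract (Poly_Mapping.single (Poly_Mapping.single i 1 + Poly_Mapping.single j 1) 1)"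
    by (simp add: indet_def mult_single flip: to_fract_mult)
  ultimately show ?thesis using single_one_neq_one by metis
qed

section \<open>Extension of scalars\<close>

definition fps_ac :: "'a::field fps \<Rightarrow> 'a alg_closure fps" where
  "fps_ac f = Abs_fps (\<lambda>n. to_ac (f $ n))"

lemma fps_ac_nth [simp]: "fps_ac f $ n = to_ac (f $ n)"
  by (simp add: fps_ac_def)

interpretation to_ac_hom: comm_ring_hom "to_ac :: 'a::field \<Rightarrow> 'a alg_closure"
  by unfold_locales simp_all

interpretation fps_ac_hom: comm_ring_hom "fps_ac :: 'a::field fps \<Rightarrow> 'a alg_closure fps"
  by unfold_locales (auto simp: fps_eq_iff fps_mult_nth to_ac_sum)

lemma fps_ac_X [simp]: "fps_ac fps_X = fps_X"
  by (simp add: fps_eq_iff fps_X_def)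

lemma fps_ac_const [simp]: "fps_ac (fps_const c) = fps_const (to_ac c)"
  by (simp add: fps_eq_iff)

lemma fps_ac_qpoch:
  assumes "q $ 0 = 0"
  shows "fps_ac (qpoch_inf a q) = qpoch_inf (fps_ac a) (fps_ac q)"
proof (rule LIMSEQ_unique)
  show "(\<lambda>M. \<Prod>j<M. 1 - fps_ac a * fps_ac q ^ j) \<longlonglongrightarrow> qpoch_inf (fps_ac a) (fps_ac q)"
    by (rule qpoch_tendsto) (simp add: assms)
  have "(\<Prod>j<M. 1 - fps_ac a * fps_ac q ^ j) = fps_ac (\<Prod>j<M. 1 - a * q ^ j)" for M
    by (simp add: fps_ac_hom.hom_prod fps_ac_hom.hom_power fps_ac_hom.hom_minus fps_ac_hom.hom_mult)
  moreover have "(\<lambda>M. fps_ac (\<Prod>j<M. 1 - a * q ^ j)) \<longlonglongrightarrow> fps_ac (qpoch_inf a q)"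
    using qpoch_tendsto[OF assms, of a] unfolding tendsto_fps_iff
    by (auto elim!: eventually_mono)
  ultimately show "(\<lambda>M. \<Prod>j<M. 1 - fps_ac a * fps_ac q ^ j) \<longlonglongrightarrow> fps_ac (qpoch_inf a q)"
    by simp
qed

lemma fps_ac_macdonald_prod: "fps_ac (macdonald_prod t x) = macdonald_prod t (\<lambda>i. to_ac (x i))"
  by (simp add: macdonald_prod_def K_prod_def fps_ac_hom.hom_mult fps_ac_hom.hom_power
      fps_ac_hom.hom_prod fps_ac_qpoch case_prod_unfold)

lemma to_ac_powi: "to_ac (a powi n) = to_ac a powi n"
  by (simp add: power_int_def)

lemma so_char_to_ac: "so_char t (\<lambda>i. to_ac (x i)) m = to_ac (so_char t x m)"
proof -
  have "so_det t (\<lambda>i. to_ac (x i)) m = to_ac (so_det t x m)" for m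
    unfolding so_det_def to_ac_hom.hom_det[symmetric]
    by (rule arg_cong[of _ _ Determinant.det], rule eq_matI) (simp_all add: to_ac_powi)
  then show ?thesis by (simp add: so_char_def)
qed

text \<open>For power series \<open>has_sum\<close> is a finite condition on each coefficient, and
  the injective inclusion of the scalars reflects it.\<close>

lemma has_sum_of_fps_ac:
  assumes "((\<lambda>i. fps_ac (f i)) has_sum fps_ac S) A"
  shows "(f has_sum S) A"
proof (rule has_sum_fpsI)
  fix n
  note D = has_sum_fpsD[OF assms, of n, simplified]
  show "finite {i \<in> A. f i $ n \<noteq> 0}" by (rule D(1))
  have "to_ac (S $ n) = to_ac (\<Sum>i | i \<in> A \<and> f i $ n \<noteq> 0. f i $ n)"
    unfolding to_ac_sum by (rule D(2))
  then show "S $ n = (\<Sum>i | i \<in> A \<and> f i $ n \<noteq> 0. f i $ n)" by simp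
qed

section \<open>The shapes of the characters\<close>

text \<open>Entry k and the ones after it are distinct integers above c, and entry k is the largest
  of them.\<close>

lemma strict_dec_list_ge:
  fixes xs :: "int list"
  assumes "sorted_wrt (>) xs" "\<And>x. x \<in> set xs \<Longrightarrow> x > c" "k < length xs"
  shows "xs ! k \<ge> c + int (length xs - k)"
  using assms
proof (induction xs arbitrary: k)
  case (Cons a xs)
  show ?case
  proof (cases k)
    case 0
    have "a > c + int (length xs)"
    proof (cases xs)
      case Nil
      then show ?thesis using Cons.prems(2) by simp
    next
      case (Cons b ys)
      then have "b \<ge> c + int (length xs)" using Cons.IH[of 0] Cons.prems by simp
      moreover have "a > b" using Cons Cons.prems by simp
      ultimately show ?thesis by simp
    qed
    then show ?thesis using 0 by simp
  next
    case (Suc m)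
    then show ?thesis using Cons.IH[of m] Cons.prems by simp
  qed
qed simp

text \<open>The coding is a strictly decreasing list of t integers above t, so v_i >= t + (t - i +
  1) = g - i.\<close>

lemma
  shows mu_core_of_nonneg: "i \<in> {1..t} \<Longrightarrow> mu (2 * t + 1) t (core_of t n) i \<ge> 0"
    and mu_core_of_antimono: "i \<in> {1..<t} \<Longrightarrow> mu (2 * t + 1) t (core_of t n) i \<ge> mu (2 * t + 1) t (core_of t n) (i + 1)"
proof -
  define v where "v = V_coding (2 * t + 1) t (core_of t n)"
  have card: "card (big_beta t n ` {1..t}) = t"
    by (subst card_image) (auto intro!: inj_onI simp: big_beta_eq_iff)
  have v: "v = rev (sorted_list_of_set (big_beta t n ` {1..t}))"
    unfolding v_def by (rule V_coding_core_of)
  have len: "length v = t" unfolding v using card by simp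
  have dec: "sorted_wrt (>) v"
    unfolding v sorted_wrt_rev by simp
  have gt: "y > int t" if "y \<in> set v" for y
    using that unfolding v by (auto simp: big_beta_gt)
  show "mu (2 * t + 1) t (core_of t n) i \<ge> 0" if "i \<in> {1..t}"
    unfolding mu_def v_def[symmetric]
  proof -
    have "v ! (i - 1) \<ge> int t + int (length v - (i - 1))"
      by (rule strict_dec_list_ge[OF dec gt]) (use that len in auto)
    then show "v ! (i - 1) + int i - int (2 * t + 1) \<ge> 0" using that unfolding len by auto
  qed
  show "mu (2 * t + 1) t (core_of t n) i \<ge> mu (2 * t + 1) t (core_of t n) (i + 1)" if "i \<in> {1..<t}"
  proof -
    have "v ! (i - 1) > v ! i"
      using sorted_wrt_nth_less[OF dec, of "i - 1" i] that len by simp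
    then show ?thesis unfolding mu_def v_def[symmetric] by simp
  qed
qed

lemma even_sum_list_core_of: "even (sum_list (core_of t n))"
  unfolding sum_list_core_of by simp

text \<open>The first part of the conclusion certifies that halving \<open>sum_list \<omega>\<close>
  is exact and that the values of \<open>mu\<close> form a partition, so that exponents and
  characters in the sum have their intended meaning.\<close>

theorem theorem5p11:
  fixes t g :: nat
  assumes "t \<ge> 1" and "g = 2 * t + 1"
  shows "(\<forall>\<omega> \<in> DD_cores g. even (sum_list \<omega>)
            \<and> (\<forall>i \<in> {1..t}. mu g t \<omega> i \<ge> 0)
            \<and> (\<forall>i \<in> {1..<t}. mu g t \<omega> i \<ge> mu g t \<omega> (i + 1)))
    \<and> ((\<lambda>\<omega>. (- 1) ^ (card (H_small_pos g \<omega>) + card (H_small_pos g \<omega> \<inter> diag \<omega>))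
              * fps_X ^ (sum_list \<omega> div 2) * fps_const (so_char t indet (mu g t \<omega>)))
        has_sum
          (qpoch_inf fps_X fps_X ^ t * K_prod t indet
           * (\<Prod>i = 1..t. qpoch_inf (fps_X * fps_const (indet i)) fps_X
               * qpoch_inf (fps_X * fps_const (inverse (indet i))) fps_X
               * qpoch_inf (fps_X * fps_const (indet i ^ 2)) (fps_X ^ 2)
               * qpoch_inf (fps_X * fps_const (inverse (indet i) ^ 2)) (fps_X ^ 2))))
       (DD_cores g)"
  unfolding macdonald_prod_def[symmetric]
proof (intro conjI ballI)
  fix \<omega> assume "\<omega> \<in> DD_cores g"
  then obtain n where n: "\<omega> = core_of t n"
    using bij_betw_imp_surj_on[OF bij_betw_core_of[of t]] assms(2) by blast
  show "even (sum_list \<omega>)" unfolding n by (rule even_sum_list_core_of)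
  show "mu g t \<omega> i \<ge> 0" if "i \<in> {1..t}" for i
    unfolding n assms(2) using that by (rule mu_core_of_nonneg)
  show "mu g t \<omega> i \<ge> mu g t \<omega> (i + 1)" if "i \<in> {1..<t}" for i
    unfolding n assms(2) using that by (rule mu_core_of_antimono)
next
  \<comment> \<open>Here the scalars are extended; the indeterminates remain in general position
    under the inclusion \<open>to_ac\<close>.\<close>
  obtain \<zeta> :: "laurent fract alg_closure" where \<zeta>: "\<zeta> ^ g = 1" "\<And>i. 0 < i \<Longrightarrow> i < g \<Longrightarrow> \<zeta> ^ i \<noteq> 1"
    using primitive_root_of_unity_exists[of g] assms(2) by auto
  interpret root_of_unity t \<zeta>
    by unfold_locales (use \<zeta> assms(2) in auto)
  define x where "x i = to_ac (indet i)" for i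
  have "((\<lambda>\<omega>. (- 1) ^ (card (H_small_pos g \<omega>) + card (H_small_pos g \<omega> \<inter> diag \<omega>))
          * fps_X ^ (sum_list \<omega> div 2) * fps_const (so_char t x (mu g t \<omega>)))
        has_sum macdonald_prod t x) (DD_cores g)"
    unfolding assms(2)
  proof (rule character_sum[OF assms(1)])
    show "x i \<noteq> 0 \<and> x i ^ (2 * t + 1) \<noteq> 1" for i
    proof -
      have "indet i ^ (2 * t + 1) \<noteq> 1" by (rule indet_power_neq_one) simp
      then show ?thesis
        unfolding x_def to_ac_power[symmetric] to_ac_eq_0_iff to_ac_eq_1_iff using indet_nonzero by blast
    qed
    show "x i \<noteq> x j" if "i \<noteq> j" for i j using that by (simp add: x_def indet_eq_iff)
    show "x i * x j \<noteq> 1" for i j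
      unfolding x_def to_ac_mult[symmetric] to_ac_eq_1_iff by (rule indet_mult_neq_one)
  qed
  then have "((\<lambda>\<omega>. fps_ac ((- 1) ^ (card (H_small_pos g \<omega>) + card (H_small_pos g \<omega> \<inter> diag \<omega>))
          * fps_X ^ (sum_list \<omega> div 2) * fps_const (so_char t indet (mu g t \<omega>))))
        has_sum fps_ac (macdonald_prod t indet)) (DD_cores g)"
    unfolding fps_ac_macdonald_prod x_def so_char_to_ac
    by (simp add: fps_ac_hom.hom_mult fps_ac_hom.hom_power fps_ac_hom.hom_uminus)
  then show "((\<lambda>\<omega>. (- 1) ^ (card (H_small_pos g \<omega>) + card (H_small_pos g \<omega> \<inter> diag \<omega>))
          * fps_X ^ (sum_list \<omega> div 2) * fps_const (so_char t indet (mu g t \<omega>)))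
        has_sum macdonald_prod t indet) (DD_cores g)"
    by (rule has_sum_of_fps_ac)
qed

end
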